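(* For $n\ge 2$ let $P$ be the nearest-neighbour simple random walk on $\{1,\ldots,n\}$ with holding probability $1/2$ at the two endpoints, i.e. $P(1,1)=P(n,n)=1/2$, $P(x,x+1)=1/2$ for $1\le x\le n-1$ and $P(x,x-1)=1/2$ for $2\le x\le n$ (so that $P$ has uniform stationary distribution $\pi$). Let $Q$ be a permutation matrix drawn uniformly at random from the set of all $n\times n$ permutation matrices, and let $\overline{P}(Q):=\frac12(P+QP^*Q)$. For all $\varepsilon \in (0,1)$ there exists $C(\varepsilon)$ (not depending on $n$) such that, with high probability (i.e. with probability tending to $1$ as $n\to\infty$), $$ t_{mix}(\overline{P}(Q),\varepsilon) \leq \frac{\ln n}{\ln 2} + C(\varepsilon) \sqrt{\ln n}. $$
   Context: For a permutation $\psi$ the associated permutation matrix is $Q_\psi(x,y)=\delta_{y=\psi(x)}$; it need not be an involution. $P^*$ is the $\ell^2(\pi)$-adjoint of $P$; here $\pi$ is uniform and $P^*=P^T=P$. The total variation distance is $\|\mu-\nu\|_{TV}=\frac12\sum_x|\mu(x)-\nu(x)|$, and $t_{mix}(K,\varepsilon):=\inf\{t\in\mathbb{N}:\max_x\|K^t(x,\cdot)-\pi\|_{TV}<\varepsilon\}$ for a transition matrix $K$ with stationary distribution $\pi$. *)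

theory Defs
  imports
    "HOL-Probability.Probability_Mass_Function"
    "HOL-Combinatorics.Permutations"
    "Jordan_Normal_Form.Matrix"
begin

text \<open>
  The state space \<open>{1, ..., n}\<close> is represented by \<open>{0, ..., n - 1}\<close>, following the indexing
  convention of \<open>Jordan_Normal_Form.Matrix\<close>: index \<open>i\<close> stands for state \<open>i + 1\<close>.
  Kernels are \<open>n \<times> n\<close> matrices, and functions and measures on the state space are vectors.
\<close>

no_notation vec_nth (infixl \<open>$\<close> 90)
hide_const (open) Finite_Cartesian_Product.vec Finite_Cartesian_Product.row
  Finite_Cartesian_Product.mat
hide_type (open) Finite_Cartesian_Product.vec

definition srw :: "nat \<Rightarrow> real mat" where
  "srw n = mat n n (\<lambda>(x, y).
     if y = x + 1 \<or> x = y + 1 \<or> (x = y \<and> (x = 0 \<or> x = n - 1)) then 1 / 2 else 0)"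

definition uniform_dist :: "nat \<Rightarrow> real vec" where
  "uniform_dist n = vec n (\<lambda>_. 1 / real n)"

definition l2_inner :: "real vec \<Rightarrow> real vec \<Rightarrow> real vec \<Rightarrow> real" where
  "l2_inner \<pi> f g = (\<Sum>x<dim_vec \<pi>. \<pi> $ x * f $ x * g $ x)"

definition is_l2_adjoint :: "real vec \<Rightarrow> real mat \<Rightarrow> real mat \<Rightarrow> bool" where
  "is_l2_adjoint \<pi> P A \<longleftrightarrow> A \<in> carrier_mat (dim_vec \<pi>) (dim_vec \<pi>) \<and>
     (\<forall>f \<in> carrier_vec (dim_vec \<pi>). \<forall>g \<in> carrier_vec (dim_vec \<pi>).
        l2_inner \<pi> (P *\<^sub>v f) g = l2_inner \<pi> f (A *\<^sub>v g))"

text \<open>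
  Well defined for \<open>n \<times> n\<close> matrices when every entry of \<open>\<pi>\<close> is positive; for the uniform
  distribution see \<open>l2_adjoint_uniform_dist\<close> below.
\<close>
definition l2_adjoint :: "real vec \<Rightarrow> real mat \<Rightarrow> real mat" where
  "l2_adjoint \<pi> P = (THE A. is_l2_adjoint \<pi> P A)"

definition permutation_mat :: "nat \<Rightarrow> (nat \<Rightarrow> nat) \<Rightarrow> real mat" where
  "permutation_mat n \<psi> = mat n n (\<lambda>(x, y). if y = \<psi> x then 1 else 0)"

definition permutation_mats :: "nat \<Rightarrow> real mat set" where
  "permutation_mats n = {permutation_mat n \<psi> | \<psi>. \<psi> permutes {..<n}}"

definition random_permutation_mat :: "nat \<Rightarrow> real mat pmf" where
  "random_permutation_mat n = pmf_of_set (permutation_mats n)"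

definition P_bar :: "real vec \<Rightarrow> real mat \<Rightarrow> real mat \<Rightarrow> real mat" where
  "P_bar \<pi> P Q = (1 / 2) \<cdot>\<^sub>m (P + Q * l2_adjoint \<pi> P * Q)"

definition tv_dist :: "real vec \<Rightarrow> real vec \<Rightarrow> real" where
  "tv_dist \<mu> \<nu> = (1 / 2) * (\<Sum>x<dim_vec \<nu>. \<bar>\<mu> $ x - \<nu> $ x\<bar>)"

text \<open>
  Values are in \<^typ>\<open>enat\<close> because the infimum of the empty set has to be infinite.
\<close>
definition t_mix :: "real vec \<Rightarrow> real mat \<Rightarrow> real \<Rightarrow> enat" where
  "t_mix \<pi> K \<epsilon> =
     Inf {enat t | t. Max {tv_dist (row (K ^\<^sub>m t) x) \<pi> | x. x < dim_vec \<pi>} < \<epsilon>}"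

lemma finite_permutation_mats: "finite (permutation_mats n)"
proof -
  have "permutation_mats n = permutation_mat n ` {\<psi>. \<psi> permutes {..<n}}"
    by (auto simp: permutation_mats_def)
  then show ?thesis by (simp add: finite_permutations)
qed

lemma permutation_mats_nonempty: "permutation_mats n \<noteq> {}"
  using permutes_id[of "{..<n}"] unfolding permutation_mats_def by blast

lemma l2_inner_uniform_dist:
  assumes "f \<in> carrier_vec n" "g \<in> carrier_vec n"
  shows "l2_inner (uniform_dist n) f g = (f \<bullet> g) / real n"
  using assms
  by (auto simp: l2_inner_def uniform_dist_def scalar_prod_def sum_divide_distrib
      atLeast0LessThan intro!: sum.cong)

lemma l2_adjoint_uniform_dist:
  assumes P: "P \<in> carrier_mat n n"
  shows "l2_adjoint (uniform_dist n) P = transpose_mat P"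
  unfolding l2_adjoint_def
proof (rule the_equality)
  have dim: "dim_vec (uniform_dist n) = n" by (simp add: uniform_dist_def)
  show "is_l2_adjoint (uniform_dist n) P (transpose_mat P)"
    unfolding is_l2_adjoint_def dim
  proof (intro conjI ballI)
    show "transpose_mat P \<in> carrier_mat n n" using P by simp
  next
    fix f g :: "real vec" assume fg: "f \<in> carrier_vec n" "g \<in> carrier_vec n"
    have "(P *\<^sub>v f) \<bullet> g = g \<bullet> (P *\<^sub>v f)"
      using P fg by (intro comm_scalar_prod[of _ n]) auto
    also have "\<dots> = (transpose_mat P *\<^sub>v g) \<bullet> f"
      using transpose_vec_mult_scalar[OF P fg] by simp
    also have "\<dots> = f \<bullet> (transpose_mat P *\<^sub>v g)"
      using P fg by (intro comm_scalar_prod[of _ n]) auto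
    finally show "l2_inner (uniform_dist n) (P *\<^sub>v f) g
        = l2_inner (uniform_dist n) f (transpose_mat P *\<^sub>v g)"
      using P fg by (subst (1 2) l2_inner_uniform_dist) auto
  qed
  fix A assume "is_l2_adjoint (uniform_dist n) P A"
  then have A: "A \<in> carrier_mat n n"
    and adj: "\<And>f g. f \<in> carrier_vec n \<Longrightarrow> g \<in> carrier_vec n \<Longrightarrow>
      l2_inner (uniform_dist n) (P *\<^sub>v f) g = l2_inner (uniform_dist n) f (A *\<^sub>v g)"
    unfolding is_l2_adjoint_def dim by auto
  show "A = transpose_mat P"
  proof (rule eq_matI)
    fix i j assume "i < dim_row (transpose_mat P)" "j < dim_col (transpose_mat P)"
    then have ij: "i < n" "j < n" using P by auto
    have "(P *\<^sub>v unit_vec n i) \<bullet> unit_vec n j / real n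
        = unit_vec n i \<bullet> (A *\<^sub>v unit_vec n j) / real n"
      using adj[of "unit_vec n i" "unit_vec n j"] A P
      by (simp add: l2_inner_uniform_dist[where n = n] mult_mat_vec_carrier[where n = n])
    then have "(P *\<^sub>v unit_vec n i) \<bullet> unit_vec n j = unit_vec n i \<bullet> (A *\<^sub>v unit_vec n j)"
      using ij by simp
    then show "A $$ (i, j) = transpose_mat P $$ (i, j)"
      using A P ij by simp
  qed (use A P in auto)
qed

end

theory Submission
  imports Defs "HOL-Real_Asymp.Real_Asymp"
begin

text \<open>
  One step of the chain from \<open>x\<close> applies one of four maps, each with probability \<open>1/4\<close>:
  \<open>x \<mapsto> x \<plusminus> 1\<close> and \<open>x \<mapsto> \<psi> (\<psi> x \<plusminus> 1)\<close>, clamped at the endpoints. Unfolding \<open>\<psi>\<close> into fresh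
  values gives a walk on a tree of lines. It spreads at an exponential rate strictly larger than
  \<open>ln 2\<close> per step, so after \<open>0.94 log\<^sub>2 n\<close> steps a typical path has probability below
  \<open>\<theta> = n\<^bsup>\<eta> - 1\<^esup>\<close>, and the bound holds even with \<open>C = 0\<close>.

  With high probability the random permutation makes the path and its image under \<open>\<psi>\<close> an
  expander, so the kernel contracts mean-zero functions in \<open>\<ell>\<^sup>2\<close> by a constant factor. Stop the
  walk when its position in the tree has weight below \<open>\<theta>\<close>. Only about \<open>1/\<theta> = n\<^bsup>1 - \<eta>\<^esup>\<close> values of
  \<open>\<psi>\<close> are revealed before that, so a revealed value is close to earlier ones (an accident) with
  probability about \<open>n\<^bsup>-\<eta>\<^esup>\<close>. Where the accidents carry little weight, the stopped law has density
  at most \<open>n\<^bsup>\<eta>\<^esup>\<close>, and the contraction removes this factor in \<open>O(\<eta> ln n)\<close> steps.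

  For a fixed starting point accidents have probability \<open>n\<^bsup>-\<eta>\<^esup>\<close> only. But from every \<open>x\<close> there are
  many disjoint branches within constant distance, explored one after the other, so all of them
  fail with probability \<open>o(1/n)\<close>. Hence every vertex has a good starting point within constant
  distance, which the walk hits within a further \<open>0.02 log\<^sub>2 n\<close> steps.
\<close>

section \<open>The kernel as an average of four maps\<close>

text \<open>\<open>Q\<close> acts only forwards: a long move is \<psi>, a unit move, \<psi> again.
  Hence only values of \<psi> itself are revealed, never preimages, and the walk on the tree of
  lines cannot return to a line it has left. Its Green function is therefore explicit, a product of
  geometric factors along the node (\<open>state_weight\<close>), and it bounds the occupation of a
  state at every time at once. The margin over ln 2 comes from the square root of this Green
  function, whose mean after j steps is at most 0.69^j with 0.69 < 1 / sqrt 2. By Markov's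
  inequality the weight is still at least \<theta> with probability at most 0.69^j / sqrt \<theta>,
  and 0.69^0.94 < 2^(-1/2). The exponent \<eta> is matched to the contraction rate so that 0.02
  log_2 n steps gain n^(-2\<eta>) in the squared norm against a density n^\<eta>. The phases add up
  to 0.98 log_2 n. The kernel is not reversible in general. It is doubly stochastic, though, and an
  average of four maps, so convexity of the square gives the contraction one step at a time.\<close>

definition neighbour :: "nat \<Rightarrow> bool \<Rightarrow> nat \<Rightarrow> nat" where
  "neighbour n \<sigma> x = (if \<sigma> then min (x + 1) (n - 1) else x - 1)"

fun step :: "nat \<Rightarrow> (nat \<Rightarrow> nat) \<Rightarrow> bool \<times> bool \<Rightarrow> nat \<Rightarrow> nat" where
  "step n \<psi> (q, \<sigma>) x = (if q then \<psi> (neighbour n \<sigma> (\<psi> x)) else neighbour n \<sigma> x)"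

definition kernel_op :: "nat \<Rightarrow> (nat \<Rightarrow> nat) \<Rightarrow> (nat \<Rightarrow> real) \<Rightarrow> nat \<Rightarrow> real" where
  "kernel_op n \<psi> f x = (\<Sum>l\<in>UNIV. f (step n \<psi> l x)) / 4"

lemma UNIV_letters: "(UNIV :: (bool \<times> bool) set) = {(True, True), (True, False), (False, True), (False, False)}"
  by auto

lemma kernel_op_expand:
  "kernel_op n \<psi> f x = (f (neighbour n True x) + f (neighbour n False x)
     + f (\<psi> (neighbour n True (\<psi> x))) + f (\<psi> (neighbour n False (\<psi> x)))) / 4"
  unfolding kernel_op_def UNIV_letters by simp

lemma neighbour_less: "x < n \<Longrightarrow> neighbour n \<sigma> x < n"
  by (auto simp: neighbour_def)

lemma permutes_less: "\<psi> permutes {..<n} \<Longrightarrow> x < n \<Longrightarrow> \<psi> x < n"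
  using permutes_in_image[of \<psi> "{..<n}" x] by auto

lemma step_less: "\<psi> permutes {..<n} \<Longrightarrow> x < n \<Longrightarrow> step n \<psi> l x < n"
  by (cases l) (auto simp: neighbour_less permutes_less)

lemma mat_mult_apply:
  fixes A B :: "real mat"
  assumes A: "A \<in> carrier_mat n n" and B: "B \<in> carrier_mat n n" and x: "x < n"
  shows "(\<Sum>y<n. (A * B) $$ (x, y) * f y) = (\<Sum>z<n. A $$ (x, z) * (\<Sum>y<n. B $$ (z, y) * f y))"
proof -
  have "(\<Sum>y<n. (A * B) $$ (x, y) * f y) = (\<Sum>y<n. \<Sum>z<n. A $$ (x, z) * B $$ (z, y) * f y)"
    using A B x
    by (intro sum.cong refl) (simp add: scalar_prod_def sum_distrib_right atLeast0LessThan)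
  also have "\<dots> = (\<Sum>z<n. \<Sum>y<n. A $$ (x, z) * B $$ (z, y) * f y)"
    by (rule sum.swap)
  finally show ?thesis by (simp add: sum_distrib_left mult.assoc)
qed

lemma permutation_mat_apply:
  assumes "\<psi> permutes {..<n}" "x < n"
  shows "(\<Sum>y<n. permutation_mat n \<psi> $$ (x, y) * f y) = f (\<psi> x)"
proof -
  have "(\<Sum>y<n. permutation_mat n \<psi> $$ (x, y) * f y) = (\<Sum>y<n. if y = \<psi> x then f y else 0)"
    using assms by (intro sum.cong) (auto simp: permutation_mat_def)
  also have "\<dots> = f (\<psi> x)"
    using permutes_less[OF assms] by simp
  finally show ?thesis .
qed

text \<open>Holding at an endpoint is a clamped move: \<open>min\<close> clamps on the right,
  truncated subtraction of natural numbers on the left. For \<open>n \<ge> 2\<close> the two moves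
  from \<open>x\<close> have different targets, so each entry of the row is hit at most
  once.\<close>

lemma srw_apply:
  assumes "2 \<le> n" "x < n"
  shows "(\<Sum>y<n. srw n $$ (x, y) * f y) = (f (neighbour n True x) + f (neighbour n False x)) / 2"
proof -
  have "(\<Sum>y<n. srw n $$ (x, y) * f y)
      = (\<Sum>y<n. (if y = neighbour n True x then f y / 2 else 0) + (if y = neighbour n False x then f y / 2 else 0))"
  proof (intro sum.cong refl)
    fix y assume "y \<in> {..<n}"
    then have "srw n $$ (x, y) = (if y = neighbour n True x then 1 / 2 else 0) + (if y = neighbour n False x then 1 / 2 else 0)"
      using assms by (cases "x = 0"; cases "x = n - 1") (auto simp: srw_def neighbour_def min_def)
    then show "srw n $$ (x, y) * f y
        = (if y = neighbour n True x then f y / 2 else 0) + (if y = neighbour n False x then f y / 2 else 0)"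
      by simp
  qed
  also have "\<dots> = (f (neighbour n True x) + f (neighbour n False x)) / 2"
    using neighbour_less[OF assms(2)] by (simp add: sum.distrib)
  finally show ?thesis .
qed

lemma srw_symmetric: "transpose_mat (srw n) = srw n"
  by (rule eq_matI) (auto simp: srw_def)

lemma P_bar_carrier: "P_bar (uniform_dist n) (srw n) (permutation_mat n \<psi>) \<in> carrier_mat n n"
  by (auto simp: P_bar_def srw_def permutation_mat_def)

lemma P_bar_apply:
  assumes n: "2 \<le> n" "x < n" and p: "\<psi> permutes {..<n}"
  shows "(\<Sum>y<n. P_bar (uniform_dist n) (srw n) (permutation_mat n \<psi>) $$ (x, y) * f y)
    = kernel_op n \<psi> f x"
proof -
  let ?P = "srw n" and ?Q = "permutation_mat n \<psi>"
  have P: "?P \<in> carrier_mat n n" and Q: "?Q \<in> carrier_mat n n"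
    by (auto simp: srw_def permutation_mat_def)
  have adj: "l2_adjoint (uniform_dist n) ?P = ?P"
    by (simp add: l2_adjoint_uniform_dist[OF P] srw_symmetric)
  have "(\<Sum>y<n. (?Q * ?P * ?Q) $$ (x, y) * f y)
      = (\<Sum>z<n. (?Q * ?P) $$ (x, z) * (\<Sum>y<n. ?Q $$ (z, y) * f y))"
    by (rule mat_mult_apply) (use P Q n in auto)
  also have "\<dots> = (\<Sum>z<n. (?Q * ?P) $$ (x, z) * f (\<psi> z))"
    using permutation_mat_apply[OF p] by simp
  also have "\<dots> = (\<Sum>z<n. ?Q $$ (x, z) * (\<Sum>y<n. ?P $$ (z, y) * f (\<psi> y)))"
    by (rule mat_mult_apply) (use P Q n in auto)
  also have "\<dots> = (\<Sum>y<n. ?P $$ (\<psi> x, y) * f (\<psi> y))"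
    by (rule permutation_mat_apply[OF p n(2)])
  also have "\<dots> = (f (\<psi> (neighbour n True (\<psi> x))) + f (\<psi> (neighbour n False (\<psi> x)))) / 2"
    by (rule srw_apply[OF n(1) permutes_less[OF p n(2)]])
  finally have 1: "(\<Sum>y<n. (?Q * ?P * ?Q) $$ (x, y) * f y)
      = (f (\<psi> (neighbour n True (\<psi> x))) + f (\<psi> (neighbour n False (\<psi> x)))) / 2" .
  have "(\<Sum>y<n. P_bar (uniform_dist n) ?P ?Q $$ (x, y) * f y)
      = (\<Sum>y<n. (?P $$ (x, y) * f y + (?Q * ?P * ?Q) $$ (x, y) * f y) / 2)"
    unfolding P_bar_def adj using P Q n(2)
    by (intro sum.cong refl) (simp add: algebra_simps)
  also have "\<dots> = ((f (neighbour n True x) + f (neighbour n False x)) / 2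
      + (f (\<psi> (neighbour n True (\<psi> x))) + f (\<psi> (neighbour n False (\<psi> x)))) / 2) / 2"
    unfolding sum_divide_distrib[symmetric] sum.distrib 1 srw_apply[OF n] ..
  finally show ?thesis unfolding kernel_op_expand by (simp add: field_simps)
qed

lemma P_bar_pow_apply:
  assumes n: "2 \<le> n" "x < n" and p: "\<psi> permutes {..<n}"
  shows "(\<Sum>y<n. (P_bar (uniform_dist n) (srw n) (permutation_mat n \<psi>) ^\<^sub>m t) $$ (x, y) * f y)
    = (kernel_op n \<psi> ^^ t) f x"
proof (induction t arbitrary: f)
  case 0
  have "(\<Sum>y<n. (1\<^sub>m n) $$ (x, y) * f y) = (\<Sum>y<n. if y = x then f y else 0)"
    using n by (intro sum.cong) auto
  then show ?case using P_bar_carrier[of n \<psi>] n by simp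
next
  case (Suc t)
  let ?K = "P_bar (uniform_dist n) (srw n) (permutation_mat n \<psi>)"
  have K: "?K \<in> carrier_mat n n" by (rule P_bar_carrier)
  have "(\<Sum>y<n. (?K ^\<^sub>m Suc t) $$ (x, y) * f y)
      = (\<Sum>z<n. (?K ^\<^sub>m t) $$ (x, z) * (\<Sum>y<n. ?K $$ (z, y) * f y))"
    using mat_mult_apply[OF pow_carrier_mat[OF K] K n(2)] by simp
  also have "\<dots> = (\<Sum>z<n. (?K ^\<^sub>m t) $$ (x, z) * kernel_op n \<psi> f z)"
    using P_bar_apply[OF n(1) _ p] by simp
  also have "\<dots> = (kernel_op n \<psi> ^^ t) (kernel_op n \<psi> f) x" by (rule Suc.IH)
  finally show ?case by (simp add: funpow_swap1)
qed

text \<open>Duality: the sign of the difference is a test function that attains twice the total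
  variation distance. It therefore suffices to control \<open>kernel_op\<close> on functions with
  values in [-1, 1].\<close>

lemma tv_dist_le:
  assumes n: "2 \<le> n" "x < n" and p: "\<psi> permutes {..<n}"
    and bound: "\<And>f. (\<And>y. \<bar>f y\<bar> \<le> 1) \<Longrightarrow>
      \<bar>(kernel_op n \<psi> ^^ t) f x - (\<Sum>y<n. f y) / real n\<bar> \<le> 2 * \<delta>"
  shows "tv_dist (row (P_bar (uniform_dist n) (srw n) (permutation_mat n \<psi>) ^\<^sub>m t) x) (uniform_dist n) \<le> \<delta>"
proof -
  let ?M = "P_bar (uniform_dist n) (srw n) (permutation_mat n \<psi>) ^\<^sub>m t"
  define f where "f y = sgn (?M $$ (x, y) - 1 / real n)" for y
  have M: "?M \<in> carrier_mat n n" by (intro pow_carrier_mat P_bar_carrier)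
  have row: "row ?M x $ y - uniform_dist n $ y = ?M $$ (x, y) - 1 / real n" if "y < n" for y
    using carrier_matD[OF M] n that by (simp add: uniform_dist_def)
  have dim: "dim_vec (uniform_dist n) = n" by (simp add: uniform_dist_def)
  have "tv_dist (row ?M x) (uniform_dist n) = (1 / 2) * (\<Sum>y<n. \<bar>?M $$ (x, y) - 1 / real n\<bar>)"
    unfolding tv_dist_def dim using row by simp
  also have "(\<Sum>y<n. \<bar>?M $$ (x, y) - 1 / real n\<bar>) = (\<Sum>y<n. ?M $$ (x, y) * f y - f y / real n)"
    unfolding f_def by (intro sum.cong refl) (simp add: sgn_if)
  also have "\<dots> = (kernel_op n \<psi> ^^ t) f x - (\<Sum>y<n. f y) / real n"
    by (simp add: sum_subtractf P_bar_pow_apply[OF n p] sum_divide_distrib)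
  also have "\<dots> \<le> \<bar>(kernel_op n \<psi> ^^ t) f x - (\<Sum>y<n. f y) / real n\<bar>" by (rule abs_ge_self)
  also have "\<dots> \<le> 2 * \<delta>" by (intro bound) (simp add: f_def sgn_if)
  finally show ?thesis by simp
qed

lemma t_mix_le:
  assumes n: "2 \<le> n" and p: "\<psi> permutes {..<n}" and \<delta>: "\<delta> < \<epsilon>"
    and bound: "\<And>f x. x < n \<Longrightarrow> (\<And>y. \<bar>f y\<bar> \<le> 1) \<Longrightarrow>
      \<bar>(kernel_op n \<psi> ^^ t) f x - (\<Sum>y<n. f y) / real n\<bar> \<le> 2 * \<delta>"
  shows "t_mix (uniform_dist n) (P_bar (uniform_dist n) (srw n) (permutation_mat n \<psi>)) \<epsilon> \<le> enat t"
proof -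
  let ?K = "P_bar (uniform_dist n) (srw n) (permutation_mat n \<psi>)"
  let ?S = "{tv_dist (row (?K ^\<^sub>m t) x) (uniform_dist n) | x. x < dim_vec (uniform_dist n)}"
  have S: "?S = (\<lambda>x. tv_dist (row (?K ^\<^sub>m t) x) (uniform_dist n)) ` {..<n}"
    by (auto simp: uniform_dist_def)
  have "tv_dist (row (?K ^\<^sub>m t) x) (uniform_dist n) < \<epsilon>" if "x < n" for x
    by (rule le_less_trans[OF tv_dist_le[OF n that p] \<delta>]) (rule bound[OF that])
  then have "Max ?S < \<epsilon>"
    unfolding S using n by (subst Max_less_iff) (auto simp: lessThan_empty_iff)
  then show ?thesis unfolding t_mix_def by (intro Inf_lower) auto
qed

text \<open>Turns the uniform law on matrices into the uniform law on permutations, so that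
  probabilities become counts divided by \<open>fact n\<close>.\<close>

lemma permutation_mat_inj: "inj_on (permutation_mat n) {\<psi>. \<psi> permutes {..<n}}"
proof (rule inj_onI)
  fix \<psi> \<phi> assume p: "\<psi> \<in> {\<psi>. \<psi> permutes {..<n}}" "\<phi> \<in> {\<psi>. \<psi> permutes {..<n}}"
    and eq: "permutation_mat n \<psi> = permutation_mat n \<phi>"
  show "\<psi> = \<phi>"
  proof
    fix x
    show "\<psi> x = \<phi> x"
    proof (cases "x < n")
      case True
      then have "\<psi> x < n" using p permutes_less by blast
      then have "permutation_mat n \<psi> $$ (x, \<psi> x) = 1" using True by (simp add: permutation_mat_def)
      then have "permutation_mat n \<phi> $$ (x, \<psi> x) = 1" using eq by simp
      then show ?thesis using True \<open>\<psi> x < n\<close> by (simp add: permutation_mat_def split: if_splits)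
    next
      case False
      then show ?thesis using p by (simp add: permutes_def)
    qed
  qed
qed

lemma random_permutation_mat_prob:
  "measure_pmf.prob (random_permutation_mat n) A
    = real (card {\<psi>. \<psi> permutes {..<n} \<and> permutation_mat n \<psi> \<in> A}) / fact n"
proof -
  let ?P = "{\<psi>. \<psi> permutes {..<n}}"
  have img: "permutation_mats n = permutation_mat n ` ?P"
    by (auto simp: permutation_mats_def)
  have "measure_pmf.prob (random_permutation_mat n) A
      = real (card (permutation_mats n \<inter> A)) / real (card (permutation_mats n))"
    unfolding random_permutation_mat_def
    by (rule measure_pmf_of_set[OF permutation_mats_nonempty finite_permutation_mats])
  also have "card (permutation_mats n) = fact n"
    unfolding img card_image[OF permutation_mat_inj] by (rule card_permutations) auto
  also have "permutation_mats n \<inter> A = permutation_mat n ` {\<psi>. \<psi> permutes {..<n} \<and> permutation_mat n \<psi> \<in> A}"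
    unfolding img by auto
  also have "card \<dots> = card {\<psi>. \<psi> permutes {..<n} \<and> permutation_mat n \<psi> \<in> A}"
    by (rule card_image, rule inj_on_subset[OF permutation_mat_inj]) auto
  finally show ?thesis by simp
qed

section \<open>Spectral gap from edge expansion\<close>

text \<open>Discrete coarea formula by peeling: subtracting the least positive value
  \<open>m\<close> from \<open>g\<close> on its support \<open>S\<close> lowers the sum of
  \<open>g\<close> by \<open>m * card S\<close> and the edge sum by \<open>m\<close> per edge
  leaving \<open>S\<close>. Expansion of \<open>S\<close> compares the two losses, and the support
  has shrunk.\<close>

lemma coarea_inequality:
  fixes g :: "'v \<Rightarrow> real" and a b :: "'e \<Rightarrow> 'v"
  assumes V: "finite V" and I: "finite I" "\<And>i. i \<in> I \<Longrightarrow> a i \<in> V \<and> b i \<in> V" and M: "0 \<le> M"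
    and ex: "\<And>S. S \<subseteq> V \<Longrightarrow> 2 * card S \<le> card V \<Longrightarrow> S \<noteq> {} \<Longrightarrow>
      real (card S) \<le> M * real (card {i \<in> I. (a i \<in> S) \<noteq> (b i \<in> S)})"
    and g: "\<And>x. x \<in> V \<Longrightarrow> 0 \<le> g x" "2 * card {x \<in> V. 0 < g x} \<le> card V"
  shows "(\<Sum>x\<in>V. g x) \<le> M * (\<Sum>i\<in>I. \<bar>g (a i) - g (b i)\<bar>)"
  using g
proof (induction "card {x \<in> V. 0 < g x}" arbitrary: g rule: less_induct)
  case less
  define S where "S = {x \<in> V. 0 < g x}"
  have S: "S \<subseteq> V" "finite S" using V by (auto simp: S_def)
  have zero: "g x = 0" if "x \<in> V" "x \<notin> S" for x
    using less.prems(1)[of x] that by (auto simp: S_def)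
  show ?case
  proof (cases "S = {}")
    case True
    then have "(\<Sum>x\<in>V. g x) = 0" using zero by simp
    then show ?thesis using M by (simp add: sum_nonneg)
  next
    case False
    define m where "m = Min (g ` S)"
    have m_in: "m \<in> g ` S" unfolding m_def using S False by (intro Min_in) auto
    have m_le: "m \<le> g x" if "x \<in> S" for x unfolding m_def using S that by (intro Min_le) auto
    have m0: "0 < m" using m_in by (auto simp: S_def)
    define g' where "g' x = (if x \<in> S then g x - m else g x)" for x
    have g'_nonneg: "0 \<le> g' x" if "x \<in> V" for x
      using that m_le less.prems(1) by (auto simp: g'_def)
    have "{x \<in> V. 0 < g' x} \<subset> {x \<in> V. 0 < g x}"
    proof
      show "{x \<in> V. 0 < g' x} \<subseteq> {x \<in> V. 0 < g x}"
        using m0 by (auto simp: g'_def split: if_splits)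
      from m_in obtain x where "x \<in> S" "m = g x" by auto
      then have "x \<in> {x \<in> V. 0 < g x}" "x \<notin> {x \<in> V. 0 < g' x}" by (auto simp: S_def g'_def)
      then show "{x \<in> V. 0 < g' x} \<noteq> {x \<in> V. 0 < g x}" by blast
    qed
    then have smaller: "card {x \<in> V. 0 < g' x} < card {x \<in> V. 0 < g x}"
      using V by (intro psubset_card_mono) auto
    have IH: "(\<Sum>x\<in>V. g' x) \<le> M * (\<Sum>i\<in>I. \<bar>g' (a i) - g' (b i)\<bar>)"
      using less.prems(2) smaller by (intro less.hyps[OF smaller] g'_nonneg) auto
    have "(\<Sum>x\<in>V. g x) = (\<Sum>x\<in>V. g' x + (if x \<in> S then m else 0))"
      by (intro sum.cong) (auto simp: g'_def)
    also have "\<dots> = (\<Sum>x\<in>V. g' x) + m * real (card S)"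
      using V S by (simp add: sum.distrib sum.If_cases Int_absorb1)
    finally have 1: "(\<Sum>x\<in>V. g x) = (\<Sum>x\<in>V. g' x) + m * real (card S)" .
    have "\<bar>g (a i) - g (b i)\<bar> = \<bar>g' (a i) - g' (b i)\<bar> + (if (a i \<in> S) \<noteq> (b i \<in> S) then m else 0)"
      if "i \<in> I" for i
      using I(2)[OF that] zero m_le m0 less.prems(1)[of "a i"] less.prems(1)[of "b i"]
      by (auto simp: g'_def)
    then have "(\<Sum>i\<in>I. \<bar>g (a i) - g (b i)\<bar>)
        = (\<Sum>i\<in>I. \<bar>g' (a i) - g' (b i)\<bar> + (if (a i \<in> S) \<noteq> (b i \<in> S) then m else 0))"
      by (intro sum.cong) auto
    also have "\<dots> = (\<Sum>i\<in>I. \<bar>g' (a i) - g' (b i)\<bar>) + m * real (card {i \<in> I. (a i \<in> S) \<noteq> (b i \<in> S)})"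
      unfolding sum.distrib using I
      by (subst sum.inter_filter[symmetric]) auto
    finally have 2: "(\<Sum>i\<in>I. \<bar>g (a i) - g (b i)\<bar>)
      = (\<Sum>i\<in>I. \<bar>g' (a i) - g' (b i)\<bar>) + m * real (card {i \<in> I. (a i \<in> S) \<noteq> (b i \<in> S)})" .
    have "m * real (card S) \<le> m * (M * real (card {i \<in> I. (a i \<in> S) \<noteq> (b i \<in> S)}))"
      using less.prems(2) m0 S False by (intro mult_left_mono ex) (auto simp: S_def)
    then show ?thesis unfolding 1 2 using IH by (simp add: algebra_simps)
  qed
qed

text \<open>Cheeger's argument: the coarea inequality for the square of \<open>g\<close>, then
  Cauchy-Schwarz on |g(a) - g(b)| (g(a) + g(b)). The degree bound turns the second factor into the
  squared norm \<open>A\<close>, of which one power cancels.\<close>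

lemma half_poincare:
  fixes g :: "'v \<Rightarrow> real" and a b :: "'e \<Rightarrow> 'v"
  assumes V: "finite V" and I: "finite I" "\<And>i. i \<in> I \<Longrightarrow> a i \<in> V \<and> b i \<in> V" and M: "0 \<le> M"
    and ex: "\<And>S. S \<subseteq> V \<Longrightarrow> 2 * card S \<le> card V \<Longrightarrow> S \<noteq> {} \<Longrightarrow>
      real (card S) \<le> M * real (card {i \<in> I. (a i \<in> S) \<noteq> (b i \<in> S)})"
    and deg: "\<And>h :: 'v \<Rightarrow> real. (\<And>x. 0 \<le> h x) \<Longrightarrow> (\<Sum>i\<in>I. h (a i) + h (b i)) \<le> d * (\<Sum>x\<in>V. h x)"
    and g: "\<And>x. 0 \<le> g x" "2 * card {x \<in> V. 0 < g x} \<le> card V"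
  shows "(\<Sum>x\<in>V. (g x)\<^sup>2) \<le> 2 * d * M\<^sup>2 * (\<Sum>i\<in>I. (g (a i) - g (b i))\<^sup>2)"
proof -
  define A where "A = (\<Sum>x\<in>V. (g x)\<^sup>2)"
  define E where "E = (\<Sum>i\<in>I. (g (a i) - g (b i))\<^sup>2)"
  have A0: "0 \<le> A" and E0: "0 \<le> E" by (auto simp: A_def E_def sum_nonneg)
  have pos: "{x \<in> V. 0 < (g x)\<^sup>2} = {x \<in> V. 0 < g x}"
    using g(1) by (auto simp: less_le)
  have "A \<le> M * (\<Sum>i\<in>I. \<bar>(g (a i))\<^sup>2 - (g (b i))\<^sup>2\<bar>)"
    unfolding A_def by (rule coarea_inequality[OF V I M ex]) (use g pos in auto)
  also have "(\<Sum>i\<in>I. \<bar>(g (a i))\<^sup>2 - (g (b i))\<^sup>2\<bar>) = (\<Sum>i\<in>I. \<bar>g (a i) - g (b i)\<bar> * (g (a i) + g (b i)))"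
  proof (intro sum.cong refl)
    fix i
    have "\<bar>(g (a i))\<^sup>2 - (g (b i))\<^sup>2\<bar> = \<bar>(g (a i) - g (b i)) * (g (a i) + g (b i))\<bar>"
      by (simp add: power2_eq_square algebra_simps)
    then show "\<bar>(g (a i))\<^sup>2 - (g (b i))\<^sup>2\<bar> = \<bar>g (a i) - g (b i)\<bar> * (g (a i) + g (b i))"
      using g(1)[of "a i"] g(1)[of "b i"] by (simp add: abs_mult)
  qed
  finally have "A\<^sup>2 \<le> (M * (\<Sum>i\<in>I. \<bar>g (a i) - g (b i)\<bar> * (g (a i) + g (b i))))\<^sup>2"
    using A0 by (intro power_mono) auto
  also have "\<dots> = M\<^sup>2 * (\<Sum>i\<in>I. \<bar>g (a i) - g (b i)\<bar> * (g (a i) + g (b i)))\<^sup>2"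
    by (simp add: power_mult_distrib)
  also have "\<dots> \<le> M\<^sup>2 * (E * (\<Sum>i\<in>I. (g (a i) + g (b i))\<^sup>2))"
    unfolding E_def
    using Cauchy_Schwarz_ineq_sum[of "\<lambda>i. \<bar>g (a i) - g (b i)\<bar>" "\<lambda>i. g (a i) + g (b i)" I]
    by (intro mult_left_mono) auto
  also have "\<dots> \<le> M\<^sup>2 * (E * (2 * d * A))"
  proof -
    have "(\<Sum>i\<in>I. (g (a i) + g (b i))\<^sup>2) \<le> (\<Sum>i\<in>I. 2 * ((g (a i))\<^sup>2 + (g (b i))\<^sup>2))"
    proof (intro sum_mono)
      fix i
      show "(g (a i) + g (b i))\<^sup>2 \<le> 2 * ((g (a i))\<^sup>2 + (g (b i))\<^sup>2)"
        using sum_squares_bound[of "g (a i)" "g (b i)"] by (simp add: power2_sum)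
    qed
    also have "\<dots> \<le> 2 * (d * A)"
      unfolding sum_distrib_left[symmetric] A_def by (intro mult_left_mono deg) auto
    finally show ?thesis using E0 by (intro mult_left_mono) auto
  qed
  finally have "A * A \<le> (2 * d * M\<^sup>2 * E) * A" by (simp add: power2_eq_square algebra_simps)
  then have "A \<le> 2 * d * M\<^sup>2 * E \<or> A = 0" using A0 by (auto simp: mult_le_cancel_right)
  \<comment> \<open>For \<open>A = 0\<close> nothing can be cancelled. The right side is nonnegative
    since \<open>deg\<close> for the constant 1 forces \<open>d \<ge> 0\<close> as soon as there is
    an edge.\<close>
  moreover have "0 \<le> 2 * d * M\<^sup>2 * E" if "A = 0"
  proof (cases "I = {}")
    case True
    then show ?thesis by (simp add: E_def)
  next
    case False
    then obtain i where "i \<in> I" by auto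
    then have "V \<noteq> {}" using I by auto
    have "0 \<le> d * (\<Sum>x\<in>V. (1::real))"
      using deg[of "\<lambda>_. 1"] order_trans[of 0 "\<Sum>i\<in>I. (1::real) + 1"] by (simp add: sum_nonneg)
    then have "0 \<le> d" using V \<open>V \<noteq> {}\<close> by (auto simp: zero_le_mult_iff card_gt_0_iff)
    then show ?thesis using E0 by simp
  qed
  ultimately show ?thesis unfolding A_def E_def by auto
qed

text \<open>\<open>c\<close> is the least attained value with at most half of the points strictly
  above it. The next smaller attained value \<open>v\<close> violates this, and the points above
  \<open>v\<close> are exactly those not below \<open>c\<close>.\<close>

lemma median_exists:
  fixes f :: "'v \<Rightarrow> real"
  assumes V: "finite V" "V \<noteq> {}"
  obtains c where "2 * card {x \<in> V. c < f x} \<le> card V" "2 * card {x \<in> V. f x < c} \<le> card V"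
proof -
  define W where "W = {v \<in> f ` V. 2 * card {x \<in> V. v < f x} \<le> card V}"
  have empty: "{x \<in> V. Max (f ` V) < f x} = {}"
    using V by (auto simp: not_less)
  have "Max (f ` V) \<in> f ` V" using V by (intro Max_in) auto
  then have "Max (f ` V) \<in> W"
    unfolding W_def mem_Collect_eq empty by simp
  then have "W \<noteq> {}" by blast
  have "finite W" using V by (simp add: W_def)
  define c where "c = Min W"
  have c: "c \<in> W" unfolding c_def by (rule Min_in) fact+
  have "2 * card {x \<in> V. f x < c} \<le> card V"
  proof (cases "{x \<in> V. f x < c} = {}")
    case True
    then show ?thesis by (simp only: card.empty)
  next
    case False
    define v where "v = Max (f ` {x \<in> V. f x < c})"
    have v: "v \<in> f ` {x \<in> V. f x < c}" unfolding v_def using V False by (intro Max_in) auto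
    have v_max: "f x \<le> v" if "x \<in> V" "f x < c" for x
      unfolding v_def using V that by (intro Max_ge) auto
    have "v \<notin> W" using v Min_le[OF \<open>finite W\<close>, of v] by (auto simp: c_def)
    then have "card V < 2 * card {x \<in> V. v < f x}" using v by (auto simp: W_def)
    moreover have "{x \<in> V. v < f x} = V - {x \<in> V. f x < c}"
      using v v_max by (force simp: not_less)
    ultimately show ?thesis using V by (simp add: card_Diff_subset card_mono)
  qed
  then show ?thesis using c that by (auto simp: W_def)
qed

lemma positive_negative_part_bound:
  fixes u w :: real
  shows "(max u 0 - max w 0)\<^sup>2 + (max (- u) 0 - max (- w) 0)\<^sup>2 \<le> (u - w)\<^sup>2"
proof -
  have "0 \<le> - (2 * u * w)" if "(u \<le> 0 \<and> 0 \<le> w) \<or> (0 \<le> u \<and> w \<le> 0)"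
    using that by (auto simp: mult_nonneg_nonpos mult_nonpos_nonneg)
  then show ?thesis
    by (cases "0 \<le> u"; cases "0 \<le> w") (auto simp: max_def power2_diff power2_commute)
qed

text \<open>After subtraction of a median the positive and the negative part each live on at most
  half of the vertices, where \<open>half_poincare\<close> applies. Shifting a mean-zero function by
  \<open>c\<close> only increases its square sum.\<close>

lemma poincare_from_expansion:
  fixes f :: "'v \<Rightarrow> real" and a b :: "'e \<Rightarrow> 'v"
  assumes V: "finite V" and I: "finite I" "\<And>i. i \<in> I \<Longrightarrow> a i \<in> V \<and> b i \<in> V"
    and M: "0 \<le> M" and d: "0 \<le> d"
    and ex: "\<And>S. S \<subseteq> V \<Longrightarrow> 2 * card S \<le> card V \<Longrightarrow> S \<noteq> {} \<Longrightarrow>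
      real (card S) \<le> M * real (card {i \<in> I. (a i \<in> S) \<noteq> (b i \<in> S)})"
    and deg: "\<And>h :: 'v \<Rightarrow> real. (\<And>x. 0 \<le> h x) \<Longrightarrow> (\<Sum>i\<in>I. h (a i) + h (b i)) \<le> d * (\<Sum>x\<in>V. h x)"
    and f: "(\<Sum>x\<in>V. f x) = 0"
  shows "(\<Sum>x\<in>V. (f x)\<^sup>2) \<le> 2 * d * M\<^sup>2 * (\<Sum>i\<in>I. (f (a i) - f (b i))\<^sup>2)"
proof (cases "V = {}")
  case True
  then show ?thesis using d by (simp add: sum_nonneg)
next
  case False
  obtain c where c: "2 * card {x \<in> V. c < f x} \<le> card V" "2 * card {x \<in> V. f x < c} \<le> card V"
    using median_exists[OF V False] .
  define p where "p x = max (f x - c) 0" for x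
  define q where "q x = max (- (f x - c)) 0" for x
  have "{x \<in> V. 0 < p x} = {x \<in> V. c < f x}" "{x \<in> V. 0 < q x} = {x \<in> V. f x < c}"
    by (auto simp: p_def q_def)
  then have P: "(\<Sum>x\<in>V. (p x)\<^sup>2) \<le> 2 * d * M\<^sup>2 * (\<Sum>i\<in>I. (p (a i) - p (b i))\<^sup>2)"
    and Q: "(\<Sum>x\<in>V. (q x)\<^sup>2) \<le> 2 * d * M\<^sup>2 * (\<Sum>i\<in>I. (q (a i) - q (b i))\<^sup>2)"
    using c by (auto intro!: half_poincare[OF V I M ex deg] simp: p_def q_def)
  have "(\<Sum>x\<in>V. (f x)\<^sup>2) \<le> (\<Sum>x\<in>V. (f x)\<^sup>2) + c\<^sup>2 * real (card V) - 2 * c * (\<Sum>x\<in>V. f x)"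
    using f by simp
  also have "\<dots> = (\<Sum>x\<in>V. (f x - c)\<^sup>2)"
    by (simp add: power2_diff sum.distrib sum_subtractf sum_distrib_left[symmetric] sum_distrib_right[symmetric] algebra_simps)
  also have "\<dots> = (\<Sum>x\<in>V. (p x)\<^sup>2) + (\<Sum>x\<in>V. (q x)\<^sup>2)"
    unfolding sum.distrib[symmetric] by (intro sum.cong) (auto simp: p_def q_def max_def power2_commute)
  also have "\<dots> \<le> 2 * d * M\<^sup>2 * (\<Sum>i\<in>I. (p (a i) - p (b i))\<^sup>2 + (q (a i) - q (b i))\<^sup>2)"
    using P Q by (simp add: sum.distrib algebra_simps)
  also have "\<dots> \<le> 2 * d * M\<^sup>2 * (\<Sum>i\<in>I. (f (a i) - f (b i))\<^sup>2)"
  proof (intro mult_left_mono sum_mono)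
    fix i
    show "(p (a i) - p (b i))\<^sup>2 + (q (a i) - q (b i))\<^sup>2 \<le> (f (a i) - f (b i))\<^sup>2"
      using positive_negative_part_bound[of "f (a i) - c" "f (b i) - c"] by (simp add: p_def q_def)
  qed (use d in auto)
  finally show ?thesis .
qed

text \<open>The clamped walk is doubly stochastic: an endpoint has one neighbour fewer, which its
  own clamped move makes up for.\<close>

lemma sum_neighbour:
  fixes h :: "nat \<Rightarrow> real"
  shows "(\<Sum>x<n. h (neighbour n True x) + h (neighbour n False x)) = 2 * (\<Sum>x<n. h x)"
proof (cases n)
  case (Suc m)
  have "(\<Sum>x<Suc m. h (neighbour n True x)) = (\<Sum>x<m. h (Suc x)) + h m"
    by (simp add: neighbour_def Suc)
  moreover have "(\<Sum>x<Suc m. h (neighbour n False x)) = h 0 + (\<Sum>x<m. h x)"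
    unfolding sum.lessThan_Suc_shift by (simp add: neighbour_def Suc)
  moreover have "(\<Sum>x<Suc m. h x) = h 0 + (\<Sum>x<m. h (Suc x))" "(\<Sum>x<Suc m. h x) = (\<Sum>x<m. h x) + h m"
    using sum.lessThan_Suc_shift[of h m] by auto
  ultimately show ?thesis using Suc by (simp add: sum.distrib)
qed simp

lemma sum_permutes:
  fixes h :: "nat \<Rightarrow> real"
  assumes "\<psi> permutes {..<n}"
  shows "(\<Sum>x<n. h (\<psi> x)) = (\<Sum>x<n. h x)"
  using sum.permute[OF assms, of h] by (simp add: comp_def)

text \<open>
  The edge joining the two neighbours of \<open>x\<close> is indexed by \<open>x\<close>; these edges form a single \<open>n\<close>-cycle.
\<close>
definition boundary :: "nat \<Rightarrow> nat set \<Rightarrow> nat set" where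
  "boundary n S = {x \<in> {..<n}. (neighbour n True x \<in> S) \<noteq> (neighbour n False x \<in> S)}"

definition expanding :: "nat \<Rightarrow> nat \<Rightarrow> (nat \<Rightarrow> nat) \<Rightarrow> bool" where
  "expanding n M \<psi> \<longleftrightarrow> (\<forall>S \<subseteq> {..<n}. S \<noteq> {} \<longrightarrow> 2 * card S \<le> n \<longrightarrow>
     card S \<le> M * (card (boundary n S) + card (boundary n {x \<in> {..<n}. \<psi> x \<in> S})))"

text \<open>The square of a mean of four numbers falls short of the mean of the squares by at least
  the within-pair differences. Summed over \<open>x\<close>, one step loses at least an eighth of
  the energy \<open>E\<close> on two n-cycles, the second being the image of the first under \<psi>.
  The union has degree 4, so the Poincare constant is \<open>2 * 4 * M^2\<close>, and 8 * 8 is the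
  64. Expansion is required of the union, as a single cycle has none.\<close>

lemma kernel_op_contraction:
  assumes p: "\<psi> permutes {..<n}" and ex: "expanding n M \<psi>" and M: "0 < M"
    and f: "(\<Sum>x<n. f x) = 0"
  shows "(\<Sum>x<n. (kernel_op n \<psi> f x)\<^sup>2) \<le> (1 - 1 / (64 * real M ^ 2)) * (\<Sum>x<n. (f x)\<^sup>2)"
proof -
  let ?u = "\<lambda>x. f (neighbour n True x)" and ?v = "\<lambda>x. f (neighbour n False x)"
  let ?u' = "\<lambda>x. f (\<psi> (neighbour n True x))" and ?v' = "\<lambda>x. f (\<psi> (neighbour n False x))"
  define a where "a = (\<lambda>(x, s). if s then neighbour n True x else \<psi> (neighbour n True x))"
  define b where "b = (\<lambda>(x, s). if s then neighbour n False x else \<psi> (neighbour n False x))"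
  let ?I = "{..<n} \<times> (UNIV :: bool set)"
  have split: "(\<Sum>i\<in>?I. h (a i) (b i)) = (\<Sum>x<n. h (neighbour n True x) (neighbour n False x))
      + (\<Sum>x<n. h (\<psi> (neighbour n True x)) (\<psi> (neighbour n False x)))" for h :: "nat \<Rightarrow> nat \<Rightarrow> real"
  proof -
    have "(\<Sum>i\<in>?I. h (a i) (b i)) = (\<Sum>x<n. \<Sum>s\<in>UNIV. h (a (x, s)) (b (x, s)))"
      by (simp only: sum.cartesian_product case_prod_eta) (simp add: split_def)
    then show ?thesis by (simp add: UNIV_bool a_def b_def sum.distrib)
  qed
  have perm: "(\<Sum>x<n. h (\<psi> (neighbour n True x)) + h (\<psi> (neighbour n False x))) = 2 * (\<Sum>x<n. h x)" for h :: "nat \<Rightarrow> real"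
    using sum_neighbour[of "\<lambda>x. h (\<psi> x)" n] sum_permutes[OF p, of h] by simp
  define E where "E = (\<Sum>i\<in>?I. (f (a i) - f (b i))\<^sup>2)"
  have "(\<Sum>x<n. (f x)\<^sup>2) \<le> 2 * 4 * (real M)\<^sup>2 * E"
    unfolding E_def
  proof (rule poincare_from_expansion[where V = "{..<n}"])
    fix S assume S: "S \<subseteq> {..<n}" "2 * card S \<le> card {..<n}" "S \<noteq> {}"
    have *: "{i \<in> ?I. (a i \<in> S) \<noteq> (b i \<in> S)}
        = boundary n S \<times> {True} \<union> boundary n {x \<in> {..<n}. \<psi> x \<in> S} \<times> {False}"
      using neighbour_less by (auto simp: a_def b_def boundary_def split: if_splits)
    have "card {i \<in> ?I. (a i \<in> S) \<noteq> (b i \<in> S)}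
        = card (boundary n S) + card (boundary n {x \<in> {..<n}. \<psi> x \<in> S})"
      unfolding * by (subst card_Un_disjoint) (auto simp: boundary_def card_cartesian_product)
    moreover have "card S \<le> M * (card (boundary n S) + card (boundary n {x \<in> {..<n}. \<psi> x \<in> S}))"
      using ex S unfolding expanding_def by auto
    ultimately show "real (card S) \<le> real M * real (card {i \<in> ?I. (a i \<in> S) \<noteq> (b i \<in> S)})"
      by (simp only: of_nat_mult[symmetric] of_nat_le_iff)
  next
    fix h :: "nat \<Rightarrow> real"
    show "(\<Sum>i\<in>?I. h (a i) + h (b i)) \<le> 4 * (\<Sum>x<n. h x)"
      unfolding split[of "\<lambda>x y. h x + h y"] sum_neighbour perm by simp
  qed (use f neighbour_less permutes_less[OF p] in \<open>auto simp: a_def b_def\<close>)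
  then have E: "(\<Sum>x<n. (f x)\<^sup>2) / (8 * (real M)\<^sup>2) \<le> E"
    using M by (simp add: field_simps)
  have "(\<Sum>x<n. (kernel_op n \<psi> f x)\<^sup>2)
      \<le> (\<Sum>x<n. ((?u x)\<^sup>2 + (?v x)\<^sup>2) / 4 - (?u x - ?v x)\<^sup>2 / 8
          + (((?u' (\<psi> x))\<^sup>2 + (?v' (\<psi> x))\<^sup>2) / 4 - (?u' (\<psi> x) - ?v' (\<psi> x))\<^sup>2 / 8))"
  proof (intro sum_mono)
    fix x
    have *: "((s + t + s' + t') / 4)\<^sup>2 \<le> (s\<^sup>2 + t\<^sup>2) / 4 - (s - t)\<^sup>2 / 8 + ((s'\<^sup>2 + t'\<^sup>2) / 4 - (s' - t')\<^sup>2 / 8)"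
      for s t s' t' :: real
    proof -
      have "(s\<^sup>2 + t\<^sup>2) / 4 - (s - t)\<^sup>2 / 8 + ((s'\<^sup>2 + t'\<^sup>2) / 4 - (s' - t')\<^sup>2 / 8) - ((s + t + s' + t') / 4)\<^sup>2
          = ((s + t - s' - t') / 4)\<^sup>2"
        by (simp add: power2_eq_square field_simps)
      then show ?thesis using zero_le_power2[of "(s + t - s' - t') / 4"] by linarith
    qed
    show "(kernel_op n \<psi> f x)\<^sup>2 \<le> ((?u x)\<^sup>2 + (?v x)\<^sup>2) / 4 - (?u x - ?v x)\<^sup>2 / 8
          + (((?u' (\<psi> x))\<^sup>2 + (?v' (\<psi> x))\<^sup>2) / 4 - (?u' (\<psi> x) - ?v' (\<psi> x))\<^sup>2 / 8)"
      unfolding kernel_op_expand by (rule *)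
  qed
  also have "\<dots> = (\<Sum>x<n. ((?u x)\<^sup>2 + (?v x)\<^sup>2)) / 4 - (\<Sum>x<n. (?u x - ?v x)\<^sup>2) / 8
      + (\<Sum>x<n. ((?u' x)\<^sup>2 + (?v' x)\<^sup>2) / 4 - (?u' x - ?v' x)\<^sup>2 / 8)"
    unfolding sum_permutes[OF p, of "\<lambda>x. ((?u' x)\<^sup>2 + (?v' x)\<^sup>2) / 4 - (?u' x - ?v' x)\<^sup>2 / 8", symmetric]
    by (simp add: sum.distrib sum_subtractf sum_divide_distrib[symmetric] add_divide_distrib)
  also have "\<dots> = (\<Sum>x<n. (f x)\<^sup>2) - E / 8"
    unfolding E_def split[of "\<lambda>x y. (f x - f y)\<^sup>2"]
    using sum_neighbour[of "\<lambda>x. (f x)\<^sup>2" n] perm[of "\<lambda>x. (f x)\<^sup>2"]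
    by (simp only: sum_subtractf sum_divide_distrib[symmetric]) (simp add: add_divide_distrib)
  also have "\<dots> \<le> (\<Sum>x<n. (f x)\<^sup>2) - ((\<Sum>x<n. (f x)\<^sup>2) / (8 * (real M)\<^sup>2)) / 8"
    using E by simp
  also have "\<dots> = (1 - 1 / (64 * real M ^ 2)) * (\<Sum>x<n. (f x)\<^sup>2)"
    by (simp add: algebra_simps)
  finally show ?thesis .
qed

section \<open>Expansion of the random graph\<close>

text \<open>Edge 0 joins 0 and 1, and edge z + 1 joins z and z + 2, so membership propagates from 0
  through both parities. A set is thus coded by its boundary and one bit, which makes sets with
  small boundary few.\<close>

lemma boundary_determines:
  assumes n: "2 \<le> n" and S: "S \<subseteq> {..<n}" "S' \<subseteq> {..<n}"
    and eq: "boundary n S = boundary n S'" "(0 \<in> S) = (0 \<in> S')"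
  shows "S = S'"
proof -
  have edge: "(neighbour n True x \<in> S) \<noteq> (neighbour n False x \<in> S) \<longleftrightarrow> (neighbour n True x \<in> S') \<noteq> (neighbour n False x \<in> S')"
    if "x < n" for x
    using eq(1) that unfolding boundary_def set_eq_iff by blast
  have "x \<in> S \<longleftrightarrow> x \<in> S'" if "x < n" for x
    using that
  proof (induction x rule: less_induct)
    case (less x)
    consider "x = 0" | "x = 1" | z where "x = z + 2" by (metis One_nat_def Suc_1 add.commute add_2_eq_Suc not0_implies_Suc)
    then show ?case
    proof cases
      case 1
      then show ?thesis using eq(2) by simp
    next
      case 2
      then show ?thesis using edge[of 0] eq(2) n by (auto simp: neighbour_def min_def split: if_splits)
    next
      case 3
      then show ?thesis using edge[of "z + 1"] less.IH[of z] less.prems by (auto simp: neighbour_def min_def split: if_splits)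
    qed
  qed
  then show ?thesis using S by blast
qed

lemma boundary_nonempty:
  assumes n: "2 \<le> n" and S: "S \<subseteq> {..<n}" "S \<noteq> {}" "2 * card S \<le> n"
  shows "boundary n S \<noteq> {}"
proof
  assume b: "boundary n S = {}"
  have "S = {}" if "0 \<notin> S"
    by (rule boundary_determines[OF n S(1)]) (use b that in \<open>auto simp: boundary_def\<close>)
  moreover have "S = {..<n}" if "0 \<in> S"
    by (rule boundary_determines[OF n S(1)]) (use b that n neighbour_less in \<open>auto simp: boundary_def\<close>)
  ultimately have "S = {..<n}" using S(2) by blast
  then show False using S(3) n by simp
qed

lemma card_subsets_le:
  assumes "finite A"
  shows "card {B. B \<subseteq> A \<and> card B \<le> m} = (\<Sum>i\<le>m. card A choose i)"
proof -
  have "{B. B \<subseteq> A \<and> card B \<le> m} = (\<Union>i\<le>m. {B. B \<subseteq> A \<and> card B = i})" by auto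
  also have "card \<dots> = (\<Sum>i\<le>m. card {B. B \<subseteq> A \<and> card B = i})"
    using assms by (intro card_UN_disjoint) auto
  finally show ?thesis using n_subsets[OF assms] by simp
qed

lemma card_small_boundary_le:
  assumes n: "2 \<le> n"
  shows "card {S. S \<subseteq> {..<n} \<and> card S = k \<and> card (boundary n S) \<le> m} \<le> 2 * (\<Sum>i\<le>m. n choose i)"
proof -
  let ?N = "{S. S \<subseteq> {..<n} \<and> card S = k \<and> card (boundary n S) \<le> m}"
  let ?B = "{B. B \<subseteq> {..<n} \<and> card B \<le> m}"
  have "inj_on (\<lambda>S. (boundary n S, 0 \<in> S)) ?N"
    using boundary_determines[OF n] by (intro inj_onI) auto
  then have "card ?N \<le> card (?B \<times> (UNIV :: bool set))"
    by (rule card_inj_on_le) (auto simp: boundary_def)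
  then show ?thesis by (simp add: card_cartesian_product card_subsets_le)
qed

lemma permutation_of_equicardinal_sets:
  assumes A: "finite A" "S \<subseteq> A" "S' \<subseteq> A" "card S = card S'"
  obtains \<pi> where "\<pi> permutes A" "\<pi> ` S = S'"
proof -
  have fin: "finite S" "finite S'" using A finite_subset by auto
  obtain f where f: "bij_betw f S S'"
    using finite_same_card_bij[OF fin A(4)] by auto
  have "card (A - S) = card (A - S')" using A fin by (simp add: card_Diff_subset)
  then obtain g where g: "bij_betw g (A - S) (A - S')"
    using finite_same_card_bij[of "A - S" "A - S'"] A by auto
  define \<pi> where "\<pi> x = (if x \<in> S then f x else if x \<in> A then g x else x)" for x
  have f': "bij_betw \<pi> S S'" using f by (rule bij_betw_cong[THEN iffD1, rotated]) (simp add: \<pi>_def)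
  have g': "bij_betw \<pi> (A - S) (A - S')"
    using g by (rule bij_betw_cong[THEN iffD1, rotated]) (auto simp: \<pi>_def)
  have "bij_betw \<pi> (S \<union> (A - S)) (S' \<union> (A - S'))"
    by (rule bij_betw_combine[OF f' g']) auto
  then have "bij_betw \<pi> A A" using A by (simp add: Un_absorb1)
  then have "\<pi> permutes A"
    by (rule bij_imp_permutes) (use A(2) in \<open>auto simp: \<pi>_def\<close>)
  then show thesis using that f' by (simp add: bij_betw_imp_surj_on)
qed

text \<open>Composing with a permutation that carries one \<open>k\<close>-set to another shows that
  all \<open>k\<close>-sets are equally likely as the image of \<open>S'\<close>, each with
  probability 1 / (n choose k).\<close>

lemma card_permutations_image:
  assumes S: "S \<subseteq> {..<n}" "S' \<subseteq> {..<n}" "card S = k" "card S' = k"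
  shows "card {\<psi>. \<psi> permutes {..<n} \<and> \<psi> ` S' = S} * (n choose k) = fact n"
proof -
  let ?P = "\<lambda>T. {\<psi>. \<psi> permutes {..<n} \<and> \<psi> ` S' = T}"
  let ?K = "{T. T \<subseteq> {..<n} \<and> card T = k}"
  have fin: "finite (?P T)" for T
    by (rule finite_subset[OF _ finite_permutations[of "{..<n}"]]) auto
  have le: "card (?P T1) \<le> card (?P T2)" if T1: "T1 \<in> ?K" and T2: "T2 \<in> ?K" for T1 T2
  proof -
    obtain \<pi> where \<pi>: "\<pi> permutes {..<n}" "\<pi> ` T1 = T2"
      using permutation_of_equicardinal_sets[of "{..<n}" T1 T2] T1 T2 by auto
    have "inj_on (\<lambda>\<psi>. \<pi> \<circ> \<psi>) (?P T1)"
      using permutes_inj[OF \<pi>(1)] by (auto intro!: inj_onI simp: fun_eq_iff inj_def)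
    moreover have "(\<lambda>\<psi>. \<pi> \<circ> \<psi>) ` ?P T1 \<subseteq> ?P T2"
      using \<pi> by (auto intro: permutes_compose simp: image_comp[symmetric])
    ultimately show ?thesis using fin by (rule card_inj_on_le)
  qed
  have "fact n = card {\<psi>. \<psi> permutes {..<n}}"
    using card_permutations[of "{..<n}" n] by simp
  also have "{\<psi>. \<psi> permutes {..<n}} = (\<Union>T\<in>?K. ?P T)"
  proof -
    have "\<psi> ` S' \<in> ?K" if "\<psi> permutes {..<n}" for \<psi>
      using S that permutes_image[OF that] card_image[OF permutes_inj_on[OF that]] by auto
    then show ?thesis by auto
  qed
  also have "card \<dots> = (\<Sum>T\<in>?K. card (?P T))"
    using fin by (intro card_UN_disjoint) auto
  also have "\<dots> = (\<Sum>T\<in>?K. card (?P S))"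
    using S by (intro sum.cong refl antisym le) auto
  also have "\<dots> = card (?P S) * (n choose k)"
    using n_subsets[of "{..<n}" k] by simp
  finally show ?thesis by simp
qed

text \<open>Chernoff bound for the partial binomial sum B: B x^m \<le> (1 + x)^n \<le> e^(n x),
  where x = y / 40 makes the 40th power of the right side equal to e^k. With e \<le> 3 this gives
  B^40 y^k \<le> 120^k. Since y \<le> 1/2 and 120^2 < 2^18, half of the factor y^k pays for
  B^2.\<close>

lemma sum_binomial_power_bound:
  fixes y :: real
  assumes k: "0 < k" "2 * k \<le> n" and m: "40 * m \<le> k" and y: "y = real k / real n"
  shows "(real (\<Sum>i\<le>m. n choose i))\<^sup>2 * y ^ k \<le> sqrt y ^ k"
proof -
  define B where "B = real (\<Sum>i\<le>m. n choose i)"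
  define x where "x = y / 40"
  have n: "0 < n" using k by simp
  have y01: "0 < y" "y \<le> 1 / 2" using k n by (auto simp: y field_simps)
  have x01: "0 < x" "x \<le> 1" using y01 by (auto simp: x_def)
  have "m \<le> n" using k m by simp
  have "B * x ^ m = (\<Sum>i\<le>m. real (n choose i) * x ^ m)"
    by (simp add: B_def sum_distrib_right)
  also have "\<dots> \<le> (\<Sum>i\<le>m. real (n choose i) * x ^ i)"
    using x01 by (intro sum_mono mult_left_mono power_decreasing) auto
  also have "\<dots> \<le> (\<Sum>i\<le>n. real (n choose i) * x ^ i)"
    using x01 \<open>m \<le> n\<close> by (intro sum_mono2) auto
  also have "\<dots> = (x + 1) ^ n" by (simp add: binomial_ring)
  also have "\<dots> \<le> exp x ^ n" using x01 exp_ge_add_one_self[of x] by (intro power_mono) (auto simp: add.commute)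
  finally have B: "B * x ^ m \<le> exp x ^ n" .
  have B0: "0 \<le> B" unfolding B_def by (rule of_nat_0_le_iff)
  have "B ^ 40 * x ^ k \<le> B ^ 40 * x ^ (m * 40)"
    using x01 m B0 by (intro mult_left_mono power_decreasing) auto
  also have "\<dots> = (B * x ^ m) ^ 40" by (simp add: power_mult_distrib power_mult)
  also have "\<dots> \<le> (exp x ^ n) ^ 40" using B B0 x01 by (intro power_mono) auto
  also have "\<dots> = exp (40 * real n * x)" by (simp add: exp_of_nat_mult[symmetric] algebra_simps)
  also have "40 * real n * x = real k" using n by (simp add: x_def y)
  also have "exp (real k) = exp 1 ^ k" using exp_of_nat_mult[of k 1] by simp
  also have "\<dots> \<le> 3 ^ k" using exp_le by (intro power_mono) auto
  finally have "B ^ 40 * x ^ k \<le> 3 ^ k" .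
  then have "B ^ 40 * (x ^ k * 40 ^ k) \<le> 3 ^ k * 40 ^ k" by simp
  then have B40: "B ^ 40 * y ^ k \<le> 120 ^ k" by (simp add: x_def power_mult_distrib[symmetric])
  have "(B\<^sup>2 * sqrt y ^ k) ^ 40 = (B ^ 40 * y ^ k) ^ 2 * (y ^ 18) ^ k"
  proof -
    have "(sqrt y ^ k) ^ 40 = ((sqrt y)\<^sup>2) ^ (20 * k)" by (simp add: power_mult[symmetric] mult.commute)
    also have "\<dots> = y ^ (20 * k)" using y01 by simp
    also have "\<dots> = (y ^ k)\<^sup>2 * (y ^ 18) ^ k" by (simp add: power_mult[symmetric] power_add[symmetric] algebra_simps)
    finally show ?thesis by (simp add: power_mult_distrib power_mult[symmetric] algebra_simps)
  qed
  also have "\<dots> \<le> (120 ^ k) ^ 2 * ((1 / 2) ^ 18) ^ k"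
    using B40 B0 y01 by (intro mult_mono power_mono) auto
  also have "\<dots> = (120 ^ 2 * (1 / 2) ^ 18) ^ k"
    by (simp only: power_mult_distrib power_mult[symmetric] mult.commute[of 2 k])
  also have "\<dots> \<le> 1" by (intro power_le_one) (auto simp: field_simps)
  finally have "B\<^sup>2 * sqrt y ^ k \<le> 1"
    using B0 y01 power_le_imp_le_base[of "B\<^sup>2 * sqrt y ^ k" 39 1] by simp
  then have "(B\<^sup>2 * sqrt y ^ k) * sqrt y ^ k \<le> 1 * sqrt y ^ k"
    using y01 by (intro mult_right_mono) auto
  moreover have "sqrt y ^ k * sqrt y ^ k = y ^ k"
    using y01 by (simp add: power_mult_distrib[symmetric])
  ultimately show ?thesis
    unfolding B_def by (simp add: mult.assoc)
qed

text \<open>Union bound over pairs of \<open>k\<close>-sets \<open>S\<close>, \<open>S'\<close> with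
  \<psi> mapping \<open>S'\<close> onto \<open>S\<close> and both boundaries at most k / 40. Each
  pair has probability 1 / (n choose k), at most (k / n)^k, and the number of pairs is absorbed by
  half of that exponent.\<close>

lemma card_not_expanding_le:
  assumes n: "2 \<le> n"
  shows "real (card {\<psi>. \<psi> permutes {..<n} \<and> \<not> expanding n 40 \<psi>})
    \<le> fact n * (\<Sum>k = 8..n div 2. 4 * sqrt (real k / real n) ^ k)"
proof -
  let ?N = "\<lambda>k. {S. S \<subseteq> {..<n} \<and> card S = k \<and> card (boundary n S) \<le> k div 40}"
  let ?P = "\<lambda>(S, S'). {\<psi>. \<psi> permutes {..<n} \<and> \<psi> ` S' = S}"
  have finN: "finite (?N k)" for k by (rule finite_subset[of _ "Pow {..<n}"]) auto
  have finP: "finite (?P p)" for p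
    by (rule finite_subset[OF _ finite_permutations[of "{..<n}"]]) (auto split: prod.splits)
  have "{\<psi>. \<psi> permutes {..<n} \<and> \<not> expanding n 40 \<psi>} \<subseteq> (\<Union>k\<in>{8..n div 2}. \<Union>p\<in>?N k \<times> ?N k. ?P p)"
  proof
    fix \<psi> assume "\<psi> \<in> {\<psi>. \<psi> permutes {..<n} \<and> \<not> expanding n 40 \<psi>}"
    then have p: "\<psi> permutes {..<n}" and "\<not> expanding n 40 \<psi>" by auto
    then obtain S where S: "S \<subseteq> {..<n}" "S \<noteq> {}" "2 * card S \<le> n"
      and big: "40 * (card (boundary n S) + card (boundary n {x \<in> {..<n}. \<psi> x \<in> S})) < card S"
      unfolding expanding_def by (auto simp: not_le)
    define S' where "S' = {x \<in> {..<n}. \<psi> x \<in> S}"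
    have img: "\<psi> ` S' = S"
    proof
      show "S \<subseteq> \<psi> ` S'"
      proof
        fix y assume y: "y \<in> S"
        then have "y \<in> \<psi> ` {..<n}" using S(1) permutes_image[OF p] by auto
        then show "y \<in> \<psi> ` S'" using y by (auto simp: S'_def)
      qed
    qed (auto simp: S'_def)
    then have "card S' = card S" using card_image[OF permutes_inj_on[OF p], of S'] by simp
    have "0 < card (boundary n S)"
      using boundary_nonempty[OF n S] by (simp add: card_gt_0_iff boundary_def)
    moreover have big': "40 * card (boundary n S) + 40 * card (boundary n S') < card S"
      using big unfolding S'_def by (simp only: distrib_left)
    \<comment> \<open>The nonempty boundary even gives more than 40 points. What is kept is the
      exponent 8, for which terms with k \<le> sqrt n are at most 1 / n^2.\<close>
    ultimately have "8 \<le> card S" by linarith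
    moreover have "card (boundary n S) \<le> card S div 40" "card (boundary n S') \<le> card S div 40"
      using big' by linarith+
    then have "S \<in> ?N (card S)" "S' \<in> ?N (card S)"
      using S(1) \<open>card S' = card S\<close> by (auto simp: S'_def)
    ultimately show "\<psi> \<in> (\<Union>k\<in>{8..n div 2}. \<Union>p\<in>?N k \<times> ?N k. ?P p)"
      using S(3) p img by (intro UN_I[of "card S"] UN_I[of "(S, S')"]) auto
  qed
  then have "card {\<psi>. \<psi> permutes {..<n} \<and> \<not> expanding n 40 \<psi>}
      \<le> card (\<Union>k\<in>{8..n div 2}. \<Union>p\<in>?N k \<times> ?N k. ?P p)"
    using finN finP by (intro card_mono finite_UN_I finite_cartesian_product) auto
  also have "\<dots> \<le> (\<Sum>k = 8..n div 2. card (\<Union>p\<in>?N k \<times> ?N k. ?P p))"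
    by (rule card_UN_le) auto
  also have "\<dots> \<le> (\<Sum>k = 8..n div 2. \<Sum>p\<in>?N k \<times> ?N k. card (?P p))"
    using finN by (intro sum_mono card_UN_le finite_cartesian_product) auto
  finally have "real (card {\<psi>. \<psi> permutes {..<n} \<and> \<not> expanding n 40 \<psi>})
      \<le> (\<Sum>k = 8..n div 2. \<Sum>p\<in>?N k \<times> ?N k. real (card (?P p)))"
    by (simp only: of_nat_sum[symmetric] of_nat_le_iff)
  also have "\<dots> \<le> (\<Sum>k = 8..n div 2. fact n * (4 * sqrt (real k / real n) ^ k))"
  proof (intro sum_mono)
    fix k assume k: "k \<in> {8..n div 2}"
    define B where "B = (\<Sum>i\<le>k div 40. n choose i)"
    have "k \<le> n div 2" using k by simp
    then have kn: "k \<le> n" "2 * k \<le> n" by linarith+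
    have ch: "0 < n choose k" using kn by simp
    have "(\<Sum>p\<in>?N k \<times> ?N k. real (card (?P p))) = (\<Sum>p\<in>?N k \<times> ?N k. fact n / real (n choose k))"
    proof (intro sum.cong refl)
      fix p assume "p \<in> ?N k \<times> ?N k"
      then have "card (?P p) * (n choose k) = fact n"
        using card_permutations_image[of "fst p" n "snd p" k] by (auto simp: split_def)
      then have "real (card (?P p) * (n choose k)) = real (fact n)" by (rule arg_cong)
      then have "real (card (?P p)) * real (n choose k) = fact n"
        by (simp only: of_nat_mult of_nat_fact)
      then show "real (card (?P p)) = fact n / real (n choose k)" using ch by (simp add: field_simps)
    qed
    also have "\<dots> = (real (card (?N k)))\<^sup>2 * (fact n / real (n choose k))"
      by (simp add: card_cartesian_product power2_eq_square)
    also have "\<dots> \<le> (2 * real B)\<^sup>2 * (fact n * (real k / real n) ^ k)"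
    proof (intro mult_mono power_mono)
      show "real (card (?N k)) \<le> 2 * real B"
        using card_small_boundary_le[OF n, of k "k div 40"] unfolding B_def[symmetric] by simp
      have "(real n / real k) ^ k \<le> real (n choose k)"
        using kn by (intro binomial_ge_n_over_k_pow_k) auto
      then have "1 / real (n choose k) \<le> 1 / (real n / real k) ^ k"
        using k n by (intro divide_left_mono) auto
      then show "fact n / real (n choose k) \<le> fact n * (real k / real n) ^ k"
        using mult_left_mono[of "1 / real (n choose k)" "1 / (real n / real k) ^ k" "fact n"]
        by (simp add: power_divide)
    qed auto
    also have "\<dots> = 4 * fact n * ((real B)\<^sup>2 * (real k / real n) ^ k)"
      by (simp add: power_mult_distrib)
    also have "\<dots> \<le> 4 * fact n * sqrt (real k / real n) ^ k"
      unfolding B_def using k kn by (intro mult_left_mono sum_binomial_power_bound) auto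
    finally show "(\<Sum>p\<in>?N k \<times> ?N k. real (card (?P p))) \<le> fact n * (4 * sqrt (real k / real n) ^ k)"
      by simp
  qed
  finally show ?thesis by (simp only: sum_distrib_left)
qed

text \<open>Split at k = sqrt n: small sets pay through the base k / n, large sets through the
  exponent.\<close>

lemma sum_power_ratio_le:
  assumes n: "0 < n"
  shows "(\<Sum>k = 8..n div 2. 4 * sqrt (real k / real n) ^ k)
    \<le> 4 * real n * (1 / (real n)\<^sup>2 + sqrt (1 / 2) powr sqrt (real n))"
proof -
  have "(\<Sum>k = 8..n div 2. 4 * sqrt (real k / real n) ^ k)
      \<le> (\<Sum>k = 8..n div 2. 4 * (1 / (real n)\<^sup>2 + sqrt (1 / 2) powr sqrt (real n)))"
  proof (intro sum_mono mult_left_mono)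
    fix k assume k: "k \<in> {8..n div 2}"
    let ?y = "sqrt (real k / real n)"
    have y1: "0 \<le> ?y" "?y \<le> 1" using k n by auto
    show "?y ^ k \<le> 1 / (real n)\<^sup>2 + sqrt (1 / 2) powr sqrt (real n)"
    proof (cases "real k \<le> sqrt (real n)")
      case True
      have "?y ^ k \<le> ?y ^ (2 * 4)" using y1 k by (intro power_decreasing) auto
      also have "\<dots> = (?y\<^sup>2) ^ 4" by (rule power_mult)
      also have "(?y\<^sup>2) ^ 4 = (real k / real n) ^ 4" by simp
      also have "\<dots> \<le> (sqrt (real n) / real n) ^ 4"
        using True n by (intro power_mono divide_right_mono) auto
      also have "\<dots> = ((sqrt (real n) / real n)\<^sup>2)\<^sup>2" by (simp add: power_mult[symmetric])
      also have "\<dots> = 1 / (real n)\<^sup>2" using n by (simp add: power_divide power2_eq_square)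
      finally show ?thesis by (rule order_trans) simp
    next
      case False
      have "?y \<le> sqrt (1 / 2)" using k n by (intro real_sqrt_le_mono) (auto simp: field_simps)
      then have "?y ^ k \<le> sqrt (1 / 2) ^ k" using y1 by (intro power_mono) auto
      also have "\<dots> = sqrt (1 / 2) powr real k" by (simp add: powr_realpow)
      also have "\<dots> \<le> sqrt (1 / 2) powr sqrt (real n)" using False by (intro powr_mono') auto
      finally show ?thesis by (rule order_trans) simp
    qed
  qed auto
  also have "\<dots> = real (card {8..n div 2}) * (4 * (1 / (real n)\<^sup>2 + sqrt (1 / 2) powr sqrt (real n)))"
    by simp
  also have "\<dots> \<le> real n * (4 * (1 / (real n)\<^sup>2 + sqrt (1 / 2) powr sqrt (real n)))"
    by (intro mult_right_mono) auto
  finally show ?thesis by (simp add: algebra_simps)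
qed

section \<open>Exploration of a random permutation\<close>

text \<open>
  Exchanging the value at the unrevealed point \<open>z \<psi>\<close> with any value not yet revealed leaves the
  history unchanged; double counting these exchanges replaces conditioning on the history.
\<close>
lemma switching_bound:
  fixes E :: "(nat \<Rightarrow> nat) set"
  assumes E: "E \<subseteq> {\<psi>. \<psi> permutes {..<n}}"
    and z: "\<And>\<psi>. \<psi> \<in> E \<Longrightarrow> z \<psi> \<notin> D \<psi>"
    and z_less: "\<And>\<psi>. \<psi> \<in> E \<Longrightarrow> z \<psi> < n"
    and D: "\<And>\<psi>. \<psi> \<in> E \<Longrightarrow> finite (D \<psi>) \<and> card (D \<psi>) \<le> N"
    and B: "\<And>\<psi>. \<psi> \<in> E \<Longrightarrow> finite (B \<psi>) \<and> card (B \<psi>) \<le> b"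
    and determined: "\<And>\<psi> \<phi>. \<psi> \<in> E \<Longrightarrow> \<phi> permutes {..<n} \<Longrightarrow> (\<And>u. u \<in> D \<psi> \<Longrightarrow> \<phi> u = \<psi> u)
      \<Longrightarrow> \<phi> \<in> E \<and> z \<phi> = z \<psi> \<and> B \<phi> = B \<psi>"
  shows "(n - N) * card {\<psi> \<in> E. \<psi> (z \<psi>) \<in> B \<psi>} \<le> b * card E"
proof -
  let ?A = "{\<psi> \<in> E. \<psi> (z \<psi>) \<in> B \<psi>}"
  define S where "S = (SIGMA \<psi>:?A. {..<n} - \<psi> ` D \<psi>)"
  define S' where "S' = (SIGMA \<psi>:E. B \<psi>)"
  define \<Phi> where "\<Phi> = (\<lambda>(\<psi>, y). (Transposition.transpose (\<psi> (z \<psi>)) y \<circ> \<psi>, \<psi> (z \<psi>)))"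
  have finE: "finite E" by (rule finite_subset[OF E]) (simp add: finite_permutations)
  have img: "\<phi> \<in> E \<and> z \<phi> = z \<psi> \<and> B \<phi> = B \<psi>" "\<phi> (z \<psi>) = y"
    if "\<psi> \<in> E" "y < n" "y \<notin> \<psi> ` D \<psi>" "\<phi> = Transposition.transpose (\<psi> (z \<psi>)) y \<circ> \<psi>" for \<psi> \<phi> y
  proof -
    have p: "\<psi> permutes {..<n}" using E that by auto
    have "\<phi> permutes {..<n}"
      unfolding that(4) using p that(2) permutes_less[OF p z_less[OF that(1)]]
      by (intro permutes_compose permutes_swap_id) auto
    moreover have "\<phi> u = \<psi> u" if "u \<in> D \<psi>" for u
    proof -
      have "\<psi> u \<noteq> y" using that \<open>y \<notin> \<psi> ` D \<psi>\<close> by auto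
      moreover have "\<psi> u \<noteq> \<psi> (z \<psi>)"
        using permutes_inj[OF p] z[OF \<open>\<psi> \<in> E\<close>] that by (auto dest: injD)
      ultimately show ?thesis unfolding \<open>\<phi> = _\<close> by (simp add: Transposition.transpose_def)
    qed
    ultimately show "\<phi> \<in> E \<and> z \<phi> = z \<psi> \<and> B \<phi> = B \<psi>" using determined[OF that(1)] by blast
    show "\<phi> (z \<psi>) = y" using that(4) by simp
  qed
  \<comment> \<open>From the exchanged permutation \<tau> the point \<open>z \<psi>\<close> is
    recovered as \<open>z \<tau>\<close>, then \<open>y\<close> as the value of \<tau> there. The
    recorded old value then undoes the transposition.\<close>
  have "inj_on \<Phi> S"
  proof (rule inj_onI)
    fix u v assume u: "u \<in> S" and v: "v \<in> S" and eq: "\<Phi> u = \<Phi> v"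
    obtain \<psi> y \<phi> w where uv: "u = (\<psi>, y)" "v = (\<phi>, w)" by (cases u, cases v) auto
    define \<tau> where "\<tau> = Transposition.transpose (\<psi> (z \<psi>)) y \<circ> \<psi>"
    have \<tau>': "\<tau> = Transposition.transpose (\<phi> (z \<phi>)) w \<circ> \<phi>" and val: "\<psi> (z \<psi>) = \<phi> (z \<phi>)"
      using eq by (auto simp: \<Phi>_def uv \<tau>_def)
    have 1: "z \<tau> = z \<psi>" "\<tau> (z \<psi>) = y" using img[of \<psi> y \<tau>] u \<tau>_def by (auto simp: S_def uv)
    have 2: "z \<tau> = z \<phi>" "\<tau> (z \<phi>) = w" using img[of \<phi> w \<tau>] v \<tau>' by (auto simp: S_def uv)
    have "y = w" using 1 2 by simp
    have "\<psi> = Transposition.transpose (\<psi> (z \<psi>)) y \<circ> \<tau>" unfolding \<tau>_def by (simp add: fun_eq_iff)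
    moreover have "\<phi> = Transposition.transpose (\<phi> (z \<phi>)) w \<circ> \<tau>" unfolding \<tau>' by (simp add: fun_eq_iff)
    ultimately have "\<psi> = \<phi>" using val \<open>y = w\<close> by simp
    then show "u = v" using \<open>y = w\<close> uv by simp
  qed
  moreover have "\<Phi> ` S \<subseteq> S'"
  proof
    fix t assume "t \<in> \<Phi> ` S"
    then obtain \<psi> y where "(\<psi>, y) \<in> S" "t = \<Phi> (\<psi>, y)" by auto
    then show "t \<in> S'" using img[of \<psi> y "Transposition.transpose (\<psi> (z \<psi>)) y \<circ> \<psi>"]
      by (auto simp: S_def S'_def \<Phi>_def)
  qed
  moreover have "finite S'" unfolding S'_def using finE B by (intro finite_SigmaI) auto
  ultimately have "card S \<le> card S'" by (rule card_inj_on_le)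
  also have "card S' = (\<Sum>\<psi>\<in>E. card (B \<psi>))"
    unfolding S'_def using finE B by (intro card_SigmaI) auto
  also have "\<dots> \<le> b * card E" using sum_bounded_above[of E "\<lambda>\<psi>. card (B \<psi>)" b] B by (simp add: mult.commute)
  finally have "card S \<le> b * card E" .
  moreover have "card S = (\<Sum>\<psi>\<in>?A. card ({..<n} - \<psi> ` D \<psi>))"
    unfolding S_def using finE by (intro card_SigmaI) auto
  moreover have "(\<Sum>\<psi>\<in>?A. n - N) \<le> (\<Sum>\<psi>\<in>?A. card ({..<n} - \<psi> ` D \<psi>))"
  proof (intro sum_mono)
    fix \<psi> assume "\<psi> \<in> ?A"
    then have "\<psi> \<in> E" by simp
    then have "card (\<psi> ` D \<psi>) \<le> N" using D card_image_le[of "D \<psi>" \<psi>] by (meson le_trans)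
    then show "n - N \<le> card ({..<n} - \<psi> ` D \<psi>)"
      using D[OF \<open>\<psi> \<in> E\<close>] diff_card_le_card_Diff[of "\<psi> ` D \<psi>" "{..<n}"] by simp
  qed
  ultimately show ?thesis by (simp add: mult.commute)
qed

text \<open>
  A node is the list of displacements leading to it, the last one first, so \<open>tl\<close> is the parent;
  the landing point of \<open>k # v\<close> is \<open>\<psi>\<close> of the point at displacement \<open>k\<close> from the landing point of \<open>v\<close>.
  The exploration processes a list of nodes from its end and discards a landing point within
  distance \<open>2 * R\<close> of an earlier one.
\<close>
definition query :: "nat \<Rightarrow> int \<Rightarrow> nat" where
  "query l k = nat (int l + k)"

definition far :: "nat \<Rightarrow> nat \<Rightarrow> (int list \<rightharpoonup> nat) \<Rightarrow> nat \<Rightarrow> bool" where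
  "far n R M y \<longleftrightarrow> R \<le> y \<and> y + R < n \<and> (\<forall>l \<in> ran M. 2 * int R < \<bar>int y - int l\<bar>)"

fun explore :: "nat \<Rightarrow> nat \<Rightarrow> nat \<Rightarrow> (nat \<Rightarrow> nat) \<Rightarrow> int list list \<Rightarrow> (int list \<rightharpoonup> nat)" where
  "explore n R x \<psi> [] = [[] \<mapsto> x]"
| "explore n R x \<psi> (e # es) = (let M = explore n R x \<psi> es in
     case M (tl e) of None \<Rightarrow> M
     | Some l \<Rightarrow> if far n R M (\<psi> (query l (hd e))) then M(e \<mapsto> \<psi> (query l (hd e))) else M)"

fun queried :: "nat \<Rightarrow> nat \<Rightarrow> nat \<Rightarrow> (nat \<Rightarrow> nat) \<Rightarrow> int list list \<Rightarrow> nat set" where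
  "queried n R x \<psi> [] = {}"
| "queried n R x \<psi> (e # es) = queried n R x \<psi> es \<union>
     (case explore n R x \<psi> es (tl e) of None \<Rightarrow> {} | Some l \<Rightarrow> {query l (hd e)})"

definition accident :: "nat \<Rightarrow> nat \<Rightarrow> nat \<Rightarrow> (nat \<Rightarrow> nat) \<Rightarrow> int list \<Rightarrow> int list list \<Rightarrow> bool" where
  "accident n R x \<psi> e es \<longleftrightarrow> (\<exists>l. explore n R x \<psi> es (tl e) = Some l \<and>
     \<not> far n R (explore n R x \<psi> es) (\<psi> (query l (hd e))))"

text \<open>\<open>es\<close> is the history explored before the block \<open>bs\<close>. Weight is
  charged where the accident happens: below a discarded node the parent is missing, so nothing
  further is charged.\<close>

fun lost :: "nat \<Rightarrow> nat \<Rightarrow> nat \<Rightarrow> (nat \<Rightarrow> nat) \<Rightarrow> (int list \<Rightarrow> real) \<Rightarrow> int list list \<Rightarrow> int list list \<Rightarrow> real" where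
  "lost n R x \<psi> w [] es = 0"
| "lost n R x \<psi> w (e # bs) es =
     (if accident n R x \<psi> e (bs @ es) then w e else 0) + lost n R x \<psi> w bs es"

text \<open>Accepted landing points keep a margin \<open>R\<close> from both ends, but the start
  \<open>x\<close> may be anywhere; hence the separate range condition for displacements from the
  root.\<close>

definition proper_nodes :: "nat \<Rightarrow> nat \<Rightarrow> nat \<Rightarrow> int list list \<Rightarrow> bool" where
  "proper_nodes n R x es \<longleftrightarrow> x < n \<and> distinct es \<and>
     (\<forall>e\<in>set es. e \<noteq> [] \<and> \<bar>hd e\<bar> \<le> int R \<and> (tl e = [] \<longrightarrow> 0 \<le> int x + hd e \<and> int x + hd e < int n))"

section \<open>Invariants of the exploration\<close>

lemma proper_nodes_Cons: "proper_nodes n R x (e # es) \<Longrightarrow> proper_nodes n R x es"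
  by (auto simp: proper_nodes_def)

lemma explore_unchanged: "e \<notin> set as \<Longrightarrow> explore n R x \<psi> (as @ es) e = explore n R x \<psi> es e"
  by (induction as) (auto simp: Let_def split: option.splits)

lemma explore_dom: "dom (explore n R x \<psi> es) \<subseteq> insert [] (set es)"
  by (induction es) (auto simp: Let_def split: option.splits if_splits)

lemma explore_new: "proper_nodes n R x (e # es) \<Longrightarrow> explore n R x \<psi> es e = None"
  using explore_dom[of n R x \<psi> es] by (fastforce simp: proper_nodes_def)

lemma explore_mono:
  assumes "proper_nodes n R x (e # es)" "explore n R x \<psi> es v = Some l"
  shows "explore n R x \<psi> (e # es) v = Some l"
  using explore_new[OF assms(1), of \<psi>] assms(2)
  by (auto simp: Let_def split: option.splits)

lemma explore_mono_append:
  assumes "proper_nodes n R x (as @ es)" "explore n R x \<psi> es v = Some l"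
  shows "explore n R x \<psi> (as @ es) v = Some l"
  using assms
proof (induction as)
  case (Cons a as)
  then show ?case using proper_nodes_Cons[of n R x a "as @ es"] explore_mono[of n R x a "as @ es"] by simp
qed simp

lemma explore_root: "proper_nodes n R x es \<Longrightarrow> explore n R x \<psi> es [] = Some x"
  using explore_mono_append[of n R x es "[]" \<psi> "[]" x] by simp

lemma explore_value:
  assumes "proper_nodes n R x es" "explore n R x \<psi> es e = Some y" "e \<noteq> []"
  shows "\<exists>l. explore n R x \<psi> es (tl e) = Some l \<and> y = \<psi> (query l (hd e)) \<and> R \<le> y \<and> y + R < n"
  using assms
proof (induction es)
  case (Cons a es)
  have p: "proper_nodes n R x es" by (rule proper_nodes_Cons[OF Cons.prems(1)])
  show ?case
  proof (cases "explore n R x \<psi> es e")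
    case None
    then have "e = a" "\<exists>l. explore n R x \<psi> es (tl a) = Some l \<and> y = \<psi> (query l (hd a)) \<and>
        far n R (explore n R x \<psi> es) (\<psi> (query l (hd a)))"
      using Cons.prems(2) by (auto simp: Let_def split: option.splits if_splits)
    then show ?thesis using explore_mono[OF Cons.prems(1)] by (auto simp: far_def)
  next
    case (Some y')
    then have "y' = y" using explore_mono[OF Cons.prems(1) Some] Cons.prems(2) by simp
    then show ?thesis using Cons.IH[OF p _ Cons.prems(3)] Some explore_mono[OF Cons.prems(1)] by blast
  qed
qed simp

lemma explore_separated:
  assumes "proper_nodes n R x es" "explore n R x \<psi> es e = Some l" "explore n R x \<psi> es e' = Some l'" "e \<noteq> e'"
  shows "2 * int R < \<bar>int l - int l'\<bar>"
  using assms
proof (induction es arbitrary: e e' l l')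
  case (Cons a es)
  have p: "proper_nodes n R x es" by (rule proper_nodes_Cons[OF Cons.prems(1)])
  show ?case
  proof (cases "explore n R x \<psi> (a # es) = explore n R x \<psi> es")
    case True
    then show ?thesis using Cons.IH[OF p] Cons.prems by simp
  next
    case False
    then obtain y where new: "explore n R x \<psi> (a # es) = (explore n R x \<psi> es)(a \<mapsto> y)"
      and y: "far n R (explore n R x \<psi> es) y"
      by (auto simp: Let_def split: option.splits if_splits)
    show ?thesis
    proof (cases "e = a")
      case True
      then have "l = y" "explore n R x \<psi> es e' = Some l'" using Cons.prems new by auto
      then show ?thesis using y by (auto simp: far_def ran_def)
    next
      case ne: False
      show ?thesis
      proof (cases "e' = a")
        case True
        then have "l' = y" "explore n R x \<psi> es e = Some l" using Cons.prems new ne by auto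
        then show ?thesis using y by (auto simp: far_def ran_def)
      next
        case False
        then show ?thesis using Cons.IH[OF p] Cons.prems new ne by simp
      qed
    qed
  qed
qed (auto split: if_splits)

lemma query_in_range:
  assumes "proper_nodes n R x (e # es)" "explore n R x \<psi> es (tl e) = Some l"
  shows "0 \<le> int l + hd e" "int l + hd e < int n"
proof -
  have e: "\<bar>hd e\<bar> \<le> int R" "tl e = [] \<Longrightarrow> 0 \<le> int x + hd e \<and> int x + hd e < int n"
    using assms(1) by (auto simp: proper_nodes_def)
  have p: "proper_nodes n R x es" by (rule proper_nodes_Cons[OF assms(1)])
  have "0 \<le> int l + hd e \<and> int l + hd e < int n"
  proof (cases "tl e = []")
    case True
    then show ?thesis using e(2) assms(2) explore_root[OF p, of \<psi>] by simp
  next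
    case False
    then have "R \<le> l" "l + R < n" using explore_value[OF p assms(2)] by auto
    then show ?thesis using e(1) by linarith
  qed
  then show "0 \<le> int l + hd e" "int l + hd e < int n" by auto
qed

lemma queried_witness:
  assumes "proper_nodes n R x es" "u \<in> queried n R x \<psi> es"
  shows "\<exists>e\<in>set es. \<exists>l. explore n R x \<psi> es (tl e) = Some l \<and> u = query l (hd e) \<and> 0 \<le> int l + hd e"
  using assms
proof (induction es)
  case (Cons a es)
  have p: "proper_nodes n R x es" by (rule proper_nodes_Cons[OF Cons.prems(1)])
  show ?case
  proof (cases "u \<in> queried n R x \<psi> es")
    case True
    then show ?thesis using Cons.IH[OF p] explore_mono[OF Cons.prems(1)] by fastforce
  next
    case False
    then obtain l where l: "explore n R x \<psi> es (tl a) = Some l" "u = query l (hd a)"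
      using Cons.prems(2) by (auto split: option.splits)
    then show ?thesis
      using explore_mono[OF Cons.prems(1) l(1)] query_in_range[OF Cons.prems(1) l(1)]
      by (intro bexI[of _ a]) auto
  qed
qed simp

text \<open>Landing points are more than \<open>2 * R\<close> apart and displacements are at most
  \<open>R\<close>, so equal query points have the same parent and the same displacement and hence
  come from the same node. \<open>switching_bound\<close> needs exactly this freshness.\<close>

lemma query_fresh:
  assumes p: "proper_nodes n R x (e # es)" and l: "explore n R x \<psi> es (tl e) = Some l"
  shows "query l (hd e) \<notin> queried n R x \<psi> es"
proof
  assume "query l (hd e) \<in> queried n R x \<psi> es"
  then obtain e' l' where e': "e' \<in> set es" and l': "explore n R x \<psi> es (tl e') = Some l'"
    "query l (hd e) = query l' (hd e')" "0 \<le> int l' + hd e'"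
    using queried_witness[OF proper_nodes_Cons[OF p]] by blast
  have eq: "int l + hd e = int l' + hd e'"
    using l'(2,3) query_in_range[OF p l] by (simp add: query_def)
  have b: "\<bar>hd e\<bar> \<le> int R" "\<bar>hd e'\<bar> \<le> int R" "e \<noteq> []" "e' \<noteq> []" "e \<noteq> e'"
    using p e' by (auto simp: proper_nodes_def)
  have "tl e = tl e'"
  proof (rule ccontr)
    assume "tl e \<noteq> tl e'"
    then have "2 * int R < \<bar>int l - int l'\<bar>"
      using explore_separated[OF proper_nodes_Cons[OF p] l l'(1)] by simp
    then show False using eq b by linarith
  qed
  then have "l = l'" using l l' by simp
  then have "hd e = hd e'" using eq by simp
  then show False using \<open>tl e = tl e'\<close> b by (metis list.collapse)
qed

text \<open>Adaptedness: each query point is computed from values already revealed, so agreement of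
  the two permutations propagates along the list.\<close>

lemma explore_determined:
  assumes "\<And>u. u \<in> queried n R x \<psi> es \<Longrightarrow> \<phi> u = \<psi> u"
  shows "explore n R x \<phi> es = explore n R x \<psi> es \<and> queried n R x \<phi> es = queried n R x \<psi> es"
  using assms
proof (induction es)
  case (Cons a es)
  then have IH: "explore n R x \<phi> es = explore n R x \<psi> es" "queried n R x \<phi> es = queried n R x \<psi> es" by auto
  have "\<phi> (query l (hd a)) = \<psi> (query l (hd a))" if "explore n R x \<psi> es (tl a) = Some l" for l
    using that by (intro Cons.prems) simp
  then show ?case using IH by (auto simp: Let_def split: option.splits)
qed simp

lemma queried_mono: "queried n R x \<psi> es \<subseteq> queried n R x \<psi> (as @ es)"
  by (induction as) auto

lemma queried_card: "finite (queried n R x \<psi> es) \<and> card (queried n R x \<psi> es) \<le> length es"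
proof (induction es)
  case (Cons a es)
  then show ?case
    by (auto split: option.splits intro: le_trans[OF card_insert_le_m1] simp: card_insert_if)
qed simp

lemma lost_determined:
  assumes "\<And>u. u \<in> queried n R x \<psi> (bs @ es) \<Longrightarrow> \<phi> u = \<psi> u"
  shows "lost n R x \<phi> w bs es = lost n R x \<psi> w bs es"
  using assms
proof (induction bs)
  case (Cons b bs)
  have eq: "explore n R x \<phi> (bs @ es) = explore n R x \<psi> (bs @ es)"
    using explore_determined[of n R x \<psi> "bs @ es" \<phi>] Cons.prems by simp
  have "\<phi> (query l (hd b)) = \<psi> (query l (hd b))" if "explore n R x \<psi> (bs @ es) (tl b) = Some l" for l
    using that by (intro Cons.prems) simp
  then have "accident n R x \<phi> b (bs @ es) = accident n R x \<psi> b (bs @ es)"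
    unfolding accident_def eq by auto
  then show ?case using Cons by simp
qed simp

text \<open>Each landing point excludes a window of \<open>4 * R + 1\<close> values, and each end of
  the interval excludes \<open>R\<close> more.\<close>

lemma not_far_card:
  assumes M: "finite (dom M)" "card (dom M) \<le> m"
  shows "card {y. y < n \<and> \<not> far n R M y} \<le> m * (4 * R + 1) + 2 * R"
proof -
  have fin: "finite (ran M)" using M by (simp add: finite_ran)
  have "ran M = (\<lambda>e. the (M e)) ` dom M"
    by (force simp: ran_def dom_def)
  then have ran: "card (ran M) \<le> m" using card_image_le[OF M(1)] M(2) by (metis le_trans)
  let ?near = "\<lambda>l. {l - 2 * R..l + 2 * R}"
  have "{y. y < n \<and> \<not> far n R M y} \<subseteq> (\<Union>l\<in>ran M. ?near l) \<union> ({..<R} \<union> {n - R..<n})"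
    by (auto simp: far_def not_less not_le abs_le_iff)
  then have "card {y. y < n \<and> \<not> far n R M y} \<le> card ((\<Union>l\<in>ran M. ?near l) \<union> ({..<R} \<union> {n - R..<n}))"
    using fin by (intro card_mono) auto
  also have "\<dots> \<le> card (\<Union>l\<in>ran M. ?near l) + (card {..<R} + card {n - R..<n})"
    by (intro order_trans[OF card_Un_le] add_mono le_refl card_Un_le)
  also have "\<dots> \<le> (\<Sum>l\<in>ran M. card (?near l)) + 2 * R"
    using fin by (intro add_mono card_UN_le) auto
  also have "(\<Sum>l\<in>ran M. card (?near l)) \<le> card (ran M) * (4 * R + 1)"
    using sum_bounded_above[of "ran M" "\<lambda>l. card (?near l)" "4 * R + 1"] by simp
  also have "\<dots> \<le> m * (4 * R + 1)" by (rule mult_le_mono1[OF ran])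
  finally show ?thesis by simp
qed

text \<open>Measurability with respect to the exploration, in combinatorial form: the event is
  closed under changing \<psi> outside the points that \<psi> itself makes the exploration
  query.\<close>

definition history_event :: "nat \<Rightarrow> nat \<Rightarrow> nat \<Rightarrow> int list list \<Rightarrow> (nat \<Rightarrow> nat) set \<Rightarrow> bool" where
  "history_event n R x es E \<longleftrightarrow> E \<subseteq> {\<psi>. \<psi> permutes {..<n}} \<and>
     (\<forall>\<psi>\<in>E. \<forall>\<phi>. \<phi> permutes {..<n} \<longrightarrow> (\<forall>u\<in>queried n R x \<psi> es. \<phi> u = \<psi> u) \<longrightarrow> \<phi> \<in> E)"

lemma history_event_append: "history_event n R x es E \<Longrightarrow> history_event n R x (as @ es) E"
  unfolding history_event_def using queried_mono by blast

lemma history_event_finite: "history_event n R x es E \<Longrightarrow> finite E"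
  unfolding history_event_def by (auto intro: finite_subset simp: finite_permutations)

definition accident_bound :: "nat \<Rightarrow> nat \<Rightarrow> nat \<Rightarrow> real" where
  "accident_bound n R N = real ((N + 1) * (4 * R + 1) + 2 * R) / real (n - N)"

text \<open>Given the history, the value at a fresh point is uniform over at least
  \<open>n - N\<close> unrevealed values. \<open>switching_bound\<close> is applied to the part
  \<open>E'\<close> of \<open>E\<close> where the parent of \<open>e\<close> was reached. The
  \<open>N + 1\<close> in \<open>accident_bound\<close> counts the root among the landing
  points.\<close>

lemma accident_card:
  assumes p: "proper_nodes n R x (e # es)" and E: "history_event n R x es E"
    and N: "length es \<le> N" "N < n"
  shows "real (card {\<psi> \<in> E. accident n R x \<psi> e es}) \<le> accident_bound n R N * real (card E)"
proof -
  define b where "b = (N + 1) * (4 * R + 1) + 2 * R"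
  define E' where "E' = {\<psi> \<in> E. explore n R x \<psi> es (tl e) \<noteq> None}"
  define z where "z \<psi> = query (the (explore n R x \<psi> es (tl e))) (hd e)" for \<psi>
  define B where "B \<psi> = {y. y < n \<and> \<not> far n R (explore n R x \<psi> es) y}" for \<psi>
  have perm: "\<psi> permutes {..<n}" if "\<psi> \<in> E" for \<psi> using E that by (auto simp: history_event_def)
  have z: "z \<psi> < n" if "\<psi> \<in> E'" for \<psi>
    using that query_in_range[OF p] by (fastforce simp: E'_def z_def query_def)
  have "{\<psi> \<in> E. accident n R x \<psi> e es} = {\<psi> \<in> E'. \<psi> (z \<psi>) \<in> B \<psi>}"
    using z perm by (auto simp: accident_def E'_def z_def B_def intro: permutes_less)
  moreover have "(n - N) * card {\<psi> \<in> E'. \<psi> (z \<psi>) \<in> B \<psi>} \<le> b * card E'"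
  proof (rule switching_bound[where D = "\<lambda>\<psi>. queried n R x \<psi> es"])
    fix \<psi> assume \<psi>: "\<psi> \<in> E'"
    show "z \<psi> \<notin> queried n R x \<psi> es"
      using \<psi> query_fresh[OF p] by (auto simp: E'_def z_def)
    show "finite (queried n R x \<psi> es) \<and> card (queried n R x \<psi> es) \<le> N"
      using queried_card[of n R x \<psi> es] N by auto
    have "finite (dom (explore n R x \<psi> es))"
      by (rule finite_subset[OF explore_dom]) simp
    moreover have "card (dom (explore n R x \<psi> es)) \<le> N + 1"
      using card_mono[OF _ explore_dom[of n R x \<psi> es]] card_length[of es] N(1)
        card_insert_le_m1[of "N + 1" "set es" "[]"] by simp
    ultimately show "finite (B \<psi>) \<and> card (B \<psi>) \<le> b"
      unfolding B_def b_def by (intro conjI not_far_card) auto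
    fix \<phi> assume \<phi>: "\<phi> permutes {..<n}" "\<And>u. u \<in> queried n R x \<psi> es \<Longrightarrow> \<phi> u = \<psi> u"
    then have "explore n R x \<phi> es = explore n R x \<psi> es" using explore_determined by blast
    moreover have "\<phi> \<in> E" using E \<psi> \<phi> unfolding history_event_def E'_def by blast
    ultimately show "\<phi> \<in> E' \<and> z \<phi> = z \<psi> \<and> B \<phi> = B \<psi>"
      using \<psi> by (simp add: E'_def z_def B_def)
  qed (use z perm in \<open>auto simp: E'_def\<close>)
  moreover have "b * card E' \<le> b * card E"
    using history_event_finite[OF E] by (intro mult_le_mono2 card_mono) (auto simp: E'_def)
  ultimately have "(n - N) * card {\<psi> \<in> E. accident n R x \<psi> e es} \<le> b * card E"
    by (simp only: le_trans)
  then have "real (n - N) * real (card {\<psi> \<in> E. accident n R x \<psi> e es}) \<le> real b * real (card E)"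
    by (simp only: of_nat_mult[symmetric] of_nat_le_iff)
  then have "real (card {\<psi> \<in> E. accident n R x \<psi> e es}) \<le> real b * real (card E) / real (n - N)"
    using N by (subst pos_le_divide_eq) (auto simp: mult.commute)
  then show ?thesis unfolding accident_bound_def b_def by simp
qed

text \<open>Linearity of expectation over the nodes of the block. Each accident is estimated given
  its own history, for which \<open>E\<close> is still a history event.\<close>

lemma sum_lost_le:
  assumes "proper_nodes n R x (bs @ es)" and E: "history_event n R x es E"
    and "length (bs @ es) \<le> N" and N: "N < n" and w: "\<And>e. 0 \<le> w e"
  shows "(\<Sum>\<psi>\<in>E. lost n R x \<psi> w bs es) \<le> sum_list (map w bs) * accident_bound n R N * real (card E)"
  using assms(1,3)
proof (induction bs)
  case (Cons b bs)
  have fin: "finite E" by (rule history_event_finite[OF E])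
  have "(\<Sum>\<psi>\<in>E. lost n R x \<psi> w (b # bs) es)
      = (\<Sum>\<psi>\<in>E. if accident n R x \<psi> b (bs @ es) then w b else 0) + (\<Sum>\<psi>\<in>E. lost n R x \<psi> w bs es)"
    by (simp add: sum.distrib)
  also have "(\<Sum>\<psi>\<in>E. if accident n R x \<psi> b (bs @ es) then w b else 0)
      = w b * real (card {\<psi> \<in> E. accident n R x \<psi> b (bs @ es)})"
    using fin by (simp add: sum.inter_filter[symmetric])
  also have "\<dots> \<le> w b * (accident_bound n R N * real (card E))"
    using Cons.prems w N
    by (intro mult_left_mono accident_card history_event_append[OF E]) auto
  also have "(\<Sum>\<psi>\<in>E. lost n R x \<psi> w bs es) \<le> sum_list (map w bs) * accident_bound n R N * real (card E)"
    using Cons.prems by (intro Cons.IH) (auto dest: proper_nodes_Cons)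
  finally show ?case by (simp add: algebra_simps)
qed simp

lemma lost_nonneg: "(\<And>e. 0 \<le> w e) \<Longrightarrow> 0 \<le> lost n R x \<psi> w bs es"
  by (induction bs) auto

text \<open>Markov's inequality for the lost weight. The first conclusion lets the failure of this
  block serve as history for the next one.\<close>

lemma card_lost_large:
  assumes p: "proper_nodes n R x (bs @ es)" and E: "history_event n R x es E"
    and N: "length (bs @ es) \<le> N" "N < n" and w: "\<And>e. 0 \<le> w e" and \<eta>: "0 < \<eta>"
  shows "history_event n R x (bs @ es) {\<psi> \<in> E. \<eta> < lost n R x \<psi> w bs es}"
    and "real (card {\<psi> \<in> E. \<eta> < lost n R x \<psi> w bs es})
      \<le> sum_list (map w bs) * accident_bound n R N / \<eta> * real (card E)"
proof -
  show "history_event n R x (bs @ es) {\<psi> \<in> E. \<eta> < lost n R x \<psi> w bs es}"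
    unfolding history_event_def
  proof (intro conjI ballI allI impI)
    show "{\<psi> \<in> E. \<eta> < lost n R x \<psi> w bs es} \<subseteq> {\<psi>. \<psi> permutes {..<n}}"
      using E by (auto simp: history_event_def)
    fix \<psi> \<phi> assume \<psi>: "\<psi> \<in> {\<psi> \<in> E. \<eta> < lost n R x \<psi> w bs es}" and \<phi>: "\<phi> permutes {..<n}"
      "\<forall>u\<in>queried n R x \<psi> (bs @ es). \<phi> u = \<psi> u"
    then show "\<phi> \<in> {\<psi> \<in> E. \<eta> < lost n R x \<psi> w bs es}"
      using lost_determined[of n R x \<psi> bs es \<phi> w] history_event_append[OF E, of bs]
      unfolding history_event_def by auto
  qed
  let ?A = "{\<psi> \<in> E. \<eta> < lost n R x \<psi> w bs es}"
  have fin: "finite E" by (rule history_event_finite[OF E])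
  have "\<eta> * real (card ?A) = (\<Sum>\<psi>\<in>?A. \<eta>)" by simp
  also have "\<dots> \<le> (\<Sum>\<psi>\<in>?A. lost n R x \<psi> w bs es)" by (intro sum_mono) auto
  also have "\<dots> \<le> (\<Sum>\<psi>\<in>E. lost n R x \<psi> w bs es)"
    using fin by (intro sum_mono2) (auto intro: lost_nonneg w)
  also have "\<dots> \<le> sum_list (map w bs) * accident_bound n R N * real (card E)"
    by (rule sum_lost_le[OF p E N w])
  finally show "real (card ?A) \<le> sum_list (map w bs) * accident_bound n R N / \<eta> * real (card E)"
    using \<eta> by (simp add: field_simps)
qed

fun blocks :: "(nat \<Rightarrow> int list list) \<Rightarrow> nat \<Rightarrow> int list list" where
  "blocks blk 0 = []"
| "blocks blk (Suc i) = blk i @ blocks blk i"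

text \<open>Conditional failure probabilities multiply, because the joint failure of the earlier
  blocks is a history event when block \<open>i\<close> is explored.\<close>

lemma card_all_blocks_lost:
  assumes "proper_nodes n R x (blocks blk m)"
    and "length (blocks blk m) \<le> N" and N: "N < n" and w: "\<And>e. 0 \<le> w e" and \<eta>: "0 < \<eta>"
    and W: "\<And>i. i < m \<Longrightarrow> sum_list (map w (blk i)) \<le> W"
  defines "F \<equiv> \<lambda>m. {\<psi>. \<psi> permutes {..<n} \<and> (\<forall>i<m. \<eta> < lost n R x \<psi> w (blk i) (blocks blk i))}"
  shows "history_event n R x (blocks blk m) (F m) \<and>
    real (card (F m)) \<le> (W * accident_bound n R N / \<eta>) ^ m * fact n"
  using assms(1,2,6)
proof (induction m)
  case 0
  have "F 0 = {\<psi>. \<psi> permutes {..<n}}" by (auto simp: F_def)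
  moreover have "card {\<psi>. \<psi> permutes {..<n}} = fact n" using card_permutations[of "{..<n}" n] by simp
  ultimately show ?case by (simp add: history_event_def)
next
  case (Suc m)
  have p: "proper_nodes n R x (blocks blk m)"
    using Suc.prems(1) by (auto simp: proper_nodes_def)
  have IH: "history_event n R x (blocks blk m) (F m)"
    "real (card (F m)) \<le> (W * accident_bound n R N / \<eta>) ^ m * fact n"
    using Suc.IH[OF p] Suc.prems by auto
  have F: "F (Suc m) = {\<psi> \<in> F m. \<eta> < lost n R x \<psi> w (blk m) (blocks blk m)}"
    by (auto simp: F_def less_Suc_eq)
  have step: "history_event n R x (blocks blk (Suc m)) (F (Suc m))"
    "real (card (F (Suc m))) \<le> sum_list (map w (blk m)) * accident_bound n R N / \<eta> * real (card (F m))"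
    unfolding F blocks.simps
    by (rule card_lost_large[OF _ IH(1) _ N w \<eta>]; use Suc.prems in simp)+
  have a0: "0 \<le> accident_bound n R N" by (simp add: accident_bound_def)
  have W0: "0 \<le> sum_list (map w (blk m))" using w by (intro sum_list_nonneg) auto
  have Wm: "sum_list (map w (blk m)) \<le> W" using Suc.prems(3) by simp
  have "real (card (F (Suc m))) \<le> sum_list (map w (blk m)) * accident_bound n R N / \<eta> * real (card (F m))"
    by (rule step(2))
  also have "\<dots> \<le> W * accident_bound n R N / \<eta> * ((W * accident_bound n R N / \<eta>) ^ m * fact n)"
    using a0 W0 Wm \<eta> IH(2)
    by (intro mult_mono divide_right_mono mult_right_mono mult_nonneg_nonneg divide_nonneg_pos) auto
  finally show ?case using step(1) by (simp add: mult.assoc)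
qed

text \<open>
  The nodes of \<open>T\<close> that are reached from \<open>z\<close> without an accident form the domain of the landing map;
  \<open>\<eta>\<close> bounds the total weight of the nodes at which an accident happens.
\<close>
definition good_start :: "nat \<Rightarrow> nat \<Rightarrow> (nat \<Rightarrow> nat) \<Rightarrow> int list set \<Rightarrow> (int list \<Rightarrow> real) \<Rightarrow> real \<Rightarrow> nat \<Rightarrow> bool" where
  "good_start n R \<psi> T h \<eta> z \<longleftrightarrow> (\<exists>M :: int list \<rightharpoonup> nat. M [] = Some z \<and>
     (\<forall>e l. M e = Some l \<longrightarrow> R \<le> l \<and> l + R < n) \<and>
     (\<forall>e e' l l'. M e = Some l \<longrightarrow> M e' = Some l' \<longrightarrow> e \<noteq> e' \<longrightarrow> 2 * int R < \<bar>int l - int l'\<bar>) \<and>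
     (\<forall>e l. e \<noteq> [] \<longrightarrow> M e = Some l \<longrightarrow> (\<exists>l'. M (tl e) = Some l' \<and> l = \<psi> (query l' (hd e)))) \<and>
     (\<Sum>e\<in>{e \<in> T. M e = None \<and> M (tl e) \<noteq> None}. h e) \<le> \<eta>)"

lemma lost_ge_sum:
  assumes "distinct bs" and w: "\<And>e. 0 \<le> w e" and "A \<subseteq> set bs"
    and "\<And>e. e \<in> A \<Longrightarrow> \<exists>as cs. bs = as @ e # cs \<and> accident n R x \<psi> e (cs @ es)"
  shows "sum w A \<le> lost n R x \<psi> w bs es"
  using assms(1,3,4)
proof (induction bs arbitrary: A)
  case (Cons b bs)
  have fin: "finite A" using Cons.prems(2) finite_subset by blast
  have IH: "sum w (A - {b}) \<le> lost n R x \<psi> w bs es"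
  proof (rule Cons.IH)
    fix e assume e: "e \<in> A - {b}"
    then obtain as cs where *: "b # bs = as @ e # cs" "accident n R x \<psi> e (cs @ es)"
      using Cons.prems(3) by blast
    then obtain as' where "as = b # as'" using e by (cases as) auto
    then show "\<exists>as cs. bs = as @ e # cs \<and> accident n R x \<psi> e (cs @ es)" using * by auto
  qed (use Cons.prems in auto)
  show ?case
  proof (cases "b \<in> A")
    case True
    then obtain as cs where *: "b # bs = as @ b # cs" "accident n R x \<psi> b (cs @ es)"
      using Cons.prems(3) by blast
    have "as = []" using *(1) Cons.prems(1) by (cases as) auto
    then have "accident n R x \<psi> b (bs @ es)" using * by simp
    then show ?thesis using IH sum.remove[OF fin True, of w] by simp
  next
    case False
    then show ?thesis using IH w[of b] by simp
  qed
qed simp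

text \<open>The list is explored from its end and lengths do not increase along it, so parents come
  before children. The final status of \<open>tl e\<close> is therefore its status when
  \<open>e\<close> was tried, and \<open>e\<close> can be missing only through an accident.\<close>

lemma unexplored_accident:
  assumes p: "proper_nodes n R x (bs @ es)" and srt: "sorted_wrt (\<lambda>a b. length b \<le> length a) bs"
    and e: "e \<in> set bs" "explore n R x \<psi> (bs @ es) e = None" "explore n R x \<psi> (bs @ es) (tl e) = Some l"
  shows "\<exists>as cs. bs = as @ e # cs \<and> accident n R x \<psi> e (cs @ es)"
proof -
  obtain as cs where bs: "bs = as @ e # cs" using split_list[OF e(1)] by blast
  have "length e \<le> length a" if "a \<in> set as" for a
    using srt that unfolding bs by (auto simp: sorted_wrt_append)
  moreover have "e \<noteq> []" using p e(1) by (auto simp: proper_nodes_def)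
  then have "length (tl e) < length e" by simp
  ultimately have "tl e \<notin> set as" "tl e \<noteq> e" by (meson not_less, metis less_irrefl)
  then have "tl e \<notin> set (as @ [e])" by simp
  then have l: "explore n R x \<psi> (cs @ es) (tl e) = Some l"
    using e(3) explore_unchanged[of "tl e" "as @ [e]" n R x \<psi> "cs @ es"] unfolding bs by simp
  have "explore n R x \<psi> (e # cs @ es) e = None"
  proof (rule ccontr)
    assume "explore n R x \<psi> (e # cs @ es) e \<noteq> None"
    then show False using explore_mono_append[of n R x as "e # cs @ es" \<psi> e] p e(2) unfolding bs by auto
  qed
  then have "accident n R x \<psi> e (cs @ es)"
    using l unfolding accident_def by (auto simp: Let_def split: if_splits)
  then show ?thesis using bs by blast
qed

text \<open>A block is a copy of the tree hung below \<open>[k]\<close> and \<open>[1, k]\<close>,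
  the two landing points of the jump \<open>(True, True)\<close> from displacement \<open>k\<close>.
  These two have weight 1 > \<eta>, so a small loss forces both to succeed. The landing map from the
  new start is read off the nodes with suffix \<open>[1, k]\<close>.\<close>

lemma good_start_of_block:
  assumes p: "proper_nodes n R x (bs @ es)" and bs: "bs = map (\<lambda>e. e @ [1, k]) L @ [[1, k], [k]]"
    and L: "distinct L" "[] \<notin> set L" "sorted_wrt (\<lambda>a b. length b \<le> length a) L"
    and w: "\<And>e. 0 \<le> w e" "w [1, k] = 1" "w [k] = 1" "\<And>e. e \<in> set L \<Longrightarrow> w (e @ [1, k]) = h e"
    and lost: "lost n R x \<psi> w bs es \<le> \<eta>" "\<eta> < 1" and R: "1 \<le> R"
  shows "good_start n R \<psi> (set L) h \<eta> (step n \<psi> (True, True) (query x k))"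
proof -
  define M where "M = explore n R x \<psi> (bs @ es)"
  have len: "1 \<le> length e" if "e \<in> set L" for e using L(2) that by (cases e) auto
  have tl_L: "tl (e @ [1, k]) = tl e @ [1, k]" if "e \<in> set L" for e
    using len[OF that] by (cases e) auto
  have srt: "sorted_wrt (\<lambda>a b. length b \<le> length a) bs"
    unfolding bs using L(3) len by (auto simp: sorted_wrt_append sorted_wrt_map)
  have dist: "distinct bs" using p by (auto simp: proper_nodes_def)
  define A where "A = {e \<in> set bs. M e = None \<and> M (tl e) \<noteq> None}"
  have A: "sum w A \<le> lost n R x \<psi> w bs es"
    by (rule lost_ge_sum[OF dist w(1)]) (auto simp: A_def M_def intro: unexplored_accident[OF p srt])
  have small: "e \<notin> A" if "w e = 1" for e
  proof
    assume "e \<in> A"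
    then have "w e \<le> sum w A" by (intro member_le_sum) (auto simp: A_def w)
    then show False using A lost that by simp
  qed
  have root: "M [] = Some x" unfolding M_def by (rule explore_root[OF p])
  obtain y where y: "M [k] = Some y"
    using small[OF w(3)] root by (auto simp: A_def bs)
  obtain z where z: "M [1, k] = Some z"
    using small[OF w(2)] y by (auto simp: A_def bs)
  have y': "y = \<psi> (query x k)" "R \<le> y" "y + R < n"
    using explore_value[OF p y[unfolded M_def]] root by (auto simp: M_def)
  have z': "z = \<psi> (query y 1)"
    using explore_value[OF p z[unfolded M_def]] y by (auto simp: M_def)
  \<comment> \<open>The margin of an accepted landing point, with \<open>R \<ge> 1\<close>, excludes
    clamping.\<close>
  have "neighbour n True y = y + 1" using y' R by (simp add: neighbour_def)
  then have "step n \<psi> (True, True) (query x k) = z"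
    using y'(1) z' by (simp add: query_def nat_add_distrib)
  moreover have "good_start n R \<psi> (set L) h \<eta> z"
    unfolding good_start_def
  proof (intro exI[of _ "\<lambda>e. M (e @ [1, k])"] conjI allI impI)
    show "M ([] @ [1, k]) = Some z" using z by simp
    show "R \<le> l" "l + R < n" if "M (e @ [1, k]) = Some l" for e l
      using explore_value[OF p, of \<psi> "e @ [1, k]" l] that by (auto simp: M_def)
    show "2 * int R < \<bar>int l - int l'\<bar>"
      if "M (e @ [1, k]) = Some l" "M (e' @ [1, k]) = Some l'" "e \<noteq> e'" for e e' l l'
      using explore_separated[OF p, of \<psi> "e @ [1, k]" l "e' @ [1, k]" l'] that by (auto simp: M_def)
    show "\<exists>l'. M (tl e @ [1, k]) = Some l' \<and> l = \<psi> (query l' (hd e))"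
      if "e \<noteq> []" "M (e @ [1, k]) = Some l" for e l
      using explore_value[OF p, of \<psi> "e @ [1, k]" l] that by (auto simp: M_def tl_append2)
    let ?A = "{e \<in> set L. M (e @ [1, k]) = None \<and> M (tl e @ [1, k]) \<noteq> None}"
    have "sum h ?A = (\<Sum>e\<in>?A. w (e @ [1, k]))" by (intro sum.cong) (auto simp: w(4))
    also have "\<dots> = sum w ((\<lambda>e. e @ [1, k]) ` ?A)"
      by (subst sum.reindex) (auto intro!: inj_onI)
    also have "\<dots> \<le> sum w A"
    proof (intro sum_mono2)
      show "(\<lambda>e. e @ [1, k]) ` ?A \<subseteq> A"
        using tl_L by (auto simp: A_def bs)
    qed (auto simp: A_def w)
    also have "\<dots> \<le> \<eta>" using A lost by simp
    finally show "sum h ?A \<le> \<eta>" .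
  qed
  ultimately show ?thesis by simp
qed

section \<open>Many branches from one starting point\<close>

definition run :: "nat \<Rightarrow> (nat \<Rightarrow> nat) \<Rightarrow> (bool \<times> bool) list \<Rightarrow> nat \<Rightarrow> nat" where
  "run n \<psi> ws x = fold (step n \<psi>) ws x"

lemma run_line:
  assumes "if \<sigma> then x + i < n else i \<le> x"
  shows "run n \<psi> (replicate i (False, \<sigma>)) x = query x (if \<sigma> then int i else - int i)"
  using assms
proof (induction i arbitrary: x)
  case (Suc i)
  have "run n \<psi> (replicate (Suc i) (False, \<sigma>)) x = run n \<psi> (replicate i (False, \<sigma>)) (neighbour n \<sigma> x)"
    by (simp add: run_def)
  also have "\<dots> = query (neighbour n \<sigma> x) (if \<sigma> then int i else - int i)"
    using Suc.prems by (intro Suc.IH) (auto simp: neighbour_def split: if_splits)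
  also have "\<dots> = query x (if \<sigma> then int (Suc i) else - int (Suc i))"
    using Suc.prems by (auto simp: neighbour_def query_def min_def of_nat_diff split: if_splits)
  finally show ?case .
qed (simp add: run_def query_def)

text \<open>Branch \<open>i\<close> walks \<open>i\<close> steps along the line of \<open>x\<close>
  and then jumps, which takes i + 1 \<le> m letters. The last entries \<open>k i\<close> are
  distinct, so the branches have disjoint nodes and are consecutive blocks of a single
  exploration.\<close>

lemma card_no_good_start:
  assumes x: "x < n" and m: "2 * m \<le> n" "m \<le> R" and R: "1 \<le> R"
    and L: "distinct L" "\<And>e. e \<in> set L \<Longrightarrow> e \<noteq> [] \<and> \<bar>hd e\<bar> \<le> int R" "sorted_wrt (\<lambda>a b. length b \<le> length a) L"
    and N: "m * (length L + 2) \<le> N" "N < n" and h: "\<And>e. 0 \<le> h e" and \<eta>: "0 < \<eta>" "\<eta> < 1"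
  shows "real (card {\<psi>. \<psi> permutes {..<n} \<and>
      \<not> (\<exists>ws. length ws \<le> m \<and> good_start n R \<psi> (set L) h \<eta> (run n \<psi> ws x))})
    \<le> ((2 + sum h (set L)) * accident_bound n R N / \<eta>) ^ m * fact n"
proof -
  \<comment> \<open>Since \<open>2 * m \<le> n\<close>, there is room for the displacements on at
    least one side of \<open>x\<close>.\<close>
  define \<sigma> where "\<sigma> \<longleftrightarrow> x + m < n"
  define k where "k i = (if \<sigma> then int i else - int i)" for i :: nat
  define blk where "blk i = map (\<lambda>e. e @ [1, k i]) L @ [[1, k i], [k i]]" for i
  \<comment> \<open>Dropping the suffix \<open>[1, k i]\<close> recovers the weight
    \<open>h\<close>; the two connecting nodes of a branch weigh 1 each, which is the 2 in the
    bound.\<close>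
  define w where "w e = (if length e \<le> 2 then 1 else h (take (length e - 2) e))" for e :: "int list"
  have w0: "0 \<le> w e" for e by (simp add: w_def h)
  have w_append: "w (e @ [1, k']) = h e" if "e \<in> set L" for e k'
  proof -
    have "\<not> length (e @ [1, k']) \<le> 2" using L(2)[OF that] by simp
    then show ?thesis by (simp add: w_def)
  qed
  have last: "last e = k i" if "e \<in> set (blk i)" for e i
    using that by (auto simp: blk_def)
  have inj: "i = j" if "k i = k j" for i j using that by (auto simp: k_def split: if_splits)
  have in_blocks: "\<exists>j<i. e \<in> set (blk j)" if "e \<in> set (blocks blk i)" for e i
    using that by (induction i) (auto intro: less_SucI)
  have proper: "proper_nodes n R x (blocks blk i)" if "i \<le> m" for i
    using that
  proof (induction i)
    case 0
    then show ?case using x by (simp add: proper_nodes_def)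
  next
    case (Suc i)
    have "inj_on (\<lambda>e. e @ [1, k i]) (set L)" by (rule inj_onI) simp
    then have "distinct (blk i)"
      unfolding blk_def using L(1,2) by (auto simp: distinct_map)
    moreover have "e \<notin> set (blocks blk i)" if "e \<in> set (blk i)" for e
    proof
      assume "e \<in> set (blocks blk i)"
      then obtain j where j: "j < i" "e \<in> set (blk j)" using in_blocks by blast
      then have "k i = k j" using last that by metis
      then show False using inj j(1) by blast
    qed
    then have "set (blk i) \<inter> set (blocks blk i) = {}" by blast
    moreover have "e \<noteq> [] \<and> \<bar>hd e\<bar> \<le> int R \<and> (tl e = [] \<longrightarrow> 0 \<le> int x + hd e \<and> int x + hd e < int n)"
      if e: "e \<in> set (blk i)" for e
    proof -
      have k: "\<bar>k i\<bar> \<le> int R" "0 \<le> int x + k i" "int x + k i < int n"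
        using Suc.prems m x by (auto simp: k_def \<sigma>_def)
      consider e' where "e' \<in> set L" "e = e' @ [1, k i]" | "e = [1, k i]" | "e = [k i]"
        using e by (auto simp: blk_def)
      then show ?thesis using L(2) R k by cases (auto simp: hd_append tl_append split: list.splits)
    qed
    ultimately show ?case using Suc by (auto simp: proper_nodes_def)
  qed
  have len: "length (blocks blk i) = i * (length L + 2)" for i
    by (induction i) (auto simp: blk_def)
  have W: "sum_list (map w (blk i)) \<le> 2 + sum h (set L)" for i
  proof -
    have "sum_list (map w (map (\<lambda>e. e @ [1, k i]) L)) = sum_list (map h L)"
      by (simp add: comp_def w_append cong: map_cong)
    also have "\<dots> = sum h (set L)" using L(1) by (simp add: sum_list_distinct_conv_sum_set)
    finally have 1: "sum_list (map w (map (\<lambda>e. e @ [1, k i]) L)) = sum h (set L)" .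
    have 2: "w [1, k i] = 1" "w [k i] = 1" by (auto simp: w_def)
    show ?thesis unfolding blk_def map_append sum_list_append 1 by (simp add: 2)
  qed
  let ?F = "{\<psi>. \<psi> permutes {..<n} \<and> (\<forall>i<m. \<eta> < lost n R x \<psi> w (blk i) (blocks blk i))}"
  have "{\<psi>. \<psi> permutes {..<n} \<and>
      \<not> (\<exists>ws. length ws \<le> m \<and> good_start n R \<psi> (set L) h \<eta> (run n \<psi> ws x))} \<subseteq> ?F"
  proof
    fix \<psi>
    assume "\<psi> \<in> {\<psi>. \<psi> permutes {..<n} \<and>
      \<not> (\<exists>ws. length ws \<le> m \<and> good_start n R \<psi> (set L) h \<eta> (run n \<psi> ws x))}"
    then have \<psi>: "\<psi> permutes {..<n}"
      and none: "\<And>ws. length ws \<le> m \<Longrightarrow> \<not> good_start n R \<psi> (set L) h \<eta> (run n \<psi> ws x)" by auto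
    have "\<eta> < lost n R x \<psi> w (blk i) (blocks blk i)" if i: "i < m" for i
    proof (rule ccontr)
      assume "\<not> \<eta> < lost n R x \<psi> w (blk i) (blocks blk i)"
      then have "good_start n R \<psi> (set L) h \<eta> (step n \<psi> (True, True) (query x (k i)))"
        using proper[of "Suc i"] i L w0 w_append \<eta> R
        by (intro good_start_of_block[where bs = "blk i" and w = w and es = "blocks blk i"])
          (auto simp: blk_def w_def)
      moreover have "run n \<psi> (replicate i (False, \<sigma>)) x = query x (k i)"
        unfolding k_def using i x m by (intro run_line) (auto simp: \<sigma>_def)
      ultimately have "good_start n R \<psi> (set L) h \<eta> (run n \<psi> (replicate i (False, \<sigma>) @ [(True, True)]) x)"
        by (simp add: run_def)
      then show False using none[of "replicate i (False, \<sigma>) @ [(True, True)]"] i by simp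
    qed
    then show "\<psi> \<in> ?F" using \<psi> by simp
  qed
  then have "card {\<psi>. \<psi> permutes {..<n} \<and>
      \<not> (\<exists>ws. length ws \<le> m \<and> good_start n R \<psi> (set L) h \<eta> (run n \<psi> ws x))} \<le> card ?F"
    by (intro card_mono finite_subset[OF _ finite_permutations[of "{..<n}"]]) auto
  also have "real (card ?F) \<le> ((2 + sum h (set L)) * accident_bound n R N / \<eta>) ^ m * fact n"
    using card_all_blocks_lost[of n R x blk m N w \<eta> "2 + sum h (set L)"] proper[of m] len N w0 W \<eta> by simp
  finally show ?thesis by simp
qed

section \<open>The walk on the tree of lines\<close>

text \<open>
  Nodes of even length are lines on which the walk moves; nodes of odd length are the
  intermediate points of the maps \<open>x \<mapsto> \<psi> (\<psi> x \<plusminus> 1)\<close>. The weights below make \<open>state_weight\<close>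
  superharmonic for the walk (\<open>line_ratio\<close> solves \<open>u + 1 / u = 4\<close>) and let the node weights of
  each generation sum to 1.
\<close>
definition line_ratio :: real where "line_ratio = 2 - sqrt 3"

definition jump_weight :: real where "jump_weight = 1 / (2 * sqrt 3)"

fun node_weight :: "int list \<Rightarrow> real" where
  "node_weight [] = 1"
| "node_weight [k] = 1"
| "node_weight (s # k # v) = jump_weight * line_ratio ^ nat \<bar>k\<bar> * node_weight v"

fun state_weight :: "int list \<times> int \<Rightarrow> real" where
  "state_weight (v, k) = node_weight v * line_ratio ^ nat \<bar>k\<bar>"

definition dir :: "bool \<Rightarrow> int" where "dir \<sigma> = (if \<sigma> then 1 else -1)"

fun cover_step :: "bool \<times> bool \<Rightarrow> int list \<times> int \<Rightarrow> int list \<times> int" where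
  "cover_step (q, \<sigma>) (v, k) = (if q then (dir \<sigma> # k # v, 0) else (v, k + dir \<sigma>))"

definition cover_run :: "(bool \<times> bool) list \<Rightarrow> int list \<times> int" where
  "cover_run ws = fold cover_step ws ([], 0)"

definition words :: "nat \<Rightarrow> (bool \<times> bool) list set" where
  "words j = {ws. length ws = j}"

lemma sum_letters:
  fixes h :: "bool \<times> bool \<Rightarrow> real"
  shows "(\<Sum>l\<in>UNIV. h l) = h (True, True) + h (True, False) + h (False, True) + h (False, False)"
  unfolding UNIV_letters by simp

lemma line_ratio_bounds: "0 < line_ratio" "line_ratio < 1" "line_ratio \<le> (52 / 100)\<^sup>2"
proof -
  have "sqrt 3 < 2" by (rule real_less_lsqrt) auto
  then show "0 < line_ratio" by (simp add: line_ratio_def)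
  have "1 < sqrt 3" by simp
  then show "line_ratio < 1" by (simp add: line_ratio_def)
  have "2 - (52 / 100)\<^sup>2 \<le> sqrt (3::real)"
    by (rule real_le_rsqrt) (simp add: power2_eq_square)
  then show "line_ratio \<le> (52 / 100)\<^sup>2" by (simp add: line_ratio_def)
qed

lemma line_ratio_quadratic: "line_ratio * line_ratio + 1 = 4 * line_ratio"
  by (simp add: line_ratio_def algebra_simps)

lemma jump_weight_bounds: "0 < jump_weight" "jump_weight \<le> (54 / 100)\<^sup>2" "jump_weight \<le> 1"
proof -
  show "0 < jump_weight" by (simp add: jump_weight_def)
  have "1 / (2 * (54 / 100)\<^sup>2) \<le> sqrt (3::real)"
    by (rule real_le_rsqrt) (simp add: power2_eq_square)
  then show "jump_weight \<le> (54 / 100)\<^sup>2" by (simp add: jump_weight_def field_simps)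
  then show "jump_weight \<le> 1" by (rule order_trans) (simp add: power2_eq_square)
qed

lemma jump_weight_line_ratio: "jump_weight * (4 - 2 * line_ratio) = 1"
  by (simp add: jump_weight_def line_ratio_def field_simps)

lemma node_weight_pos: "0 < node_weight v"
  using line_ratio_bounds jump_weight_bounds by (induction v rule: node_weight.induct) auto

lemma state_weight_pos: "0 < state_weight s"
  using node_weight_pos line_ratio_bounds by (cases s) simp

lemma line_ratio_superharmonic:
  "line_ratio ^ nat \<bar>k - 1\<bar> + line_ratio ^ nat \<bar>k + 1\<bar>
    = 4 * line_ratio ^ nat \<bar>k\<bar> - (if k = 0 then 4 - 2 * line_ratio else 0)"
proof (cases "k = 0")
  case False
  define m where "m = nat \<bar>k\<bar> - 1"
  have m: "nat \<bar>k\<bar> = m + 1" using False by (simp add: m_def)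
  have "{nat \<bar>k - 1\<bar>, nat \<bar>k + 1\<bar>} = {m, m + 2}" and "nat \<bar>k - 1\<bar> \<noteq> nat \<bar>k + 1\<bar>"
    using False m by (auto simp: abs_if)
  then have "line_ratio ^ nat \<bar>k - 1\<bar> + line_ratio ^ nat \<bar>k + 1\<bar> = line_ratio ^ m + line_ratio ^ (m + 2)"
    by (auto simp: doubleton_eq_iff)
  also have "\<dots> = line_ratio ^ m * (line_ratio * line_ratio + 1)"
    by (simp add: algebra_simps power2_eq_square)
  finally show ?thesis using False m by (simp add: line_ratio_quadratic)
qed simp

lemma finite_words: "finite (words j)" and card_words: "card (words j) = 4 ^ j"
proof -
  have eq: "words j = {ws. set ws \<subseteq> UNIV \<and> length ws = j}" by (simp add: words_def)
  show "finite (words j)" unfolding eq by (rule finite_lists_length_eq) simp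
  have "card (UNIV :: (bool \<times> bool) set) = 4" by (simp add: UNIV_letters)
  then show "card (words j) = 4 ^ j" unfolding eq
    by (subst card_lists_length_eq) (simp_all del: card_prod)
qed

lemma cover_run_snoc: "cover_run (ws @ [l]) = cover_step l (cover_run ws)"
  by (simp add: cover_run_def)

lemma run_snoc: "run n \<psi> (ws @ [l]) x = step n \<psi> l (run n \<psi> ws x)"
  by (simp add: run_def)

definition extend :: "(bool \<times> bool) list set \<Rightarrow> (bool \<times> bool) list set" where
  "extend A = (\<lambda>(ws, l). ws @ [l]) ` (A \<times> UNIV)"

lemma words_Suc: "words (Suc j) = extend (words j)"
proof
  show "words (Suc j) \<subseteq> extend (words j)"
  proof
    fix ws assume "ws \<in> words (Suc j)"
    then have "ws = butlast ws @ [last ws]" "butlast ws \<in> words j"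
      by (auto simp: words_def intro!: append_butlast_last_id[symmetric])
    then show "ws \<in> extend (words j)" unfolding extend_def by (auto intro!: image_eqI[of _ _ "(butlast ws, last ws)"])
  qed
qed (auto simp: words_def extend_def)

lemma sum_extend: "(\<Sum>ws\<in>extend A. h ws) = (\<Sum>ws\<in>A. \<Sum>l\<in>UNIV. h (ws @ [l]))"
proof -
  have "inj_on (\<lambda>(ws, l). ws @ [l]) (A \<times> UNIV)" by (auto intro!: inj_onI)
  then show ?thesis unfolding extend_def
    by (simp add: sum.reindex sum.cartesian_product split_def)
qed

lemma finite_extend: "finite A \<Longrightarrow> finite (extend A)"
  unfolding extend_def by (intro finite_imageI finite_cartesian_product) auto

lemma sum_words_Suc:
  "(\<Sum>ws\<in>words (Suc j). h (cover_run ws)) = (\<Sum>ws\<in>words j. \<Sum>l\<in>UNIV. h (cover_step l (cover_run ws)))"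
  unfolding words_Suc sum_extend cover_run_snoc ..

text \<open>\<open>state_weight\<close> is the Green function normalised to 1 at the start: on a
  line the walk is killed by a jump with probability 1/2 per step, and \<open>jump_weight\<close> =
  1 / (4 - 2 * \<open>line_ratio\<close>) is the factor for entering a given new line. The induction
  looks at the last letter: a state is entered from its two neighbours on the line and, at
  displacement 0, from one parent state.\<close>

lemma occupation_bound:
  "real (card {ws \<in> words j. cover_run ws = s}) \<le> 4 ^ j * state_weight s"
proof (induction j arbitrary: s)
  case 0
  have "{ws \<in> words 0. cover_run ws = s} = (if s = ([], 0) then {[]} else {})"
    by (auto simp: words_def cover_run_def)
  then show ?case using state_weight_pos[of s] by auto
next
  case (Suc j)
  define c where "c s = real (card {ws \<in> words j. cover_run ws = s})" for s
  have c: "c s = (\<Sum>ws\<in>words j. of_bool (cover_run ws = s))" for s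
    unfolding c_def using finite_words by (simp add: Int_def)
  have IH: "c s \<le> 4 ^ j * state_weight s" for s unfolding c_def by (rule Suc.IH)
  obtain v k where s: "s = (v, k)" by (cases s)
  \<comment> \<open>Entries by a jump, which always land at displacement 0; the first two entries of
    \<open>v\<close> record the sign and the displacement left on the parent line.\<close>
  define r where "r = (if k = 0 \<and> 2 \<le> length v then c (tl (tl v), hd (tl v)) else 0)"
  have "real (card {ws \<in> words (Suc j). cover_run ws = s}) = (\<Sum>ws\<in>words (Suc j). of_bool (cover_run ws = s))"
    using finite_words by (simp add: Int_def)
  also have "\<dots> = (\<Sum>ws\<in>words j. \<Sum>l\<in>UNIV. of_bool (cover_step l (cover_run ws) = s))"
    by (rule sum_words_Suc)
  also have "\<dots> \<le> (\<Sum>ws\<in>words j. of_bool (cover_run ws = (v, k - 1)) + of_bool (cover_run ws = (v, k + 1))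
      + (if k = 0 \<and> 2 \<le> length v then of_bool (cover_run ws = (tl (tl v), hd (tl v))) else 0))"
  proof (intro sum_mono)
    fix ws
    obtain v' k' where c: "cover_run ws = (v', k')" by (cases "cover_run ws")
    have "of_bool (cover_step (True, True) (v', k') = s) + of_bool (cover_step (True, False) (v', k') = s)
      \<le> (if k = 0 \<and> 2 \<le> length v then of_bool ((v', k') = (tl (tl v), hd (tl v))) else (0::real))"
    proof (cases "k = 0 \<and> 2 \<le> length v")
      case True
      then obtain \<sigma>\<^sub>0 k\<^sub>0 v\<^sub>0 where "v = \<sigma>\<^sub>0 # k\<^sub>0 # v\<^sub>0" by (cases v; cases "tl v") auto
      then show ?thesis using True by (simp add: s dir_def of_bool_def)
    next
      case False
      then show ?thesis by (auto simp: s)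
    qed
    moreover have "of_bool (cover_step (False, True) (v', k') = s) = (of_bool ((v', k') = (v, k - 1)) :: real)"
      "of_bool (cover_step (False, False) (v', k') = s) = (of_bool ((v', k') = (v, k + 1)) :: real)"
      by (auto simp: s dir_def of_bool_def)
    ultimately show "(\<Sum>l\<in>UNIV. of_bool (cover_step l (cover_run ws) = s)) \<le>
      of_bool (cover_run ws = (v, k - 1)) + of_bool (cover_run ws = (v, k + 1))
      + (if k = 0 \<and> 2 \<le> length v then of_bool (cover_run ws = (tl (tl v), hd (tl v))) else (0::real))"
      unfolding sum_letters c by linarith
  qed
  also have "\<dots> = c (v, k - 1) + c (v, k + 1) + r"
  proof -
    have "(\<Sum>ws\<in>words j. if k = 0 \<and> 2 \<le> length v then of_bool (cover_run ws = (tl (tl v), hd (tl v))) else 0) = r"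
    proof (cases "k = 0 \<and> 2 \<le> length v")
      case True
      then show ?thesis by (simp add: r_def c)
    next
      case False
      then have *: "(k = 0 \<and> 2 \<le> length v) = False" by blast
      show ?thesis unfolding r_def * by simp
    qed
    then show ?thesis by (simp only: c sum.distrib)
  qed
  also have "\<dots> \<le> 4 ^ j * (4 * state_weight s)"
  proof (cases "k = 0 \<and> 2 \<le> length v")
    case True
    then obtain \<sigma> k' v' where v: "v = \<sigma> # k' # v'" by (cases v; cases "tl v") auto
    have "c (v, k - 1) + c (v, k + 1) + r
        \<le> 4 ^ j * (state_weight (v, -1) + state_weight (v, 1) + state_weight (v', k'))"
      using IH[of "(v, -1)"] IH[of "(v, 1)"] IH[of "(v', k')"] True v by (simp add: r_def algebra_simps)
    also have "state_weight (v, -1) + state_weight (v, 1) + state_weight (v', k') = 4 * state_weight s"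
    proof -
      have "state_weight (v', k') = jump_weight * (4 - 2 * line_ratio) * (node_weight v' * line_ratio ^ nat \<bar>k'\<bar>)"
        unfolding jump_weight_line_ratio by simp
      then show ?thesis using True unfolding s v by (simp add: algebra_simps)
    qed
    finally show ?thesis .
  next
    case False
    then have "r = 0" unfolding r_def by (rule if_not_P)
    have "c (v, k - 1) + c (v, k + 1) \<le> 4 ^ j * (state_weight (v, k - 1) + state_weight (v, k + 1))"
      using IH[of "(v, k - 1)"] IH[of "(v, k + 1)"] by (simp add: algebra_simps)
    also have "state_weight (v, k - 1) + state_weight (v, k + 1) \<le> 4 * state_weight s"
    proof -
      have "line_ratio ^ nat \<bar>k - 1\<bar> + line_ratio ^ nat \<bar>k + 1\<bar> \<le> 4 * line_ratio ^ nat \<bar>k\<bar>"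
        unfolding line_ratio_superharmonic using line_ratio_bounds by simp
      then have "node_weight v * (line_ratio ^ nat \<bar>k - 1\<bar> + line_ratio ^ nat \<bar>k + 1\<bar>)
          \<le> node_weight v * (4 * line_ratio ^ nat \<bar>k\<bar>)"
        using node_weight_pos[of v] by (intro mult_left_mono) auto
      then show ?thesis unfolding s by (simp add: algebra_simps)
    qed
    finally show ?thesis using \<open>r = 0\<close> by simp
  qed
  finally show ?case by simp
qed

text \<open>
  The decay rate 0.69 of this potential, which dominates the square root of the weight, is below
  \<open>1 / sqrt 2\<close>: this makes \<open>log\<^sub>2 n\<close> steps sufficient.
\<close>
fun potential :: "int list \<times> int \<Rightarrow> real" where
  "potential (v, k) = sqrt (node_weight v) * (82 / 100) ^ nat \<bar>k\<bar>"

text \<open>54/100 and 52/100 are the square roots of \<open>jump_weight\<close> and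
  \<open>line_ratio\<close>, rounded up. With decay 0.52 along the line the sum would be about 3.5
  times the potential off the centre. The slower decay 0.82 balances the centre, 2 * 0.82 + 2 * 0.54
  = 2.72, against distance 1, also about 2.72; the allowance is 4 * 0.69 = 2.76.\<close>

lemma potential_step: "(\<Sum>l\<in>UNIV. potential (cover_step l s)) \<le> 4 * (69 / 100) * potential s"
proof -
  obtain v k where s: "s = (v, k)" by (cases s)
  define m where "m = nat \<bar>k\<bar>"
  have sq: "sqrt (jump_weight * line_ratio ^ m) \<le> 54 / 100 * (52 / 100) ^ m"
  proof (rule real_le_lsqrt)
    have "jump_weight * line_ratio ^ m \<le> (54 / 100)\<^sup>2 * ((52 / 100)\<^sup>2) ^ m"
      using jump_weight_bounds line_ratio_bounds by (intro mult_mono power_mono) auto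
    then show "jump_weight * line_ratio ^ m \<le> (54 / 100 * (52 / 100) ^ m)\<^sup>2"
      by (simp only: power_mult_distrib power_mult[symmetric] mult.commute[of 2 m] mult.commute)
  qed auto
  have "(82 / 100) ^ nat \<bar>k - 1\<bar> + (82 / 100) ^ nat \<bar>k + 1\<bar> + 2 * (54 / 100 * (52 / 100) ^ m)
      \<le> 4 * (69 / 100) * (82 / 100 :: real) ^ m"
  proof (cases "k = 0")
    case True
    then show ?thesis by (simp add: m_def)
  next
    case False
    then obtain p where m: "m = p + 1" by (metis Suc_eq_plus1 m_def not0_implies_Suc zero_less_abs_iff nat_0_iff not_le)
    have "{nat \<bar>k - 1\<bar>, nat \<bar>k + 1\<bar>} = {p, p + 2}" and "nat \<bar>k - 1\<bar> \<noteq> nat \<bar>k + 1\<bar>"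
      using False m by (auto simp: abs_if m_def)
    then have eq: "(82 / 100) ^ nat \<bar>k - 1\<bar> + (82 / 100) ^ nat \<bar>k + 1\<bar> = (82 / 100) ^ p + (82 / 100 :: real) ^ (p + 2)"
      by (auto simp: doubleton_eq_iff)
    define q r :: real where "q = (82 / 100) ^ p" and "r = (52 / 100) ^ p"
    have "r \<le> q" "0 < q" unfolding q_def r_def by (auto intro: power_mono)
    then have "q + (82 / 100) * (82 / 100) * q + 2 * (54 / 100 * (52 / 100 * r)) \<le> 4 * (69 / 100) * (82 / 100 * q)"
      by simp
    then show ?thesis unfolding eq m q_def r_def by (simp add: power_add power2_eq_square)
  qed
  then have "(82 / 100) ^ nat \<bar>k - 1\<bar> + (82 / 100) ^ nat \<bar>k + 1\<bar> + 2 * sqrt (jump_weight * line_ratio ^ m)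
      \<le> 4 * (69 / 100) * (82 / 100 :: real) ^ m"
    using sq by linarith
  then have "sqrt (node_weight v) * ((82 / 100) ^ nat \<bar>k - 1\<bar> + (82 / 100) ^ nat \<bar>k + 1\<bar> + 2 * sqrt (jump_weight * line_ratio ^ m))
      \<le> sqrt (node_weight v) * (4 * (69 / 100) * (82 / 100) ^ m)"
    using node_weight_pos[of v] by (intro mult_left_mono) auto
  then show ?thesis unfolding UNIV_letters s
    by (simp add: dir_def m_def real_sqrt_mult algebra_simps)
qed

lemma sum_potential_le: "(\<Sum>ws\<in>words j. potential (cover_run ws)) \<le> 4 ^ j * (69 / 100) ^ j"
proof (induction j)
  case 0
  then show ?case by (simp add: words_def cover_run_def)
next
  case (Suc j)
  have "(\<Sum>ws\<in>words (Suc j). potential (cover_run ws))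
      \<le> (\<Sum>ws\<in>words j. 4 * (69 / 100) * potential (cover_run ws))"
    unfolding sum_words_Suc by (intro sum_mono potential_step)
  also have "\<dots> \<le> 4 * (69 / 100) * (4 ^ j * (69 / 100) ^ j)"
    unfolding sum_distrib_left[symmetric] using Suc by (intro mult_left_mono) auto
  finally show ?case by simp
qed

lemma sqrt_state_weight_le: "sqrt (state_weight s) \<le> potential s"
proof -
  obtain v k where s: "s = (v, k)" by (cases s)
  have "sqrt line_ratio \<le> 82 / 100"
    using line_ratio_bounds(3) by (intro real_le_lsqrt) (auto simp: power2_eq_square)
  then have "sqrt line_ratio ^ nat \<bar>k\<bar> \<le> (82 / 100) ^ nat \<bar>k\<bar>"
    using line_ratio_bounds by (intro power_mono) auto
  then show ?thesis unfolding s using node_weight_pos[of v]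
    by (simp add: real_sqrt_mult real_sqrt_power mult_left_mono)
qed

text \<open>Markov's inequality for the square root of \<open>state_weight\<close>, whose mean is
  controlled through \<open>potential\<close>.\<close>

lemma heavy_words_bound:
  assumes \<theta>: "0 < \<theta>"
  shows "real (card {ws \<in> words j. \<theta> \<le> state_weight (cover_run ws)}) / 4 ^ j \<le> (69 / 100) ^ j / sqrt \<theta>"
proof -
  let ?A = "{ws \<in> words j. \<theta> \<le> state_weight (cover_run ws)}"
  have "sqrt \<theta> * real (card ?A) = (\<Sum>ws\<in>?A. sqrt \<theta>)" by simp
  also have "\<dots> \<le> (\<Sum>ws\<in>?A. potential (cover_run ws))"
    by (intro sum_mono order_trans[OF _ sqrt_state_weight_le]) auto
  also have "\<dots> \<le> (\<Sum>ws\<in>words j. potential (cover_run ws))"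
    using finite_words order_trans[OF _ sqrt_state_weight_le] state_weight_pos
    by (intro sum_mono2) (auto simp: less_imp_le)
  also have "\<dots> \<le> 4 ^ j * (69 / 100) ^ j" by (rule sum_potential_le)
  finally show ?thesis using \<theta> by (simp add: field_simps)
qed

section \<open>The finite tree of heavy states\<close>

fun main_nodes :: "nat \<Rightarrow> nat \<Rightarrow> int list set" where
  "main_nodes R 0 = {[]}"
| "main_nodes R (Suc i) = (\<lambda>(s, k, v). s # k # v) ` ({1, -1} \<times> {- int R..int R} \<times> main_nodes R i)"

lemma finite_main_nodes: "finite (main_nodes R i)"
  by (induction i) auto

lemma length_main_nodes: "v \<in> main_nodes R i \<Longrightarrow> length v = 2 * i"
  by (induction i arbitrary: v) auto

text \<open>Two-sided geometric series with limit (1 + u) / (1 - u) = sqrt 3 for u =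
  \<open>line_ratio\<close>; the induction carries the exact tail.\<close>

lemma sum_line_ratio: "(\<Sum>k = - int R..int R. line_ratio ^ nat \<bar>k\<bar>) \<le> sqrt 3"
proof -
  have "(1 - line_ratio) * (\<Sum>k = - int R..int R. line_ratio ^ nat \<bar>k\<bar>) + 2 * line_ratio ^ (R + 1) = 1 + line_ratio"
  proof (induction R)
    case (Suc R)
    have "{- int (Suc R)..int (Suc R)} = insert (- int (Suc R)) (insert (int (Suc R)) {- int R..int R})"
      by auto
    then have sum: "(\<Sum>k = - int (Suc R)..int (Suc R). line_ratio ^ nat \<bar>k\<bar>)
        = 2 * line_ratio ^ (R + 1) + (\<Sum>k = - int R..int R. line_ratio ^ nat \<bar>k\<bar>)"
      by (simp add: nat_add_distrib)
    have "(1 - line_ratio) * (2 * line_ratio ^ (R + 1) + X) + 2 * line_ratio ^ (Suc R + 1)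
        = (1 - line_ratio) * X + 2 * line_ratio ^ (R + 1)" for X
      by (simp add: algebra_simps)
    then show ?case unfolding sum using Suc by simp
  qed (simp add: algebra_simps)
  then have "(1 - line_ratio) * (\<Sum>k = - int R..int R. line_ratio ^ nat \<bar>k\<bar>) \<le> 1 + line_ratio"
    using line_ratio_bounds zero_le_power[of line_ratio "R + 1"] by linarith
  also have "\<dots> = (1 - line_ratio) * sqrt 3" by (simp add: line_ratio_def algebra_simps)
  finally show ?thesis using line_ratio_bounds by simp
qed

text \<open>A new generation multiplies the total by at most 2 * \<open>jump_weight\<close> * sqrt 3
  = 1: two signs, one jump, one sum over the line.\<close>

lemma sum_node_weight: "(\<Sum>v\<in>main_nodes R i. node_weight v) \<le> 1"
proof (induction i)
  case (Suc i)
  have "inj_on (\<lambda>(s, k, v). s # k # v) ({1, -1} \<times> {- int R..int R} \<times> main_nodes R i)"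
    by (auto intro!: inj_onI)
  then have "(\<Sum>v\<in>main_nodes R (Suc i). node_weight v)
      = (\<Sum>(s, k, v)\<in>{1, -1 :: int} \<times> {- int R..int R} \<times> main_nodes R i. jump_weight * line_ratio ^ nat \<bar>k\<bar> * node_weight v)"
    by (simp add: sum.reindex split_def)
  also have "\<dots> = 2 * jump_weight * (\<Sum>k = - int R..int R. line_ratio ^ nat \<bar>k\<bar>) * (\<Sum>v\<in>main_nodes R i. node_weight v)"
    by (simp add: sum.cartesian_product[symmetric] sum_distrib_left[symmetric] sum_distrib_right[symmetric] mult.assoc)
  also have "\<dots> \<le> 2 * jump_weight * sqrt 3 * 1"
    using Suc jump_weight_bounds sum_line_ratio[of R] line_ratio_bounds node_weight_pos
    by (intro mult_mono mult_nonneg_nonneg sum_nonneg) (auto simp: less_imp_le)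
  also have "\<dots> = 1" by (simp add: jump_weight_def)
  finally show ?case .
qed simp

definition heavy_states :: "nat \<Rightarrow> nat \<Rightarrow> real \<Rightarrow> (int list \<times> int) set" where
  "heavy_states R s \<theta> = {p \<in> (\<Union>i\<le>s. main_nodes R i) \<times> {- int R..int R}. \<theta> \<le> state_weight p}"

lemma finite_heavy_states: "finite (heavy_states R s \<theta>)"
  unfolding heavy_states_def using finite_main_nodes by (intro finite_Collect_conjI disjI1) auto

lemma sum_heavy_states: "(\<Sum>p\<in>heavy_states R s \<theta>. state_weight p) \<le> 2 * (real s + 1)"
proof -
  let ?V = "\<Union>i\<le>s. main_nodes R i"
  have "(\<Sum>p\<in>heavy_states R s \<theta>. state_weight p) \<le> (\<Sum>p\<in>?V \<times> {- int R..int R}. state_weight p)"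
    unfolding heavy_states_def using finite_main_nodes state_weight_pos
    by (intro sum_mono2) (auto simp: less_imp_le)
  also have "\<dots> = (\<Sum>v\<in>?V. node_weight v) * (\<Sum>k = - int R..int R. line_ratio ^ nat \<bar>k\<bar>)"
  proof -
    have "(\<Sum>p\<in>?V \<times> {- int R..int R}. state_weight p)
        = (\<Sum>(v, k)\<in>?V \<times> {- int R..int R}. node_weight v * line_ratio ^ nat \<bar>k\<bar>)"
      by (intro sum.cong) auto
    then show ?thesis by (simp only: sum_product sum.cartesian_product)
  qed
  also have "\<dots> \<le> (real s + 1) * 2"
  proof (intro mult_mono)
    have "main_nodes R i \<inter> main_nodes R j = {}" if "i \<noteq> j" for i j
      using length_main_nodes[of _ R i] length_main_nodes[of _ R j] that by fastforce
    then have "(\<Sum>v\<in>?V. node_weight v) = (\<Sum>i\<le>s. \<Sum>v\<in>main_nodes R i. node_weight v)"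
      using finite_main_nodes by (intro sum.UNION_disjoint) auto
    also have "\<dots> \<le> (\<Sum>i\<le>s. 1)" by (intro sum_mono sum_node_weight)
    finally show "(\<Sum>v\<in>?V. node_weight v) \<le> real s + 1" by simp
    have "sqrt 3 \<le> (2::real)" by (rule real_le_lsqrt) auto
    then show "(\<Sum>k = - int R..int R. line_ratio ^ nat \<bar>k\<bar>) \<le> 2" using sum_line_ratio[of R] by linarith
  qed (use line_ratio_bounds(1) in \<open>auto intro!: sum_nonneg simp: less_imp_le\<close>)
  finally show ?thesis by simp
qed

lemma card_heavy_states:
  assumes "0 < \<theta>"
  shows "real (card (heavy_states R s \<theta>)) \<le> 2 * (real s + 1) / \<theta>"
proof -
  have "\<theta> * real (card (heavy_states R s \<theta>)) = (\<Sum>p\<in>heavy_states R s \<theta>. \<theta>)" by simp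
  also have "\<dots> \<le> (\<Sum>p\<in>heavy_states R s \<theta>. state_weight p)"
    by (intro sum_mono) (auto simp: heavy_states_def)
  also have "\<dots> \<le> 2 * (real s + 1)" by (rule sum_heavy_states)
  finally show ?thesis using assms by (simp add: field_simps)
qed

text \<open>The state from which a jump uses the landing point \<open>e\<close>: a jump from
  \<open>(v, k)\<close> passes through \<open>k # v\<close> and ends at some
  \<open>s # k # v\<close>. An accident at \<open>e\<close> is therefore charged the weight of this
  state.\<close>

definition node_state :: "int list \<Rightarrow> int list \<times> int" where
  "node_state e = (if even (length e) then (tl (tl e), hd (tl e)) else (tl e, hd e))"

definition tree_nodes :: "nat \<Rightarrow> nat \<Rightarrow> real \<Rightarrow> int list set" where
  "tree_nodes R s \<theta> = (\<lambda>((v, k), a). a @ k # v) ` (heavy_states R s \<theta> \<times> {[], [1], [-1]})"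

lemma node_state_simps:
  "even (length v) \<Longrightarrow> node_state (k # v) = (v, k)"
  "even (length v) \<Longrightarrow> node_state (s # k # v) = (v, k)"
  by (auto simp: node_state_def)

lemma finite_tree_nodes: "finite (tree_nodes R s \<theta>)"
  unfolding tree_nodes_def using finite_heavy_states by (intro finite_imageI finite_cartesian_product) auto

lemma tree_nodes_hd:
  assumes "e \<in> tree_nodes R s \<theta>" "1 \<le> R"
  shows "e \<noteq> [] \<and> \<bar>hd e\<bar> \<le> int R"
  using assms by (auto simp: tree_nodes_def heavy_states_def)

lemma card_tree_nodes:
  assumes "0 < \<theta>"
  shows "real (card (tree_nodes R s \<theta>)) \<le> 6 * (real s + 1) / \<theta>"
proof -
  have "card (tree_nodes R s \<theta>) \<le> card (heavy_states R s \<theta> \<times> {[], [1], [-1 :: int]})"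
    unfolding tree_nodes_def using finite_heavy_states by (intro card_image_le finite_cartesian_product) auto
  also have "\<dots> = 3 * card (heavy_states R s \<theta>)" by (simp add: card_cartesian_product)
  finally have "real (card (tree_nodes R s \<theta>)) \<le> 3 * real (card (heavy_states R s \<theta>))" by simp
  also have "\<dots> \<le> 3 * (2 * (real s + 1) / \<theta>)"
    by (intro mult_left_mono card_heavy_states assms) auto
  finally show ?thesis by simp
qed

lemma sum_tree_nodes: "(\<Sum>e\<in>tree_nodes R s \<theta>. state_weight (node_state e)) \<le> 6 * (real s + 1)"
proof -
  let ?A = "heavy_states R s \<theta> \<times> {[], [1], [-1 :: int]}"
  have "(\<Sum>e\<in>tree_nodes R s \<theta>. state_weight (node_state e))
      \<le> (\<Sum>x\<in>?A. ((\<lambda>e. state_weight (node_state e)) \<circ> (\<lambda>((v, k), a). a @ k # v)) x)"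
    unfolding tree_nodes_def using finite_heavy_states state_weight_pos
    by (intro sum_image_le) (auto simp: less_imp_le)
  also have "\<dots> = (\<Sum>x\<in>?A. state_weight (fst x))"
    using length_main_nodes
    by (intro sum.cong refl) (auto simp: heavy_states_def node_state_simps simp del: state_weight.simps)
  also have "\<dots> = 3 * (\<Sum>p\<in>heavy_states R s \<theta>. state_weight p)"
    using sum.cartesian_product[of "\<lambda>p a. state_weight p" "{[], [1], [-1 :: int]}" "heavy_states R s \<theta>"]
    by (simp add: split_def sum_distrib_left)
  finally show ?thesis using sum_heavy_states[of R s \<theta>] by simp
qed

lemma cover_run_range:
  assumes "length ws \<le> R" "cover_run ws = (v, k)"
  shows "(\<exists>i\<le>length ws. v \<in> main_nodes R i) \<and> \<bar>k\<bar> \<le> int (length ws)"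
  using assms
proof (induction ws arbitrary: v k rule: rev_induct)
  case Nil
  then show ?case by (auto simp: cover_run_def intro: exI[of _ 0])
next
  case (snoc l ws)
  obtain v' k' where c: "cover_run ws = (v', k')" by (cases "cover_run ws")
  obtain q \<sigma> where l: "l = (q, \<sigma>)" by (cases l)
  from snoc.IH[OF _ c] snoc.prems(1) obtain i where i: "i \<le> length ws" "v' \<in> main_nodes R i"
    and k': "\<bar>k'\<bar> \<le> int (length ws)" by auto
  have eq: "cover_step (q, \<sigma>) (v', k') = (v, k)" using snoc.prems(2) c l by (simp add: cover_run_snoc)
  show ?case
  proof (cases q)
    case True
    then have "v = dir \<sigma> # k' # v'" "k = 0" using eq by auto
    moreover have "dir \<sigma> # k' # v' \<in> main_nodes R (Suc i)"
      using i(2) k' snoc.prems(1) by (auto simp: dir_def intro!: image_eqI[of _ _ "(dir \<sigma>, k', v')"])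
    ultimately show ?thesis using i(1) by (intro conjI exI[of _ "Suc i"]) auto
  next
    case False
    then have "v = v'" "k = k' + dir \<sigma>" using eq by auto
    then show ?thesis using i k' by (auto simp: dir_def intro: exI[of _ i])
  qed
qed

section \<open>Mixing from good starting points\<close>

lemma kernel_op_pow_average:
  "(kernel_op n \<psi> ^^ (m + j)) f x = (\<Sum>ws\<in>words m. (kernel_op n \<psi> ^^ j) f (run n \<psi> ws x)) / 4 ^ m"
proof (induction m arbitrary: j)
  case 0
  then show ?case by (simp add: words_def run_def)
next
  case (Suc m)
  have "(kernel_op n \<psi> ^^ (Suc m + j)) f x = (kernel_op n \<psi> ^^ (m + Suc j)) f x" by simp
  also have "\<dots> = (\<Sum>ws\<in>words m. (kernel_op n \<psi> ^^ Suc j) f (run n \<psi> ws x)) / 4 ^ m"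
    by (rule Suc.IH)
  also have "\<dots> = (\<Sum>ws\<in>words m. \<Sum>l\<in>UNIV. (kernel_op n \<psi> ^^ j) f (run n \<psi> (ws @ [l]) x)) / 4 ^ Suc m"
    by (simp add: kernel_op_def run_snoc sum_divide_distrib[symmetric])
  also have "\<dots> = (\<Sum>ws\<in>words (Suc m). (kernel_op n \<psi> ^^ j) f (run n \<psi> ws x)) / 4 ^ Suc m"
    unfolding words_Suc sum_extend ..
  finally show ?case .
qed

lemma run_less: "\<psi> permutes {..<n} \<Longrightarrow> x < n \<Longrightarrow> run n \<psi> ws x < n"
  by (induction ws rule: rev_induct) (simp_all add: run_snoc step_less, simp add: run_def)

lemma kernel_op_bounded:
  assumes p: "\<psi> permutes {..<n}" and f: "\<And>y. y < n \<Longrightarrow> \<bar>f y\<bar> \<le> B" and x: "x < n"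
  shows "\<bar>(kernel_op n \<psi> ^^ j) f x\<bar> \<le> B"
proof -
  have "\<bar>(kernel_op n \<psi> ^^ j) f x\<bar> = \<bar>\<Sum>ws\<in>words j. f (run n \<psi> ws x)\<bar> / 4 ^ j"
    using kernel_op_pow_average[where m = j and j = 0] by simp
  also have "\<dots> \<le> (\<Sum>ws\<in>words j. B) / 4 ^ j"
    using f run_less[OF p x] by (intro divide_right_mono order_trans[OF sum_abs] sum_mono) auto
  also have "\<dots> = B" by (simp add: card_words)
  finally show ?thesis .
qed

lemma sum_kernel_op:
  assumes p: "\<psi> permutes {..<n}"
  shows "(\<Sum>x<n. kernel_op n \<psi> f x) = (\<Sum>x<n. f x)"
proof -
  have "(\<Sum>x<n. kernel_op n \<psi> f x)
      = ((\<Sum>x<n. f (neighbour n True x) + f (neighbour n False x))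
        + (\<Sum>x<n. f (\<psi> (neighbour n True (\<psi> x))) + f (\<psi> (neighbour n False (\<psi> x))))) / 4"
    unfolding kernel_op_expand sum_divide_distrib[symmetric] sum.distrib[symmetric] by (simp add: add.assoc)
  also have "(\<Sum>x<n. f (\<psi> (neighbour n True (\<psi> x))) + f (\<psi> (neighbour n False (\<psi> x))))
      = (\<Sum>x<n. f (\<psi> (neighbour n True x)) + f (\<psi> (neighbour n False x)))"
    by (rule sum_permutes[OF p, of "\<lambda>x. f (\<psi> (neighbour n True x)) + f (\<psi> (neighbour n False x))"])
  also have "\<dots> = 2 * (\<Sum>x<n. f x)"
    unfolding sum_neighbour[of "\<lambda>x. f (\<psi> x)"] sum_permutes[OF p] ..
  finally show ?thesis unfolding sum_neighbour by simp
qed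

lemma kernel_op_pow_contraction:
  assumes p: "\<psi> permutes {..<n}" and \<rho>: "0 \<le> \<rho>"
    and contr: "\<And>f. (\<Sum>x<n. f x) = 0 \<Longrightarrow> (\<Sum>x<n. (kernel_op n \<psi> f x)\<^sup>2) \<le> \<rho> * (\<Sum>x<n. (f x)\<^sup>2)"
    and f: "(\<Sum>x<n. f x) = 0"
  shows "(\<Sum>x<n. ((kernel_op n \<psi> ^^ j) f x)\<^sup>2) \<le> \<rho> ^ j * (\<Sum>x<n. (f x)\<^sup>2)"
proof -
  have zero: "(\<Sum>x<n. (kernel_op n \<psi> ^^ j) f x) = 0" for j
    by (induction j) (simp_all add: f sum_kernel_op[OF p])
  show ?thesis
  proof (induction j)
    case (Suc j)
    have "(\<Sum>x<n. ((kernel_op n \<psi> ^^ Suc j) f x)\<^sup>2) \<le> \<rho> * (\<Sum>x<n. ((kernel_op n \<psi> ^^ j) f x)\<^sup>2)"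
      using contr[OF zero[of j]] by simp
    also have "\<dots> \<le> \<rho> * (\<rho> ^ j * (\<Sum>x<n. (f x)\<^sup>2))" by (intro mult_left_mono Suc \<rho>)
    finally show ?case by (simp add: mult.assoc)
  qed simp
qed

text \<open>Divided by \<open>c\<close>, the image of \<open>B\<close> under \<open>r\<close> is a
  subprobability measure with masses at most \<theta>, so its squared norm is at most \<theta>;
  Cauchy-Schwarz finishes.\<close>

lemma spread_sum_bound:
  fixes F :: "nat \<Rightarrow> real"
  assumes B: "finite B" "\<And>w. w \<in> B \<Longrightarrow> r w < n"
    and fib: "\<And>y. real (card {w \<in> B. r w = y}) \<le> c * \<theta>" and tot: "real (card B) \<le> c"
    and c: "0 < c"
  shows "\<bar>\<Sum>w\<in>B. F (r w)\<bar> \<le> c * sqrt (\<theta> * (\<Sum>y<n. (F y)\<^sup>2))"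
proof -
  define \<nu> where "\<nu> y = real (card {w \<in> B. r w = y})" for y
  have \<theta>: "0 \<le> \<theta>" using fib[of 0] c by (smt (verit) of_nat_0_le_iff zero_le_mult_iff)
  have "(\<Sum>w\<in>B. F (r w)) = (\<Sum>y<n. \<Sum>w\<in>{w \<in> B. r w = y}. F (r w))"
    using B by (intro sum.group[symmetric]) auto
  also have "\<dots> = (\<Sum>y<n. \<nu> y * F y)" by (simp add: \<nu>_def)
  finally have eq: "(\<Sum>w\<in>B. F (r w)) = (\<Sum>y<n. \<nu> y * F y)" .
  have "(\<Sum>y<n. \<nu> y) = (\<Sum>y<n. \<Sum>w\<in>{w \<in> B. r w = y}. 1)" by (simp add: \<nu>_def)
  also have "\<dots> = (\<Sum>w\<in>B. 1)" using B by (intro sum.group) auto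
  finally have \<nu>_sum: "(\<Sum>y<n. \<nu> y) = real (card B)" by simp
  have "(\<Sum>y<n. (\<nu> y)\<^sup>2) \<le> (\<Sum>y<n. c * \<theta> * \<nu> y)"
    unfolding power2_eq_square using fib by (intro sum_mono mult_right_mono) (auto simp: \<nu>_def)
  also have "\<dots> \<le> c * \<theta> * c"
    unfolding sum_distrib_left[symmetric] \<nu>_sum using c \<theta> tot by (intro mult_left_mono) auto
  finally have \<nu>2: "(\<Sum>y<n. (\<nu> y)\<^sup>2) \<le> c\<^sup>2 * \<theta>" by (simp add: power2_eq_square algebra_simps)
  have "(\<Sum>y<n. \<nu> y * F y)\<^sup>2 \<le> (\<Sum>y<n. (\<nu> y)\<^sup>2) * (\<Sum>y<n. (F y)\<^sup>2)"
    by (rule Cauchy_Schwarz_ineq_sum)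
  also have "\<dots> \<le> c\<^sup>2 * \<theta> * (\<Sum>y<n. (F y)\<^sup>2)" by (intro mult_right_mono \<nu>2 sum_nonneg) auto
  finally have "\<bar>\<Sum>y<n. \<nu> y * F y\<bar> \<le> sqrt (c\<^sup>2 * \<theta> * (\<Sum>y<n. (F y)\<^sup>2))"
    by (simp add: real_le_rsqrt)
  also have "\<dots> = c * sqrt (\<theta> * (\<Sum>y<n. (F y)\<^sup>2))" using c by (simp add: real_sqrt_mult mult.assoc)
  finally show ?thesis unfolding eq .
qed

section \<open>The walk stopped at small weight or at an accident\<close>

fun tame_words :: "(int list \<rightharpoonup> nat) \<Rightarrow> real \<Rightarrow> nat \<Rightarrow> (bool \<times> bool) list set" where
  "tame_words M \<theta> 0 = {[]}"
| "tame_words M \<theta> (Suc j) = {ws \<in> extend (tame_words M \<theta> j).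
     M (fst (cover_run ws)) \<noteq> None \<and> \<theta> \<le> state_weight (cover_run ws)}"

lemma tame_words_subset: "tame_words M \<theta> j \<subseteq> words j"
proof (induction j)
  case (Suc j)
  then have "extend (tame_words M \<theta> j) \<subseteq> extend (words j)" by (auto simp: extend_def)
  then show ?case unfolding words_Suc by auto
qed (simp add: words_def)

lemma finite_tame_words: "finite (tame_words M \<theta> j)"
  by (rule finite_subset[OF tame_words_subset finite_words])

text \<open>The actual walk follows the tree while its landing points exist: strictly inside the
  window of radius \<open>R\<close> no move is clamped. After a jump, existence of the node
  \<open>v'\<close> implies that of the intermediate point, its parent.\<close>

lemma step_position:
  assumes R: "1 \<le> R" and M: "\<And>e l. M e = Some l \<Longrightarrow> R \<le> l \<and> l + R < n"
    "\<And>e l. e \<noteq> [] \<Longrightarrow> M e = Some l \<Longrightarrow> \<exists>l'. M (tl e) = Some l' \<and> l = \<psi> (query l' (hd e))"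
    and pos: "y = query l k" "M v = Some l" "\<bar>k\<bar> < int R"
    and nxt: "cover_step a (v, k) = (v', k')" "M v' = Some l'"
  shows "step n \<psi> a y = query l' k'"
proof -
  obtain q \<sigma> where a: "a = (q, \<sigma>)" by (cases a)
  have move: "neighbour n \<sigma> (query i j) = query i (j + dir \<sigma>)"
    if "R \<le> i" "i + R < n" "\<bar>j\<bar> < int R" for i j
  proof -
    have ij: "0 < int i + j" "int i + j + 1 < int n" using that by linarith+
    show ?thesis
    proof (cases \<sigma>)
      case True
      have "query i j + 1 \<le> n - 1" using ij by (simp add: query_def)
      then show ?thesis using True ij by (simp add: neighbour_def query_def dir_def)
    next
      case False
      then show ?thesis using ij by (simp add: neighbour_def query_def dir_def)
    qed
  qed
  show ?thesis
  proof (cases q)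
    case True
    then have v': "v' = dir \<sigma> # k # v" "k' = 0" using nxt(1) a by auto
    obtain i where i: "M (k # v) = Some i" "l' = \<psi> (query i (dir \<sigma>))"
      using M(2)[of v' l'] nxt(2) v' by auto
    have "i = \<psi> y" using M(2)[of "k # v" i] i(1) pos by auto
    moreover have "neighbour n \<sigma> i = query i (dir \<sigma>)"
      using move[of i 0] M(1)[OF i(1)] R by (simp add: query_def)
    ultimately show ?thesis using True a v' i(2) by (simp add: query_def)
  next
    case False
    then have "v' = v" "k' = k + dir \<sigma>" using nxt(1) a by auto
    then show ?thesis using False a pos nxt(2) move M(1)[OF pos(2)] by simp
  qed
qed

lemma tame_run_position:
  assumes R: "1 \<le> R" "j \<le> R" and M: "M [] = Some z" "\<And>e l. M e = Some l \<Longrightarrow> R \<le> l \<and> l + R < n"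
    "\<And>e l. e \<noteq> [] \<Longrightarrow> M e = Some l \<Longrightarrow> \<exists>l'. M (tl e) = Some l' \<and> l = \<psi> (query l' (hd e))"
    and ws: "ws \<in> tame_words M \<theta> j" and c: "cover_run ws = (v, k)"
  shows "\<exists>l. M v = Some l \<and> run n \<psi> ws z = query l k"
  using R(2) ws c
proof (induction j arbitrary: ws v k)
  case 0
  then show ?case using M(1) by (auto simp: cover_run_def run_def query_def)
next
  case (Suc j)
  then obtain us a where ws: "ws = us @ [a]" "us \<in> tame_words M \<theta> j" by (auto simp: extend_def)
  obtain u i where u: "cover_run us = (u, i)" by (cases "cover_run us")
  obtain l where l: "M u = Some l" "run n \<psi> us z = query l i"
    using Suc.IH[OF _ ws(2) u] Suc.prems(1) by auto
  have "length us = j" using ws(2) tame_words_subset by (auto simp: words_def)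
  then have "\<bar>i\<bar> < int R" using cover_run_range[of us R u i] u Suc.prems(1) by auto
  moreover obtain l' where l': "M v = Some l'" using Suc.prems(2,3) by auto
  moreover have "cover_step a (u, i) = (v, k)" using Suc.prems(3) ws u by (simp add: cover_run_snoc)
  ultimately have "step n \<psi> a (run n \<psi> us z) = query l' k"
    by (intro step_position[where R = R and M = M and l = l and v = u and k = i and v' = v]) (use R(1) M(2,3) l in blast)+
  then show ?case using l' ws by (simp add: run_snoc)
qed

text \<open>Telescoping over the stopping time. At each of \<open>s\<close> steps the surviving
  words lose those that become light (\<open>B\<close>) and those that miss a landing point
  (\<open>L\<close>). Light words have a law with masses at most \<theta> and at least
  \<open>r\<close> contraction steps ahead of them; the missing ones are paid for by \<eta>. Words
  surviving all \<open>s\<close> steps are heavy and hence rare.\<close>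

lemma good_start_mixing:
  assumes p: "\<psi> permutes {..<n}" and \<rho>: "0 \<le> \<rho>" "\<rho> \<le> 1"
    and contr: "\<And>f. (\<Sum>x<n. f x) = 0 \<Longrightarrow> (\<Sum>x<n. (kernel_op n \<psi> f x)\<^sup>2) \<le> \<rho> * (\<Sum>x<n. (f x)\<^sup>2)"
    and good: "good_start n R \<psi> (tree_nodes R s \<theta>) (\<lambda>e. state_weight (node_state e)) \<eta> z"
    and R: "1 \<le> R" "s \<le> R" and \<theta>: "0 < \<theta>" "\<theta> \<le> 1" and \<eta>: "0 \<le> \<eta>"
    and F: "(\<Sum>x<n. F x) = 0" "(\<Sum>x<n. (F x)\<^sup>2) \<le> real n" "\<And>x. x < n \<Longrightarrow> \<bar>F x\<bar> \<le> 2"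
    and t: "s + r \<le> t"
  shows "\<bar>(kernel_op n \<psi> ^^ t) F z\<bar>
    \<le> 2 * (69 / 100) ^ s / sqrt \<theta> + real s * (2 * \<eta> + sqrt (\<theta> * real n * \<rho> ^ r))"
proof -
  obtain M where M: "M [] = Some z" "\<And>e l. M e = Some l \<Longrightarrow> R \<le> l \<and> l + R < n"
    "\<And>e l. e \<noteq> [] \<Longrightarrow> M e = Some l \<Longrightarrow> \<exists>l'. M (tl e) = Some l' \<and> l = \<psi> (query l' (hd e))"
    and sep: "\<And>e e' l l'. M e = Some l \<Longrightarrow> M e' = Some l' \<Longrightarrow> e \<noteq> e' \<Longrightarrow> 2 * int R < \<bar>int l - int l'\<bar>"
    and lost: "(\<Sum>e\<in>{e \<in> tree_nodes R s \<theta>. M e = None \<and> M (tl e) \<noteq> None}. state_weight (node_state e)) \<le> \<eta>"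
    using good unfolding good_start_def by blast
  have z: "z < n" using M(2)[OF M(1)] by simp
  define G where "G j = (kernel_op n \<psi> ^^ (t - j)) F" for j
  define S where "S A j = (\<Sum>ws\<in>A. G j (run n \<psi> ws z)) / 4 ^ j" for A j
  let ?T = "tame_words M \<theta>"
  let ?A = "{e \<in> tree_nodes R s \<theta>. M e = None \<and> M (tl e) \<noteq> None}"
  have G2: "\<bar>G j y\<bar> \<le> 2" if "y < n" for j y
    unfolding G_def by (rule kernel_op_bounded[OF p F(3) that])
  have step: "\<bar>S (?T j) j\<bar> \<le> \<bar>S (?T (Suc j)) (Suc j)\<bar> + (2 * \<eta> + sqrt (\<theta> * real n * \<rho> ^ r))" if j: "j < s" for j
  proof -
    let ?E = "extend (?T j)"
    define B where "B = {ws \<in> ?E. M (fst (cover_run ws)) \<noteq> None \<and> state_weight (cover_run ws) < \<theta>}"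
    define L where "L = {ws \<in> ?E. M (fst (cover_run ws)) = None}"
    have tame_pos: "\<exists>l. M u = Some l \<and> run n \<psi> us z = query l i"
      if "us \<in> ?T j" "cover_run us = (u, i)" for us u i
      by (rule tame_run_position[OF R(1) _ M that]) (use j R in simp)
    have finE: "finite ?E" by (intro finite_extend finite_tame_words)
    have Ew: "?E \<subseteq> words (Suc j)"
      using tame_words_subset[of M \<theta> j] unfolding words_Suc by (auto simp: extend_def)
    have tj: "t - j = Suc (t - Suc j)" using j t by simp
    have "S (?T j) j = (\<Sum>ws\<in>?T j. \<Sum>l\<in>UNIV. G (Suc j) (run n \<psi> (ws @ [l]) z)) / 4 ^ Suc j"
      unfolding S_def G_def tj
      by (simp add: kernel_op_def run_snoc sum_divide_distrib[symmetric])
    also have "\<dots> = S ?E (Suc j)" unfolding S_def sum_extend ..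
    also have "?E = ?T (Suc j) \<union> (B \<union> L)" by (auto simp: B_def L_def)
    also have "S (?T (Suc j) \<union> (B \<union> L)) (Suc j) = S (?T (Suc j)) (Suc j) + (S B (Suc j) + S L (Suc j))"
    proof -
      have fin: "finite (?T (Suc j))" "finite B" "finite L" using finE by (auto simp: B_def L_def)
      have "?T (Suc j) \<inter> (B \<union> L) = {}" "B \<inter> L = {}" by (auto simp: B_def L_def)
      then show ?thesis unfolding S_def using fin by (simp add: sum.union_disjoint add_divide_distrib del: tame_words.simps)
    qed
    finally have split: "S (?T j) j = S (?T (Suc j)) (Suc j) + (S B (Suc j) + S L (Suc j))" .
    have B_bound: "\<bar>S B (Suc j)\<bar> \<le> sqrt (\<theta> * real n * \<rho> ^ r)"
    proof -
      have finB: "finite B" using finE by (auto simp: B_def)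
      have B_pos: "\<exists>l v k. cover_run ws = (v, k) \<and> M v = Some l \<and> run n \<psi> ws z = query l k \<and> \<bar>k\<bar> \<le> int R"
        if "ws \<in> B" for ws
      proof -
        obtain us a where ws: "ws = us @ [a]" "us \<in> ?T j" using \<open>ws \<in> B\<close> by (auto simp: B_def extend_def)
        obtain u i where u: "cover_run us = (u, i)" by (cases "cover_run us")
        obtain v k where v: "cover_run ws = (v, k)" by (cases "cover_run ws")
        obtain l where l: "M u = Some l" "run n \<psi> us z = query l i"
          using tame_pos[OF ws(2) u] by blast
        have "length us = j" using ws(2) tame_words_subset by (auto simp: words_def)
        then have "\<bar>i\<bar> < int R" "\<bar>k\<bar> \<le> int R"
          using cover_run_range[of us R u i] cover_run_range[of ws R v k] u v ws j R by auto
        moreover obtain l' where l': "M v = Some l'" using \<open>ws \<in> B\<close> v by (auto simp: B_def)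
        moreover have "cover_step a (u, i) = (v, k)" using v ws u by (simp add: cover_run_snoc)
        ultimately have "step n \<psi> a (run n \<psi> us z) = query l' k"
          by (intro step_position[where R = R and M = M and l = l and v = u and k = i and v' = v]) (use R(1) M(2,3) l in blast)+
        then show ?thesis using v l' ws \<open>\<bar>k\<bar> \<le> int R\<close> by (auto simp: run_snoc)
      qed
      have "\<bar>\<Sum>ws\<in>B. G (Suc j) (run n \<psi> ws z)\<bar> \<le> 4 ^ Suc j * sqrt (\<theta> * (\<Sum>y<n. (G (Suc j) y)\<^sup>2))"
      proof (rule spread_sum_bound[OF finB])
        show "run n \<psi> ws z < n" for ws by (rule run_less[OF p z])
        have "card B \<le> card (words (Suc j))" using Ew finite_words by (intro card_mono) (auto simp: B_def)
        then have "real (card B) \<le> real (4 ^ Suc j)" unfolding card_words by (rule of_nat_mono)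
        then show "real (card B) \<le> 4 ^ Suc j" by simp
        show "real (card {ws \<in> B. run n \<psi> ws z = y}) \<le> 4 ^ Suc j * \<theta>" for y
        proof (cases "{ws \<in> B. run n \<psi> ws z = y} = {}")
          case True
          then show ?thesis using \<theta> by (simp only: card.empty) simp
        next
          case False
          then obtain us where us: "us \<in> B" "run n \<psi> us z = y" by auto
          \<comment> \<open>Distinct lines are more than \<open>2 * R\<close> apart and
            displacements are at most \<open>R\<close>, so a position determines the tree state. The
            fibre is then bounded by the occupation of a single light state.\<close>
          have same: "cover_run ws = cover_run us" if ws: "ws \<in> B" "run n \<psi> ws z = y" for ws
          proof -
            obtain l v k where 1: "cover_run ws = (v, k)" "M v = Some l" "y = query l k" "\<bar>k\<bar> \<le> int R"
              using B_pos[OF ws(1)] ws(2) by auto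
            obtain l' v' k' where 2: "cover_run us = (v', k')" "M v' = Some l'" "y = query l' k'" "\<bar>k'\<bar> \<le> int R"
              using B_pos[OF us(1)] us(2) by auto
            have "0 \<le> int l + k" "0 \<le> int l' + k'" using M(2)[OF 1(2)] M(2)[OF 2(2)] 1(4) 2(4) by linarith+
            then have eq: "int l + k = int l' + k'" using 1(3) 2(3) by (simp add: query_def)
            have "v = v'"
            proof (rule ccontr)
              assume "v \<noteq> v'"
              then show False using sep[OF 1(2) 2(2)] eq 1(4) 2(4) by linarith
            qed
            then show ?thesis using 1 2 eq by simp
          qed
          have "card {ws \<in> B. run n \<psi> ws z = y} \<le> card {ws \<in> words (Suc j). cover_run ws = cover_run us}"
            using Ew finite_words same by (intro card_mono) (auto simp: B_def)
          then have "real (card {ws \<in> B. run n \<psi> ws z = y}) \<le> 4 ^ Suc j * state_weight (cover_run us)"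
            using occupation_bound[of "Suc j" "cover_run us"] by linarith
          also have "\<dots> \<le> 4 ^ Suc j * \<theta>" using us(1) by (intro mult_left_mono) (auto simp: B_def)
          finally show ?thesis .
        qed
      qed simp
      also have "\<dots> \<le> 4 ^ Suc j * sqrt (\<theta> * (real n * \<rho> ^ r))"
      proof -
        have "(\<Sum>y<n. (G (Suc j) y)\<^sup>2) \<le> \<rho> ^ (t - Suc j) * (\<Sum>y<n. (F y)\<^sup>2)"
          unfolding G_def by (rule kernel_op_pow_contraction[OF p \<rho>(1) contr F(1)])
        also have "\<dots> \<le> \<rho> ^ r * real n"
          using \<rho> F(2) j t by (intro mult_mono power_decreasing) (auto simp: sum_nonneg)
        finally show ?thesis using \<theta> by (simp add: mult.commute)
      qed
      finally show ?thesis unfolding S_def by (simp add: field_simps)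
    qed
    have L_bound: "\<bar>S L (Suc j)\<bar> \<le> 2 * \<eta>"
    proof -
      have "L \<subseteq> (\<Union>e\<in>?A. extend {ws \<in> words j. cover_run ws = node_state e})"
      proof
        fix ws assume "ws \<in> L"
        then obtain us q \<sigma> where ws: "ws = us @ [(q, \<sigma>)]" "us \<in> ?T j" "M (fst (cover_run ws)) = None"
          by (auto simp: L_def extend_def)
        obtain u i where u: "cover_run us = (u, i)" by (cases "cover_run us")
        \<comment> \<open>At time 0 the weight is 1; here \<theta> \<le> 1 enters.\<close>
        have heavy: "\<theta> \<le> state_weight (u, i)"
          using ws(2) u \<theta> by (cases j) (auto simp: cover_run_def)
        have alive: "M u \<noteq> None" using tame_pos[OF ws(2) u] by auto
        have us: "length us = j" "us \<in> words j" using ws(2) tame_words_subset by (auto simp: words_def)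
        then obtain m where m: "m \<le> j" "u \<in> main_nodes R m" and i: "\<bar>i\<bar> \<le> int j"
          using cover_run_range[of us R u i] u j R by auto
        have "(u, i) \<in> heavy_states R s \<theta>"
          using heavy m i j R by (auto simp: heavy_states_def simp del: state_weight.simps)
        then have tree: "a @ i # u \<in> tree_nodes R s \<theta>" if "a \<in> {[], [1], [-1]}" for a
          unfolding tree_nodes_def using that by (intro image_eqI[of _ _ "((u, i), a)"]) auto
        have q: q using ws(1,3) u alive by (auto simp: cover_run_snoc split: if_splits)
        then have none: "M (dir \<sigma> # i # u) = None" using ws(1,3) u by (simp add: cover_run_snoc)
        have ev: "even (length u)" using length_main_nodes[OF m(2)] by simp
        \<comment> \<open>The first missing point of the jump, so that its parent exists and the
          accident is counted in \<open>?A\<close>.\<close>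
        define e where "e = (if M (i # u) = None then i # u else dir \<sigma> # i # u)"
        have "e \<in> ?A"
          using tree[of "[]"] tree[of "[dir \<sigma>]"] none alive by (auto simp: e_def dir_def)
        moreover have "node_state e = (u, i)" using ev by (simp add: e_def node_state_simps)
        ultimately show "ws \<in> (\<Union>e\<in>?A. extend {ws \<in> words j. cover_run ws = node_state e})"
          using us u ws(1) by (intro UN_I[of e]) (auto simp: extend_def)
      qed
      then have "card L \<le> card (\<Union>e\<in>?A. extend {ws \<in> words j. cover_run ws = node_state e})"
        using finite_tree_nodes finite_words by (intro card_mono finite_UN_I finite_extend) auto
      also have "\<dots> \<le> (\<Sum>e\<in>?A. card (extend {ws \<in> words j. cover_run ws = node_state e}))"
        using finite_tree_nodes by (intro card_UN_le) auto
      also have "\<dots> \<le> (\<Sum>e\<in>?A. 4 * card {ws \<in> words j. cover_run ws = node_state e})"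
      proof (intro sum_mono)
        fix e
        have "card (extend {ws \<in> words j. cover_run ws = node_state e})
            \<le> card ({ws \<in> words j. cover_run ws = node_state e} \<times> (UNIV :: (bool \<times> bool) set))"
          unfolding extend_def using finite_words by (intro card_image_le finite_cartesian_product) auto
        also have "\<dots> = card {ws \<in> words j. cover_run ws = node_state e} * 4"
          by (simp add: card_cartesian_product UNIV_letters)
        finally show "card (extend {ws \<in> words j. cover_run ws = node_state e})
            \<le> 4 * card {ws \<in> words j. cover_run ws = node_state e}" by simp
      qed
      finally have "real (card L) \<le> real (\<Sum>e\<in>?A. 4 * card {ws \<in> words j. cover_run ws = node_state e})"
        by (rule of_nat_mono)
      also have "\<dots> = (\<Sum>e\<in>?A. 4 * real (card {ws \<in> words j. cover_run ws = node_state e}))"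
        by (simp only: of_nat_sum of_nat_mult of_nat_numeral)
      also have "\<dots> \<le> (\<Sum>e\<in>?A. 4 * (4 ^ j * state_weight (node_state e)))"
        by (intro sum_mono mult_left_mono occupation_bound) auto
      also have "\<dots> = 4 ^ Suc j * (\<Sum>e\<in>?A. state_weight (node_state e))"
        by (simp add: sum_distrib_left mult.assoc)
      also have "\<dots> \<le> 4 ^ Suc j * \<eta>" by (intro mult_left_mono lost) auto
      finally have card_L: "real (card L) \<le> 4 ^ Suc j * \<eta>" .
      have "\<bar>\<Sum>ws\<in>L. G (Suc j) (run n \<psi> ws z)\<bar> \<le> (\<Sum>ws\<in>L. 2)"
        by (intro order_trans[OF sum_abs] sum_mono G2 run_less[OF p z])
      also have "\<dots> \<le> 4 ^ Suc j * (2 * \<eta>)" using card_L by (simp add: algebra_simps)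
      finally show ?thesis unfolding S_def by (simp add: field_simps)
    qed
    show ?thesis unfolding split using B_bound L_bound by linarith
  qed
  have iter: "\<bar>S (?T 0) 0\<bar> \<le> \<bar>S (?T j) j\<bar> + real j * (2 * \<eta> + sqrt (\<theta> * real n * \<rho> ^ r))" if "j \<le> s" for j
    using that
  proof (induction j)
    case (Suc j)
    then show ?case using step[of j] by (simp add: algebra_simps del: tame_words.simps)
  qed simp
  have "\<bar>S (?T s) s\<bar> \<le> 2 * ((69 / 100) ^ s / sqrt \<theta>)"
  proof -
    let ?H = "{ws \<in> words s. \<theta> \<le> state_weight (cover_run ws)}"
    have "?T s \<subseteq> ?H"
      using tame_words_subset[of M \<theta> s] \<theta> by (cases s) (auto simp: cover_run_def)
    then have "card (?T s) \<le> card ?H" using finite_words by (intro card_mono) auto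
    then have "real (card (?T s)) / 4 ^ s \<le> real (card ?H) / 4 ^ s"
      by (intro divide_right_mono) auto
    then have c: "real (card (?T s)) / 4 ^ s \<le> (69 / 100) ^ s / sqrt \<theta>"
      using heavy_words_bound[OF \<theta>(1), of s] by (rule order_trans)
    have "\<bar>\<Sum>ws\<in>?T s. G s (run n \<psi> ws z)\<bar> \<le> (\<Sum>ws\<in>?T s. 2)"
      by (intro order_trans[OF sum_abs] sum_mono G2 run_less[OF p z])
    then have "\<bar>S (?T s) s\<bar> \<le> 2 * (real (card (?T s)) / 4 ^ s)"
      unfolding S_def by (simp add: field_simps)
    then show ?thesis using c by linarith
  qed
  moreover have "S (?T 0) 0 = (kernel_op n \<psi> ^^ t) F z" by (simp add: S_def G_def run_def)
  ultimately show ?thesis using iter[of s] by simp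
qed

section \<open>Mixing from all starting points\<close>

text \<open>In each round of at most \<open>m\<close> letters the word leading to a good point is
  taken with probability at least 4^(-m); otherwise the bound for one round fewer holds at the new
  position. Rounds vary in length, so \<open>reach\<close> asks for the bound \<delta> at all times
  from \<open>t\<close> on.\<close>

lemma mixing_from_everywhere:
  assumes p: "\<psi> permutes {..<n}" and F: "\<And>x. x < n \<Longrightarrow> \<bar>F x\<bar> \<le> 2" and \<delta>: "0 \<le> \<delta>"
    and reach: "\<And>x. x < n \<Longrightarrow> \<exists>ws. length ws \<le> m \<and> (\<forall>j\<ge>t. \<bar>(kernel_op n \<psi> ^^ j) F (run n \<psi> ws x)\<bar> \<le> \<delta>)"
    and x: "x < n" and j: "t + q * m \<le> j"
  shows "\<bar>(kernel_op n \<psi> ^^ j) F x\<bar> \<le> \<delta> + 2 * (1 - 1 / 4 ^ m) ^ q"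
  using x j
proof (induction q arbitrary: x j)
  case 0
  have "\<bar>(kernel_op n \<psi> ^^ j) F x\<bar> \<le> 2" by (rule kernel_op_bounded[OF p F 0(1)])
  then show ?case using \<delta> by simp
next
  case (Suc q)
  define B where "B = \<delta> + 2 * (1 - 1 / 4 ^ m) ^ q"
  obtain ws where ws: "length ws \<le> m" "\<And>j. t \<le> j \<Longrightarrow> \<bar>(kernel_op n \<psi> ^^ j) F (run n \<psi> ws x)\<bar> \<le> \<delta>"
    using reach[OF Suc.prems(1)] by auto
  define i where "i = length ws"
  have i: "i \<le> m" "i + (j - i) = j" "t + q * m \<le> j - i" "t \<le> j - i" using ws(1) Suc.prems(2) by (auto simp: i_def)
  let ?G = "\<lambda>u. (kernel_op n \<psi> ^^ (j - i)) F (run n \<psi> u x)"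
  have win: "ws \<in> words i" by (simp add: words_def i_def)
  have c: "0 \<le> 1 - 1 / (4 :: real) ^ m" by simp
  have "\<bar>\<Sum>u\<in>words i. ?G u\<bar> \<le> (\<Sum>u\<in>words i. \<bar>?G u\<bar>)" by (rule sum_abs)
  also have "\<dots> = \<bar>?G ws\<bar> + (\<Sum>u\<in>words i - {ws}. \<bar>?G u\<bar>)" by (rule sum.remove[OF finite_words win])
  also have "\<dots> \<le> \<delta> + (\<Sum>u\<in>words i - {ws}. B)"
    unfolding B_def using Suc.IH[OF run_less[OF p Suc.prems(1)] i(3)] ws(2)[OF i(4)]
    by (intro add_mono sum_mono) auto
  also have "\<dots> = \<delta> + (4 ^ i - 1) * B"
    using win finite_words by (simp add: card_Diff_singleton card_words of_nat_diff)
  \<comment> \<open>Every word contributes \<delta> once, so \<delta> does not accumulate over the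
    rounds.\<close>
  also have "\<dots> = 4 ^ i * (\<delta> + (1 - 1 / 4 ^ i) * (2 * (1 - 1 / 4 ^ m) ^ q))"
    by (simp add: B_def field_simps)
  also have "\<dots> \<le> 4 ^ i * (\<delta> + (1 - 1 / 4 ^ m) * (2 * (1 - 1 / 4 ^ m) ^ q))"
  proof (intro mult_left_mono add_left_mono mult_right_mono)
    have "(4 :: real) ^ i \<le> 4 ^ m" using i(1) by (intro power_increasing) auto
    then show "1 - 1 / (4 :: real) ^ i \<le> 1 - 1 / 4 ^ m" by (simp add: field_simps)
  qed (use c in auto)
  finally have "\<bar>\<Sum>u\<in>words i. ?G u\<bar> / 4 ^ i \<le> \<delta> + (1 - 1 / 4 ^ m) * (2 * (1 - 1 / 4 ^ m) ^ q)"
    by (simp add: field_simps)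
  moreover have "(kernel_op n \<psi> ^^ j) F x = (\<Sum>u\<in>words i. ?G u) / 4 ^ i"
    using kernel_op_pow_average[where m = i and j = "j - i"] i(2) by simp
  ultimately show ?case by (simp add: algebra_simps)
qed

lemma centered_test_function:
  fixes f :: "nat \<Rightarrow> real"
  assumes n: "0 < n" and f: "\<And>y. \<bar>f y\<bar> \<le> 1"
  defines "a \<equiv> (\<Sum>y<n. f y) / real n"
  shows "(\<Sum>x<n. f x - a) = 0" "(\<Sum>x<n. (f x - a)\<^sup>2) \<le> real n" "\<bar>f x - a\<bar> \<le> 2"
    "(kernel_op n \<psi> ^^ t) (\<lambda>x. f x - a) x = (kernel_op n \<psi> ^^ t) f x - a"
proof -
  have an: "(\<Sum>x<n. f x) = real n * a" using n by (simp add: a_def)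
  show "(\<Sum>x<n. f x - a) = 0" by (simp add: sum_subtractf an)
  have "(\<Sum>x<n. (f x - a)\<^sup>2) = (\<Sum>x<n. (f x)\<^sup>2) - 2 * a * (\<Sum>x<n. f x) + real n * a\<^sup>2"
    by (simp add: power2_diff sum.distrib sum_subtractf sum_distrib_left[symmetric] sum_distrib_right[symmetric] mult_ac)
  also have "\<dots> = (\<Sum>x<n. (f x)\<^sup>2) - real n * a\<^sup>2" unfolding an by (simp add: power2_eq_square)
  also have "\<dots> \<le> (\<Sum>x<n. (f x)\<^sup>2)" by simp
  also have "\<dots> \<le> (\<Sum>x<n. 1)" using f by (intro sum_mono) (simp add: abs_square_le_1)
  finally show "(\<Sum>x<n. (f x - a)\<^sup>2) \<le> real n" by simp
  have "\<bar>\<Sum>x<n. f x\<bar> \<le> (\<Sum>x<n. 1)" using f by (intro order_trans[OF sum_abs] sum_mono) auto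
  then have "\<bar>a\<bar> \<le> 1" using n by (simp add: a_def field_simps)
  then show "\<bar>f x - a\<bar> \<le> 2" using f[of x] by linarith
  show "(kernel_op n \<psi> ^^ t) (\<lambda>x. f x - a) x = (kernel_op n \<psi> ^^ t) f x - a"
    using kernel_op_pow_average[where m = t and j = 0 and n = n and \<psi> = \<psi>]
    by (simp add: sum_subtractf card_words diff_divide_distrib)
qed

text \<open>Longest nodes come first because \<open>explore\<close> works from the end of the list;
  this amounts to breadth-first exploration.\<close>

lemma tree_nodes_list:
  obtains L where "set L = tree_nodes R s \<theta>" "distinct L" "sorted_wrt (\<lambda>a b. length b \<le> length a) L"
    "length L = card (tree_nodes R s \<theta>)"
proof -
  obtain xs where xs: "set xs = tree_nodes R s \<theta>" "distinct xs"
    using finite_distinct_list[OF finite_tree_nodes] by blast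
  have "sorted_wrt (\<lambda>a b. length b \<le> length a) (rev (sort_key length xs))"
    using sorted_sort_key[of length xs] by (simp add: sorted_wrt_rev sorted_map)
  then show thesis using that[of "rev (sort_key length xs)"] xs distinct_card[OF xs(2)] by simp
qed

definition uniformly_close :: "nat \<Rightarrow> nat \<Rightarrow> real \<Rightarrow> (nat \<Rightarrow> nat) \<Rightarrow> bool" where
  "uniformly_close n t \<delta> \<psi> \<longleftrightarrow> (\<forall>f x. x < n \<longrightarrow> (\<forall>y. \<bar>f y\<bar> \<le> 1) \<longrightarrow>
     \<bar>(kernel_op n \<psi> ^^ t) f x - (\<Sum>y<n. f y) / real n\<bar> \<le> \<delta>)"

definition gap_rate :: real where "gap_rate = 1 - 1 / (64 * 40\<^sup>2)"

text \<open>Union bound over the failure of expansion and, for every start, the absence of a good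
  point within \<open>m\<close> letters. Otherwise \<open>kernel_op_contraction\<close> with
  \<open>M = 40\<close> gives \<open>gap_rate\<close>, and \<open>good_start_mixing\<close> supplies
  the hypothesis of \<open>mixing_from_everywhere\<close>. The radius \<open>s + m\<close> covers
  both the displacements of the main walk and those of the branches.\<close>

lemma card_not_uniformly_close:
  fixes n m R s N r q :: nat
  assumes n: "2 \<le> n" "2 * m \<le> n" and R: "R = s + m" "1 \<le> R"
    and \<theta>: "0 < \<theta>" "\<theta> \<le> 1" and \<eta>: "0 < \<eta>" "\<eta> < 1"
    and N: "m * (card (tree_nodes R s \<theta>) + 2) \<le> N" "N < n"
  defines "\<delta> \<equiv> 2 * (69 / 100) ^ s / sqrt \<theta> + real s * (2 * \<eta> + sqrt (\<theta> * real n * gap_rate ^ r))"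
  shows "real (card {\<psi>. \<psi> permutes {..<n} \<and>
      \<not> uniformly_close n (s + r + q * m) (\<delta> + 2 * (1 - 1 / 4 ^ m) ^ q) \<psi>})
    \<le> fact n * (4 * real n * (1 / (real n)\<^sup>2 + sqrt (1 / 2) powr sqrt (real n))
        + real n * ((2 + 6 * (real s + 1)) * accident_bound n R N / \<eta>) ^ m)"
proof -
  let ?h = "\<lambda>e. state_weight (node_state e)"
  let ?bad = "{\<psi>. \<psi> permutes {..<n} \<and> \<not> uniformly_close n (s + r + q * m) (\<delta> + 2 * (1 - 1 / 4 ^ m) ^ q) \<psi>}"
  let ?E = "{\<psi>. \<psi> permutes {..<n} \<and> \<not> expanding n 40 \<psi>}"
  let ?B = "\<lambda>x. {\<psi>. \<psi> permutes {..<n} \<and>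
      \<not> (\<exists>ws. length ws \<le> m \<and> good_start n R \<psi> (tree_nodes R s \<theta>) ?h \<eta> (run n \<psi> ws x))}"
  obtain L where L: "set L = tree_nodes R s \<theta>" "distinct L" "sorted_wrt (\<lambda>a b. length b \<le> length a) L"
    "length L = card (tree_nodes R s \<theta>)" by (rule tree_nodes_list)
  have rate: "0 \<le> gap_rate" "gap_rate \<le> 1" by (auto simp: gap_rate_def)
  have \<delta>0: "0 \<le> \<delta>" using \<theta> \<eta> rate by (simp add: \<delta>_def)
  have a0: "0 \<le> accident_bound n R N" by (simp add: accident_bound_def)
  have fin: "finite {\<psi>. \<psi> permutes {..<n} \<and> Q \<psi>}" for Q
    by (rule finite_subset[OF _ finite_permutations[of "{..<n}"]]) auto
  have "?bad \<subseteq> ?E \<union> (\<Union>x\<in>{..<n}. ?B x)"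
  proof
    fix \<psi> assume bad: "\<psi> \<in> ?bad"
    show "\<psi> \<in> ?E \<union> (\<Union>x\<in>{..<n}. ?B x)"
    proof (rule ccontr)
      assume "\<psi> \<notin> ?E \<union> (\<Union>x\<in>{..<n}. ?B x)"
      then have p: "\<psi> permutes {..<n}" and ex: "expanding n 40 \<psi>"
        and good: "\<And>x. x < n \<Longrightarrow> \<exists>ws. length ws \<le> m \<and> good_start n R \<psi> (tree_nodes R s \<theta>) ?h \<eta> (run n \<psi> ws x)"
        using bad by auto
      have contr: "(\<Sum>x<n. (kernel_op n \<psi> f x)\<^sup>2) \<le> gap_rate * (\<Sum>x<n. (f x)\<^sup>2)"
        if "(\<Sum>x<n. f x) = 0" for f
        using kernel_op_contraction[OF p ex _ that] by (simp add: gap_rate_def)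
      have "\<bar>(kernel_op n \<psi> ^^ (s + r + q * m)) f x - (\<Sum>y<n. f y) / real n\<bar> \<le> \<delta> + 2 * (1 - 1 / 4 ^ m) ^ q"
        if x: "x < n" and f: "\<And>y. \<bar>f y\<bar> \<le> 1" for f x
      proof -
        let ?F = "\<lambda>x. f x - (\<Sum>y<n. f y) / real n"
        have n0: "0 < n" using n by simp
        note F = centered_test_function[OF n0 f]
        have "\<exists>ws. length ws \<le> m \<and> (\<forall>j\<ge>s + r. \<bar>(kernel_op n \<psi> ^^ j) ?F (run n \<psi> ws x)\<bar> \<le> \<delta>)" if x': "x < n" for x
        proof -
          obtain ws where ws: "length ws \<le> m" "good_start n R \<psi> (tree_nodes R s \<theta>) ?h \<eta> (run n \<psi> ws x)"
            using good[OF x'] by blast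
          have "\<bar>(kernel_op n \<psi> ^^ j) ?F (run n \<psi> ws x)\<bar> \<le> \<delta>" if "s + r \<le> j" for j
            unfolding \<delta>_def using R \<eta>
            by (intro good_start_mixing[OF p rate contr ws(2) R(2) _ \<theta> _ F(1,2,3) that]) auto
          then show ?thesis using ws(1) by blast
        qed
        then have "\<bar>(kernel_op n \<psi> ^^ (s + r + q * m)) ?F x\<bar> \<le> \<delta> + 2 * (1 - 1 / 4 ^ m) ^ q"
          by (intro mixing_from_everywhere[OF p F(3) \<delta>0 _ x]) auto
        then show ?thesis unfolding F(4) .
      qed
      then show False using bad unfolding uniformly_close_def by blast
    qed
  qed
  then have "card ?bad \<le> card (?E \<union> (\<Union>x\<in>{..<n}. ?B x))"
    by (intro card_mono finite_UnI finite_UN_I fin) auto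
  also have "\<dots> \<le> card ?E + card (\<Union>x\<in>{..<n}. ?B x)" by (rule card_Un_le)
  also have "\<dots> \<le> card ?E + (\<Sum>x<n. card (?B x))" by (intro add_left_mono card_UN_le) simp
  finally have "real (card ?bad) \<le> real (card ?E + (\<Sum>x<n. card (?B x)))" by (rule of_nat_mono)
  also have "\<dots> = real (card ?E) + (\<Sum>x<n. real (card (?B x)))" by simp
  also have "real (card ?E) \<le> fact n * (4 * real n * (1 / (real n)\<^sup>2 + sqrt (1 / 2) powr sqrt (real n)))"
    using n by (intro order_trans[OF card_not_expanding_le mult_left_mono] sum_power_ratio_le) auto
  also have "(\<Sum>x<n. real (card (?B x)))
      \<le> (\<Sum>x<n. ((2 + 6 * (real s + 1)) * accident_bound n R N / \<eta>) ^ m * fact n)"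
  proof (intro sum_mono)
    fix x assume "x \<in> {..<n}"
    then have x: "x < n" by simp
    have "real (card (?B x)) \<le> ((2 + sum ?h (tree_nodes R s \<theta>)) * accident_bound n R N / \<eta>) ^ m * fact n"
      unfolding L(1)[symmetric]
    proof (rule card_no_good_start[OF x n(2) _ R(2) L(2) _ L(3) _ N(2) _ \<eta>])
      show "e \<noteq> [] \<and> \<bar>hd e\<bar> \<le> int R" if "e \<in> set L" for e
        using that R(2) unfolding L(1) by (rule tree_nodes_hd)
      show "m * (length L + 2) \<le> N" using N(1) L(4) by simp
    qed (use R state_weight_pos in \<open>auto simp: less_imp_le simp del: state_weight.simps\<close>)
    also have "\<dots> \<le> ((2 + 6 * (real s + 1)) * accident_bound n R N / \<eta>) ^ m * fact n"
      using a0 \<eta> sum_tree_nodes[of R s \<theta>] state_weight_pos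
      by (intro mult_right_mono power_mono divide_right_mono mult_right_mono divide_nonneg_pos mult_nonneg_nonneg add_nonneg_nonneg sum_nonneg)
        (auto simp: less_imp_le)
    finally show "real (card (?B x)) \<le> ((2 + 6 * (real s + 1)) * accident_bound n R N / \<eta>) ^ m * fact n" .
  qed
  finally show ?thesis by (simp add: algebra_simps)
qed

section \<open>Asymptotics\<close>

definition phase :: "real \<Rightarrow> nat \<Rightarrow> nat" where
  "phase c n = nat \<lfloor>c * (ln (real n) / ln 2)\<rfloor>"

lemma phase_bounds:
  assumes "0 \<le> c" "1 \<le> n"
  shows "real (phase c n) \<le> c * (ln (real n) / ln 2)" "c * (ln (real n) / ln 2) - 1 \<le> real (phase c n)"
proof -
  have "0 \<le> c * (ln (real n) / ln 2)" using assms by simp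
  then have "real (phase c n) = real_of_int \<lfloor>c * (ln (real n) / ln 2)\<rfloor>" by (simp add: phase_def)
  then show "real (phase c n) \<le> c * (ln (real n) / ln 2)" "c * (ln (real n) / ln 2) - 1 \<le> real (phase c n)"
    by linarith+
qed

lemma filterlim_phase:
  assumes "0 < c"
  shows "filterlim (phase c) at_top at_top"
proof -
  have "filterlim (\<lambda>n. c * (ln (real n) / ln 2)) at_top at_top" using assms by real_asymp
  then show ?thesis unfolding phase_def
    by (intro filterlim_compose[OF filterlim_nat_sequentially] filterlim_compose[OF filterlim_floor_sequentially])
qed

text \<open>Rounding the number of steps down costs at most one factor 1 / b.\<close>

lemma power_phase_le:
  assumes b: "0 < b" "b \<le> 1" and c: "0 \<le> c" and n: "1 \<le> n"
  shows "b ^ phase c n \<le> real n powr (c * ln b / ln 2) / b"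
proof -
  have "ln b \<le> 0" using b by simp
  have "b ^ phase c n = exp (real (phase c n) * ln b)" using b by (simp add: exp_of_nat_mult)
  also have "\<dots> \<le> exp ((c * (ln (real n) / ln 2) - 1) * ln b)"
    using phase_bounds(2)[OF c n] \<open>ln b \<le> 0\<close> by (simp add: mult_right_mono_neg)
  also have "\<dots> = exp (c * ln b / ln 2 * ln (real n)) * exp (- ln b)"
    by (simp add: exp_add[symmetric] field_simps)
  also have "\<dots> = real n powr (c * ln b / ln 2) / b"
    using b n by (simp add: powr_def exp_minus divide_inverse)
  finally show ?thesis .
qed

text \<open>Half of what contraction gains: \<open>gap_rate ^ phase (2 / 100) n\<close> is
  n^(-2\<eta>) up to a constant for \<eta> = \<open>gap_exponent\<close>, so a density n^\<eta>
  still leaves n^(-\<eta>).\<close>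

definition gap_exponent :: real where "gap_exponent = - (1 / 100) * ln gap_rate / ln 2"

lemma gap_rate_bounds: "0 < gap_rate" "gap_rate < 1"
  by (auto simp: gap_rate_def)

lemma gap_exponent_bounds: "0 < gap_exponent" "gap_exponent < 1"
proof -
  have "ln gap_rate < 0" using gap_rate_bounds by simp
  then show "0 < gap_exponent" by (simp add: gap_exponent_def divide_neg_pos)
  have "- ln gap_rate = ln (1 / gap_rate)" using gap_rate_bounds by (simp add: ln_div)
  also have "\<dots> \<le> 1 / gap_rate - 1" using gap_rate_bounds by (intro ln_le_minus_one) simp
  also have "\<dots> \<le> 1" by (simp add: gap_rate_def)
  finally have "- ln gap_rate \<le> 1" .
  moreover have "1 / 2 \<le> ln (2::real)" using ln2_ge_two_thirds by linarith
  ultimately have "- (1 / 100) * ln gap_rate < ln 2" by linarith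
  then show "gap_exponent < 1" unfolding gap_exponent_def by (subst pos_divide_less_eq) auto
qed

definition threshold :: "nat \<Rightarrow> real" where "threshold n = real n powr (gap_exponent - 1)"

definition main_phase :: "nat \<Rightarrow> nat" where "main_phase = phase (94 / 100)"

text \<open>Small enough to vanish after summation over the main phase, yet only polylogarithmically
  small, so that Markov's inequality costs no power of \<open>n\<close>.\<close>

definition loss :: "nat \<Rightarrow> real" where "loss n = 1 / (real (main_phase n) + 2)\<^sup>2"

definition start_error :: "nat \<Rightarrow> real" where
  "start_error n = 2 * (69 / 100) ^ main_phase n / sqrt (threshold n)
     + real (main_phase n) * (2 * loss n + sqrt (threshold n * real n * gap_rate ^ phase (2 / 100) n))"

lemma main_phase_le:
  assumes "1 \<le> n"
  shows "real (main_phase n) \<le> 2 * ln (real n)"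
proof -
  have "real (main_phase n) \<le> 94 / 100 * (ln (real n) / ln 2)"
    unfolding main_phase_def using assms by (intro phase_bounds) auto
  also have "\<dots> \<le> 94 / 100 * (ln (real n) / (2 / 3))"
    using assms ln2_ge_two_thirds by (intro mult_left_mono divide_left_mono) auto
  also have "\<dots> \<le> 2 * ln (real n)" using assms by simp
  finally show ?thesis .
qed

lemma start_error_tendsto: "start_error \<longlonglongrightarrow> 0"
proof (rule tendsto_sandwich)
  let ?u = "\<lambda>n. 200 / 69 * real n powr (- gap_exponent / 2)
    + (2 / (94 / 100 * (ln (real n) / ln 2) + 1) + 2 * ln (real n) * (real n powr (- gap_exponent / 2) / sqrt gap_rate))"
  show "\<forall>\<^sub>F n in sequentially. 0 \<le> start_error n"
    unfolding start_error_def loss_def threshold_def using gap_rate_bounds by (intro always_eventually allI) simp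
  show "\<forall>\<^sub>F n in sequentially. start_error n \<le> ?u n"
    using eventually_ge_at_top[of 1]
  proof eventually_elim
    case (elim n)
    then have n: "1 \<le> n" "0 < real n" by auto
    have l2: "0 < ln (2::real)" by simp
    \<comment> \<open>A rational certificate for 0.69^0.94 \<le> 2^(-1/2), the reason for the length
      0.94 log_2 n: 94 log_2 (100/69) is about 50.3.\<close>
    have "(2::real) ^ 50 \<le> (100 / 69) ^ 94" by (simp add: field_simps)
    then have "ln ((2::real) ^ 50) \<le> ln ((100 / 69) ^ 94)" by (intro ln_mono) auto
    also have "ln ((100 / 69 :: real) ^ 94) = real 94 * ln (100 / 69)" by (rule ln_realpow)
    also have "ln ((2::real) ^ 50) = real 50 * ln 2" by (rule ln_realpow)
    finally have "50 * ln 2 \<le> 94 * ln (100 / 69 :: real)" by simp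
    moreover have "ln (100 / 69 :: real) = - ln (69 / 100)" by (simp add: ln_div)
    ultimately have "94 / 100 * ln (69 / 100) \<le> - (1 / 2) * ln (2::real)" by linarith
    then have exp: "94 / 100 * ln (69 / 100) / ln 2 \<le> - (1 / 2 :: real)"
      by (rule iffD2[OF pos_divide_le_eq[OF l2]])
    have "(69 / 100) ^ main_phase n \<le> real n powr (94 / 100 * ln (69 / 100) / ln 2) / (69 / 100)"
      unfolding main_phase_def by (rule power_phase_le) (use n in auto)
    also have "\<dots> \<le> real n powr (- (1 / 2)) / (69 / 100)"
      using n by (intro divide_right_mono powr_mono exp) auto
    finally have A: "(69 / 100) ^ main_phase n \<le> 100 / 69 * real n powr (- (1 / 2))" by simp
    have sq: "sqrt (threshold n) = real n powr ((gap_exponent - 1) / 2)"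
      unfolding threshold_def by (simp add: powr_half_sqrt[symmetric] powr_powr)
    have "2 * (69 / 100) ^ main_phase n / sqrt (threshold n)
        \<le> 2 * (100 / 69 * real n powr (- (1 / 2))) / real n powr ((gap_exponent - 1) / 2)"
      unfolding sq using A by (intro divide_right_mono) auto
    also have "\<dots> = 200 / 69 * (real n powr (- (1 / 2)) / real n powr ((gap_exponent - 1) / 2))" by simp
    also have "real n powr (- (1 / 2)) / real n powr ((gap_exponent - 1) / 2) = real n powr (- gap_exponent / 2)"
      unfolding powr_diff[symmetric] by (simp add: field_simps)
    finally have 1: "2 * (69 / 100) ^ main_phase n / sqrt (threshold n) \<le> 200 / 69 * real n powr (- gap_exponent / 2)" .
    have "gap_rate ^ phase (2 / 100) n \<le> real n powr (2 / 100 * ln gap_rate / ln 2) / gap_rate"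
      using n gap_rate_bounds by (intro power_phase_le) auto
    also have "2 / 100 * ln gap_rate / ln 2 = - 2 * gap_exponent" by (simp add: gap_exponent_def)
    finally have "threshold n * real n * gap_rate ^ phase (2 / 100) n
        \<le> threshold n * real n * (real n powr (- 2 * gap_exponent) / gap_rate)"
      by (intro mult_left_mono) (auto simp: threshold_def)
    also have "threshold n * real n * (real n powr (- 2 * gap_exponent) / gap_rate)
        = real n powr gap_exponent * (real n powr (- 2 * gap_exponent) / gap_rate)"
      using n powr_add[of "real n" "gap_exponent - 1" 1] by (simp add: threshold_def)
    also have "real n powr gap_exponent * (real n powr (- 2 * gap_exponent) / gap_rate) = real n powr (- gap_exponent) / gap_rate"
      by (simp add: powr_add[symmetric])
    finally have "sqrt (threshold n * real n * gap_rate ^ phase (2 / 100) n) \<le> sqrt (real n powr (- gap_exponent) / gap_rate)"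
      by (rule real_sqrt_le_mono)
    also have "\<dots> = real n powr (- gap_exponent / 2) / sqrt gap_rate"
      by (simp add: real_sqrt_divide powr_half_sqrt[symmetric] powr_powr)
    finally have 2: "sqrt (threshold n * real n * gap_rate ^ phase (2 / 100) n) \<le> real n powr (- gap_exponent / 2) / sqrt gap_rate" .
    let ?s = "real (main_phase n)"
    have "?s * (2 * loss n) \<le> (?s + 2) * (2 * loss n)" by (intro mult_right_mono) (auto simp: loss_def)
    also have "\<dots> = 2 / (?s + 2)"
    proof -
      have "?s + 2 \<noteq> 0" by linarith
      then show ?thesis unfolding loss_def power2_eq_square by (simp add: divide_simps)
    qed
    also have "\<dots> \<le> 2 / (94 / 100 * (ln (real n) / ln 2) + 1)"
    proof (intro divide_left_mono mult_pos_pos)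
      show "94 / 100 * (ln (real n) / ln 2) + 1 \<le> ?s + 2"
        using phase_bounds(2)[of "94 / 100" n] n by (simp add: main_phase_def)
      have "0 \<le> ln (real n) / ln 2" using n by simp
      then show "0 < 94 / 100 * (ln (real n) / ln 2) + 1" by linarith
    qed auto
    finally have 3: "?s * (2 * loss n) \<le> 2 / (94 / 100 * (ln (real n) / ln 2) + 1)" .
    have 4: "?s * sqrt (threshold n * real n * gap_rate ^ phase (2 / 100) n)
        \<le> 2 * ln (real n) * (real n powr (- gap_exponent / 2) / sqrt gap_rate)"
      using n main_phase_le[OF n(1)] gap_rate_bounds by (intro mult_mono 2) (auto simp: threshold_def)
    show ?case unfolding start_error_def distrib_left using 1 3 4 by linarith
  qed
  have "0 < sqrt gap_rate" using gap_rate_bounds by simp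
  then show "?u \<longlonglongrightarrow> 0" using gap_exponent_bounds(1) by real_asymp
qed simp

definition node_bound :: "nat \<Rightarrow> nat \<Rightarrow> nat" where
  "node_bound m n = m * (card (tree_nodes (main_phase n + m) (main_phase n) (threshold n)) + 2)"

definition branch_error :: "nat \<Rightarrow> nat \<Rightarrow> real" where
  "branch_error m n = (2 + 6 * (real (main_phase n) + 1)) * accident_bound n (main_phase n + m) (node_bound m n) / loss n"

text \<open>About n^(1 - \<eta>) revealed points give accident probability n^(-\<eta>), both up to
  powers of ln n. Half of the exponent is given up to absorb all logarithmic factors.\<close>

lemma branch_error_small:
  shows "\<forall>\<^sub>F n in sequentially. node_bound m n < n \<and> 0 \<le> branch_error m n \<and>
    branch_error m n \<le> real n powr (- gap_exponent / 2)"
proof -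
  \<comment> \<open>The three bounds anticipate the estimates with \<open>l\<close> = (ln n)^2:
    twice the node count 8 l^2 a gives 16 l^2, and 8 l * 94 l^3 * l^2 = 752 l^6.\<close>
  have e1: "\<forall>\<^sub>F n in sequentially. 2 * ln (real n) + real m + 2 \<le> ln (real n) ^ 2" by real_asymp
  have e2: "\<forall>\<^sub>F n in sequentially. 16 * ln (real n) ^ 4 * real n powr (- gap_exponent) \<le> 1"
    using gap_exponent_bounds(1) by real_asymp
  have e3: "\<forall>\<^sub>F n in sequentially. 752 * ln (real n) ^ 12 * real n powr (- gap_exponent / 2) \<le> 1"
    using gap_exponent_bounds(1) by real_asymp
  show ?thesis
    using e1 e2 e3 eventually_ge_at_top[of 1]
  proof eventually_elim
    case (elim n)
    let ?N = "node_bound m n" and ?R = "main_phase n + m" and ?s = "real (main_phase n)"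
    define l where "l = ln (real n) ^ 2"
    define a where "a = real n powr (1 - gap_exponent)"
    have n: "1 \<le> n" "0 < real n" using elim by auto
    have sl: "?s + real m + 2 \<le> l" using elim(1) main_phase_le[OF n(1)] by (simp add: l_def)
    have a1: "1 \<le> a" using n gap_exponent_bounds by (simp add: a_def ge_one_powr_ge_zero)
    have l2: "2 \<le> l" using sl by linarith
    have an: "a = real n * real n powr (- gap_exponent)"
      using n powr_add[of "real n" 1 "- gap_exponent"] by (simp add: a_def)
    have th: "0 < threshold n" "1 / threshold n = a"
      using n by (auto simp: threshold_def a_def powr_minus_divide[symmetric])
    have "real (card (tree_nodes ?R (main_phase n) (threshold n))) \<le> 6 * (?s + 1) * a"
      using card_tree_nodes[OF th(1), of ?R "main_phase n"] th(2) by (simp add: divide_inverse)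
    then have "real (card (tree_nodes ?R (main_phase n) (threshold n))) + 2 \<le> 6 * (?s + 1) * a + 2 * a"
      using a1 by linarith
    also have "\<dots> \<le> 8 * (?s + real m + 2) * a"
      unfolding distrib_right[symmetric] using a1 by (intro mult_right_mono) auto
    also have "\<dots> \<le> 8 * l * a" using sl a1 by (intro mult_right_mono) auto
    finally have card: "real (card (tree_nodes ?R (main_phase n) (threshold n))) + 2 \<le> 8 * l * a" .
    have "real ?N = real m * (real (card (tree_nodes ?R (main_phase n) (threshold n))) + 2)"
      by (simp add: node_bound_def algebra_simps)
    also have "\<dots> \<le> l * (8 * l * a)" using card sl by (intro mult_mono) auto
    finally have N: "real ?N \<le> 8 * l ^ 2 * a" by (simp add: power2_eq_square mult_ac)
    have "real n * (16 * l ^ 2 * real n powr (- gap_exponent)) \<le> real n * 1"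
      using elim(2) n by (intro mult_left_mono) (auto simp: l_def)
    then have Nn: "2 * real ?N \<le> real n" using N by (simp add: an mult_ac)
    then have "?N < n" using n by linarith
    have "real ((?N + 1) * (4 * ?R + 1) + 2 * ?R) = (real ?N + 1) * (4 * real ?R + 1) + 2 * real ?R"
      by (simp add: algebra_simps)
    also have "\<dots> \<le> (9 * l ^ 2 * a) * (5 * l) + 2 * l ^ 3 * a"
    proof (rule add_mono[OF mult_mono])
      have la: "1 \<le> l ^ 2 * a" using l2 a1 mult_mono[of 1 "l ^ 2" 1 a] by simp
      then show "real ?N + 1 \<le> 9 * l ^ 2 * a" using N by linarith
      show "4 * real ?R + 1 \<le> 5 * l" using sl by simp
      have "2 * real ?R \<le> 2 * l * 1" using sl by simp
      also have "\<dots> \<le> 2 * l * (l ^ 2 * a)" using la l2 by (intro mult_left_mono) auto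
      finally show "2 * real ?R \<le> 2 * l ^ 3 * a" by (simp add: power3_eq_cube power2_eq_square mult_ac)
    qed (use l2 a1 in auto)
    also have "\<dots> = 47 * l ^ 3 * a" by (simp add: power3_eq_cube power2_eq_square)
    finally have num: "real ((?N + 1) * (4 * ?R + 1) + 2 * ?R) \<le> 47 * l ^ 3 * a" .
    have "accident_bound n ?R ?N \<le> 47 * l ^ 3 * a / (real n / 2)"
      unfolding accident_bound_def using num Nn n l2 a1
      by (intro frac_le) (auto simp: of_nat_diff)
    also have "\<dots> = 94 * l ^ 3 * real n powr (- gap_exponent)" using n by (simp add: an)
    finally have acc: "accident_bound n ?R ?N \<le> 94 * l ^ 3 * real n powr (- gap_exponent)" .
    have acc0: "0 \<le> accident_bound n ?R ?N" by (simp add: accident_bound_def)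
    have be: "branch_error m n = (2 + 6 * (?s + 1)) * accident_bound n ?R ?N * (?s + 2)\<^sup>2"
      by (simp add: branch_error_def loss_def)
    also have "\<dots> \<le> (8 * l) * (94 * l ^ 3 * real n powr (- gap_exponent)) * l\<^sup>2"
      using sl acc acc0 l2 by (intro mult_mono power_mono) auto
    also have "\<dots> = 752 * l ^ 6 * real n powr (- gap_exponent / 2) * real n powr (- gap_exponent / 2)"
      using powr_add[of "real n" "- gap_exponent / 2" "- gap_exponent / 2"] by (simp add: power_numeral_reduce)
    also have "\<dots> \<le> 1 * real n powr (- gap_exponent / 2)"
      using elim(3) by (intro mult_right_mono) (auto simp: l_def)
    finally have "branch_error m n \<le> real n powr (- gap_exponent / 2)" by simp
    moreover have "0 \<le> branch_error m n" unfolding be using acc0 by simp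
    ultimately show ?case using \<open>?N < n\<close> by simp
  qed
qed

text \<open>At n^(-\<eta>/2) per branch, 4 / \<eta> branches all fail with probability at most
  n^(-2), which survives the union bound over \<open>n\<close> starts.\<close>

definition branches :: nat where "branches = nat \<lceil>4 / gap_exponent\<rceil>"

lemma branches_bounds: "1 \<le> branches" "4 \<le> real branches * gap_exponent"
proof -
  have "0 < 4 / gap_exponent" using gap_exponent_bounds by simp
  then have "4 / gap_exponent \<le> real branches" unfolding branches_def by linarith
  then show "4 \<le> real branches * gap_exponent" using gap_exponent_bounds by (simp add: field_simps)
  then show "1 \<le> branches" by (cases branches) auto
qed

text \<open>The last summand is the number of rounds times their length \<open>branches\<close>. As
  \<open>branches\<close> is constant, the number of rounds tends to infinity within a share of 0.02
  log_2 n.\<close>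

definition mixing_time :: "nat \<Rightarrow> nat" where
  "mixing_time n = main_phase n + phase (2 / 100) n + phase (2 / 100 / real branches) n * branches"

lemma mixing_time_le:
  assumes "1 \<le> n"
  shows "real (mixing_time n) \<le> ln (real n) / ln 2"
proof -
  have "real (phase (2 / 100 / real branches) n) * real branches
      \<le> 2 / 100 / real branches * (ln (real n) / ln 2) * real branches"
    using assms by (intro mult_right_mono phase_bounds) auto
  also have "\<dots> = 2 / 100 * (ln (real n) / ln 2)" using branches_bounds by simp
  finally have "real (mixing_time n)
      \<le> 94 / 100 * (ln (real n) / ln 2) + 2 / 100 * (ln (real n) / ln 2) + 2 / 100 * (ln (real n) / ln 2)"
    unfolding mixing_time_def main_phase_def of_nat_add of_nat_mult using assms
    by (intro add_mono phase_bounds) auto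
  moreover have "0 \<le> ln (real n) / ln 2" using assms by simp
  ultimately show ?thesis by linarith
qed

lemma uniformly_close_mono: "uniformly_close n t \<delta> \<psi> \<Longrightarrow> \<delta> \<le> \<epsilon> \<Longrightarrow> uniformly_close n t \<epsilon> \<psi>"
  unfolding uniformly_close_def by (meson order_trans)

lemma eventually_card_not_uniformly_close:
  assumes \<epsilon>: "0 < \<epsilon>"
  shows "\<forall>\<^sub>F n in sequentially. real (card {\<psi>. \<psi> permutes {..<n} \<and> \<not> uniformly_close n (mixing_time n) \<epsilon> \<psi>})
    \<le> fact n * (4 * real n * (1 / (real n)\<^sup>2 + sqrt (1 / 2) powr sqrt (real n)) + 1 / real n)"
proof -
  let ?c = "1 - 1 / 4 ^ branches :: real" and ?q = "phase (2 / 100 / real branches)"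
  have "1 / 4 ^ branches \<le> (1 :: real)" by simp
  then have c: "norm ?c < 1" by simp
  have "filterlim ?q sequentially sequentially"
    using branches_bounds by (intro filterlim_phase) simp
  then have "(\<lambda>n. ?c ^ ?q n) \<longlonglongrightarrow> 0"
    by (rule filterlim_compose[OF LIMSEQ_power_zero[OF c]])
  then have "(\<lambda>n. start_error n + 2 * ?c ^ ?q n) \<longlonglongrightarrow> 0 + 2 * 0"
    by (intro tendsto_intros start_error_tendsto)
  then have "\<forall>\<^sub>F n in sequentially. start_error n + 2 * ?c ^ ?q n < \<epsilon>"
    using \<epsilon> by (auto dest: order_tendstoD(2))
  then show ?thesis
    using branch_error_small[of branches] eventually_ge_at_top[of "2 * branches"]
  proof eventually_elim
    case (elim n)
    have n: "2 * branches \<le> n" "2 \<le> n" "1 \<le> n" using elim branches_bounds by auto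
    let ?bad = "\<lambda>\<delta>. {\<psi>. \<psi> permutes {..<n} \<and> \<not> uniformly_close n (mixing_time n) \<delta> \<psi>}"
    have "?bad \<epsilon> \<subseteq> ?bad (start_error n + 2 * ?c ^ ?q n)"
      using elim(1) uniformly_close_mono[OF _ less_imp_le] by blast
    then have "card (?bad \<epsilon>) \<le> card (?bad (start_error n + 2 * ?c ^ ?q n))"
      by (intro card_mono finite_subset[OF _ finite_permutations[of "{..<n}"]]) auto
    then have "real (card (?bad \<epsilon>)) \<le> real (card (?bad (start_error n + 2 * ?c ^ ?q n)))" by simp
    also have "\<dots> \<le> fact n * (4 * real n * (1 / (real n)\<^sup>2 + sqrt (1 / 2) powr sqrt (real n))
        + real n * branch_error branches n ^ branches)"
      unfolding mixing_time_def start_error_def branch_error_def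
    proof (rule card_not_uniformly_close)
      show "threshold n \<le> 1" using n gap_exponent_bounds powr_mono[of "gap_exponent - 1" 0 "real n"] by (simp add: threshold_def)
      show "0 < threshold n" using n by (simp add: threshold_def)
      show "0 < loss n" unfolding loss_def by simp
      have "1 < (real (main_phase n) + 2)\<^sup>2" by (rule one_less_power) auto
      then show "loss n < 1" by (simp add: loss_def)
      show "1 \<le> main_phase n + branches" using branches_bounds by simp
    qed (use n elim in \<open>auto simp: node_bound_def\<close>)
    also have "\<dots> \<le> fact n * (4 * real n * (1 / (real n)\<^sup>2 + sqrt (1 / 2) powr sqrt (real n)) + 1 / real n)"
    proof (intro mult_left_mono add_left_mono)
      have "real n * branch_error branches n ^ branches \<le> real n * (real n powr (- gap_exponent / 2)) ^ branches"
        using elim by (intro mult_left_mono power_mono) auto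
      also have "\<dots> = real n powr 1 * real n powr (real branches * (- gap_exponent / 2))"
        using n by (simp add: powr_power)
      also have "\<dots> = real n powr (1 - real branches * gap_exponent / 2)"
        unfolding powr_add[symmetric] by simp
      also have "\<dots> \<le> real n powr (- 1)"
        using n branches_bounds by (intro powr_mono) auto
      also have "\<dots> = 1 / real n" using n by (simp add: powr_minus_divide)
      finally show "real n * branch_error branches n ^ branches \<le> 1 / real n" .
    qed auto
    finally show ?case .
  qed
qed

theorem proposition8p3:
  fixes \<epsilon> :: real
  assumes "0 < \<epsilon>" and "\<epsilon> < 1"
  shows "\<exists>C :: real.
    (\<lambda>n. measure_pmf.prob (random_permutation_mat n)
       {Q. ereal_of_enat (t_mix (uniform_dist n) (P_bar (uniform_dist n) (srw n) Q) \<epsilon>)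
             \<le> ereal (ln (real n) / ln 2 + C * sqrt (ln (real n)))})
    \<longlonglongrightarrow> 1"
proof (rule exI[of _ 0])
  let ?A = "\<lambda>n. {Q. ereal_of_enat (t_mix (uniform_dist n) (P_bar (uniform_dist n) (srw n) Q) \<epsilon>)
      \<le> ereal (ln (real n) / ln 2 + 0 * sqrt (ln (real n)))}"
  let ?e = "\<lambda>n. 4 * real n * (1 / (real n)\<^sup>2 + sqrt (1 / 2) powr sqrt (real n)) + 1 / real n"
  show "(\<lambda>n. measure_pmf.prob (random_permutation_mat n) (?A n)) \<longlonglongrightarrow> 1"
  proof (rule tendsto_sandwich)
    show "\<forall>\<^sub>F n in sequentially. 1 - ?e n \<le> measure_pmf.prob (random_permutation_mat n) (?A n)"
      using eventually_card_not_uniformly_close[OF assms(1)] eventually_ge_at_top[of 2]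
    proof eventually_elim
      case (elim n)
      let ?P = "{\<psi>. \<psi> permutes {..<n}}"
      let ?bad = "{\<psi>. \<psi> permutes {..<n} \<and> \<not> uniformly_close n (mixing_time n) \<epsilon> \<psi>}"
      let ?good = "{\<psi>. \<psi> permutes {..<n} \<and> permutation_mat n \<psi> \<in> ?A n}"
      have fin: "finite ?P" by (simp add: finite_permutations)
      have "\<psi> \<in> ?good" if \<psi>: "\<psi> permutes {..<n}" "uniformly_close n (mixing_time n) \<epsilon> \<psi>" for \<psi>
      proof -
        \<comment> \<open>\<open>uniformly_close\<close> with \<epsilon> bounds twice the total
          variation distance, which is thus at most \<epsilon> / 2 and strictly below
          \<epsilon>.\<close>
        have "t_mix (uniform_dist n) (P_bar (uniform_dist n) (srw n) (permutation_mat n \<psi>)) \<epsilon> \<le> enat (mixing_time n)"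
          using \<psi>(2) assms(1) by (intro t_mix_le[OF elim(2) \<psi>(1), of "\<epsilon> / 2"]) (auto simp: uniformly_close_def)
        then have "ereal_of_enat (t_mix (uniform_dist n) (P_bar (uniform_dist n) (srw n) (permutation_mat n \<psi>)) \<epsilon>)
            \<le> ereal_of_enat (enat (mixing_time n))" by (simp only: ereal_of_enat_le_iff)
        also have "\<dots> \<le> ereal (ln (real n) / ln 2 + 0 * sqrt (ln (real n)))"
          using mixing_time_le[of n] elim(2) by simp
        finally show ?thesis using \<psi>(1) by simp
      qed
      then have "?P \<subseteq> ?good \<union> ?bad" by blast
      then have "card ?P \<le> card (?good \<union> ?bad)"
        by (intro card_mono finite_subset[OF _ fin]) auto
      also have "\<dots> \<le> card ?good + card ?bad" by (rule card_Un_le)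
      finally have "fact n \<le> card ?good + card ?bad" using card_permutations[of "{..<n}" n] by simp
      then have "real (fact n) \<le> real (card ?good + card ?bad)" by (rule of_nat_mono)
      then have "fact n \<le> real (card ?good) + real (card ?bad)" by (simp only: of_nat_fact of_nat_add)
      then have "fact n \<le> real (card ?good) + fact n * ?e n" using elim(1) by linarith
      then have "fact n * (1 - ?e n) \<le> real (card ?good)" by (simp only: right_diff_distrib mult_1_right)
      then have "1 - ?e n \<le> real (card ?good) / fact n"
        by (subst pos_le_divide_eq) (simp_all only: fact_gt_zero mult.commute)
      then show ?case unfolding random_permutation_mat_prob .
    qed
    have "?e \<longlonglongrightarrow> 0" by real_asymp
    then show "(\<lambda>n. 1 - ?e n) \<longlonglongrightarrow> 1" using tendsto_diff[of "\<lambda>_. 1" 1 sequentially ?e 0] by simp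
  qed auto
qed

end
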